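(* Let $n=3$ and $s_0,s_1,s_2,b_0,b_1,b_2\in\mathbb{R}$, $S=s_0+s_1+s_2$. Assume that the 21 conditions (C1)–(C21) hold, and that the following rules hold: (R1) It is not the case that both $b_0+b_1+b_2=\tfrac12$ and $b_0+b_1+b_2=\max(b_0,b_1,b_2)$. (R2) For each $j\in\{0,1,2\}$: at most one of the following four inequalities is an equality: (E1) $S\ge 2-(b_0+b_1+b_2)$; (E2) $S\ge \tfrac32+\max(-b_0-b_1,-b_0-b_2,-b_1-b_2)$; (E3) $S\ge 1+\max(-b_0,-b_1,-b_2,0)$; (E4$_j$) $S\ge s_j+\max(0,-b_j)$. (R3) For each $j\in\{0,1,2\}$: at most one of the following five inequalities is an equality: (E1), (E2), (E3), (E5$_j$) $S\ge \tfrac34+\tfrac{s_j-b_j}{2}$, (E6$_j$) $S\ge s_j$. Then $\begin{pmatrix} s_0 & s_1 & s_2\\ b_0 & b_1 & b_2\end{pmatrix}$ is a product.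
   Context: For $u\in\mathcal S(\mathbb{R}^{1+n})$ let $\widetilde u(\tau,\xi)=\iint e^{-i(t\tau+x\cdot\xi)}u(t,x)\,dt\,dx$, $(\tau,\xi)\in\mathbb{R}\times\mathbb{R}^n$, and $\langle x\rangle=(1+|x|^2)^{1/2}$. For $s,b\in\mathbb{R}$ the wave-Sobolev space $H^{s,b}=H^{s,b}(\mathbb{R}^{1+n})$ is the completion of $\mathcal S(\mathbb{R}^{1+n})$ with respect to the norm $\|u\|_{H^{s,b}}=\|\langle\xi\rangle^s\langle|\tau|-|\xi|\rangle^b\widetilde u(\tau,\xi)\|_{L^2_{\tau,\xi}}$. A real matrix $\begin{pmatrix} s_0 & s_1 & s_2\\ b_0 & b_1 & b_2\end{pmatrix}$ is called a product (in dimension $n$) if there is a constant $C$ such that $\|uv\|_{H^{-s_0,-b_0}}\le C\|u\|_{H^{s_1,b_1}}\|v\|_{H^{s_2,b_2}}$ for all $u,v\in\mathcal S(\mathbb{R}^{1+n})$. With $S=s_0+s_1+s_2$, the conditions (C1)–(C21) for $n=3$ are: (C1) $b_0+b_1+b_2\ge\frac12$; (C2) $b_0+b_1\ge0$; (C3) $b_0+b_2\ge0$; (C4) $b_1+b_2\ge0$; (C5) $S\ge 2-(b_0+b_1+b_2)$; (C6) $S\ge\frac32-(b_0+b_1)$; (C7) $S\ge\frac32-(b_0+b_2)$; (C8) $S\ge\frac32-(b_1+b_2)$; (C9) $S\ge1-b_0$; (C10) $S\ge1-b_1$; (C11) $S\ge 1-b_2$; (C12) $S\ge1$; (C13) $s_0+b_0+2s_1+2s_2\ge\frac32$;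 (C14) $2s_0+s_1+b_1+2s_2\ge\frac32$; (C15) $2s_0+2s_1+s_2+b_2\ge\frac32$; (C16) $s_1+s_2\ge-b_0$; (C17) $s_0+s_2\ge-b_1$; (C18) $s_0+s_1\ge-b_2$; (C19) $s_1+s_2\ge0$; (C20) $s_0+s_2\ge0$; (C21) $s_0+s_1\ge0$. *)

theory Defs
  imports "HOL-Analysis.Analysis"
begin

text \<open>Space-time R^{1+3} is modelled as real \<times> real^3; points are (t,x), frequencies (tau,xi).\<close>

type_synonym st = "real \<times> (real ^ 3)"

fun iter_deriv :: "(st \<Rightarrow> complex) \<Rightarrow> st list \<Rightarrow> st \<Rightarrow> complex" where
  "iter_deriv f [] = f"
| "iter_deriv f (v # vs) = (\<lambda>z. frechet_derivative (iter_deriv f vs) (at z) v)"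

definition schwartz :: "(st \<Rightarrow> complex) \<Rightarrow> bool" where
  "schwartz f \<longleftrightarrow>
     (\<forall>vs z. iter_deriv f vs differentiable (at z)) \<and>
     (\<forall>vs (N::nat). \<exists>C. \<forall>z. (1 + norm z) ^ N * norm (iter_deriv f vs z) \<le> C)"

definition ft :: "(st \<Rightarrow> complex) \<Rightarrow> st \<Rightarrow> complex" where
  "ft u = (\<lambda>(\<tau>, \<xi>). integral\<^sup>L lborel
            (\<lambda>(t, x). cis (- (t * \<tau> + x \<bullet> \<xi>)) * u (t, x)))"

definition jbr :: "real \<Rightarrow> real" where
  "jbr r = sqrt (1 + r\<^sup>2)"

text \<open>Squared H^{s,b} norm (as an extended nonnegative real, to avoid integrability side issues).\<close>
definition hsb_sq :: "real \<Rightarrow> real \<Rightarrow> (st \<Rightarrow> complex) \<Rightarrow> ennreal" where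
  "hsb_sq s b u = (\<integral>\<^sup>+ p. ennreal
      ((jbr (norm (snd p)) powr s * jbr (\<bar>fst p\<bar> - norm (snd p)) powr b * cmod (ft u p))\<^sup>2) \<partial>lborel)"

text \<open>The matrix (s0 s1 s2; b0 b1 b2) is a product: ||uv||_{H^{-s0,-b0}} \<le> C ||u||_{H^{s1,b1}} ||v||_{H^{s2,b2}};
  stated equivalently with squared norms (the constant C here plays the role of C^2).\<close>
definition is_product :: "real \<Rightarrow> real \<Rightarrow> real \<Rightarrow> real \<Rightarrow> real \<Rightarrow> real \<Rightarrow> bool" where
  "is_product s0 s1 s2 b0 b1 b2 \<longleftrightarrow>
     (\<exists>C::real. \<forall>u v. schwartz u \<longrightarrow> schwartz v \<longrightarrow>
        hsb_sq (- s0) (- b0) (\<lambda>p. u p * v p) \<le> ennreal C * hsb_sq s1 b1 u * hsb_sq s2 b2 v)"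

definition at_most_one :: "bool list \<Rightarrow> bool" where
  "at_most_one ps \<longleftrightarrow> length (filter id ps) \<le> 1"

end

theory Submission
  imports Defs "HOL-Probability.Probability"
begin

text \<open>By duality the product estimate is a bound for the trilinear form \<open>\<integral>\<integral> w F(p) G(q) H(r)\<close> over \<open>p + q + r = 0\<close>.
  Split each variable into dyadic blocks \<open>\<langle>\<xi>\<rangle> \<sim> 2\<^sup>n\<close>, \<open>\<langle>\<bar>\<tau>\<bar> - \<bar>\<xi>\<bar>\<rangle> \<sim> 2\<^sup>l\<close>. On a block, Cauchy--Schwarz reduces the estimate to the
  volume of an intersection of two thickened cones; when the output frequency is low the two waves are first localised to balls
  by averaging, and one factor is reflected. The admissible index vectors form finitely many polyhedral cones. In suitable
  integral coordinates \<open>t\<^sub>r \<ge> 0\<close> of such a cone the exponent is \<open>- \<Sum> k\<^sub>r t\<^sub>r\<close>, where every \<open>k\<^sub>r\<close> is the slack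
  of one of the 21 conditions. The coordinates with positive slack are summed geometrically. By the rules at most one slack
  vanishes, up to a few compatible pairs, and along the remaining directions the sum is controlled by Cauchy--Schwarz because moving
  along them changes both the third index and the pair of the first two. If some \<open>b\<^sub>j = 0\<close> and \<open>S = 1\<close>, or two of the
  \<open>b\<^sub>j\<close> vanish and \<open>S > 3/2\<close>, too many slacks may vanish; then the modulations with exponent \<open>0\<close> are not decomposed at all.\<close>

subsection \<open>Fourier transforms of Schwartz functions\<close>

text \<open>On a block with n1 much larger than n0, fixing the output makes the cone intersection
  too large by a factor of about 2^(n1 - n0): its volume is divided by the size of the fixed
  frequency, which is only 2^n0. After localisation to opposite balls the two waves have nearly
  opposite frequencies, so reflecting one of them replaces the fixed frequency by about twice the
  first one. The price is that the reflection forgets on which time sides the waves lie. If both lie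
  on the same side, a sharper bound without reflection holds; it serves where the output modulation
  is comparable to n1. Some walls between the cones are places where two volume bounds agree.
  \<open>C13\<close> originates there: it belongs to the ray n0 = l0 = t, n1 = n2 = 2 t, on which
  the bounds in (l1, l2) and in (l0, l1) coincide. A vanishing slack would make the geometric series
  along its ray diverge. Square summability of the blocks of the three functions takes the place of
  decay there, so a free ray has to be visible both in the third index and in the first two.\<close>

lemma nn_integral_decay_finite:
  "(\<integral>\<^sup>+z. ennreal (1 / (1 + norm (z::st)) ^ 6) \<partial>lborel) < \<infinity>"
proof -
  define c where "c = unit_ball_vol (real DIM(st))"
  have c: "c \<ge> 0" by (simp add: c_def)
  have dim: "DIM(st) = 4" by simp
  have "(\<integral>\<^sup>+z. ennreal (1 / (1 + norm (z::st)) ^ 6) \<partial>lborel)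
      \<le> (\<integral>\<^sup>+z. (\<Sum>k. ennreal (1 / (1 + real k) ^ 6) * indicator (ball 0 (real k + 1)) (z::st)) \<partial>lborel)"
  proof (rule nn_integral_mono)
    fix z :: st
    define k where "k = nat \<lfloor>norm z\<rfloor>"
    have k: "real k \<le> norm z" "norm z < real k + 1"
      unfolding k_def by (auto simp: of_nat_nat)
    have "ennreal (1 / (1 + norm z) ^ 6) \<le> ennreal (1 / (1 + real k) ^ 6)"
      using k by (intro ennreal_leI divide_left_mono power_mono mult_pos_pos zero_less_power) auto
    also have "\<dots> = (\<Sum>k\<in>{k}. ennreal (1 / (1 + real k) ^ 6) * indicator (ball 0 (real k + 1)) z)"
      using k by simp
    also have "\<dots> \<le> (\<Sum>k. ennreal (1 / (1 + real k) ^ 6) * indicator (ball 0 (real k + 1)) z)"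
      by (rule sum_le_suminf) auto
    finally show "ennreal (1 / (1 + norm z) ^ 6) \<le> \<dots>" .
  qed
  also have "\<dots> = (\<Sum>k. ennreal (1 / (1 + real k) ^ 6) * emeasure lborel (ball (0::st) (real k + 1)))"
  proof -
    have [measurable]: "ball (0::st) r \<in> sets borel" for r by simp
    show ?thesis by (subst nn_integral_suminf) (simp_all add: nn_integral_cmult_indicator)
  qed
  \<comment> \<open>The exponent 6 is the dimension 4 plus 2: a ball of radius k + 1 has volume of
    order (k + 1)^4, which leaves the convergent series of inverse squares.\<close>
  also have "\<dots> = (\<Sum>k. ennreal (c * (1 / (real (Suc k))^2)))"
  proof (rule suminf_cong)
    fix k
    define x where "x = 1 + real k"
    have x: "x > 0" by (simp add: x_def)
    have "x ^ 6 = x ^ 4 * x ^ 2" by (simp flip: power_add)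
    then have xx: "1 / x ^ 6 * (c * x ^ 4) = c * (1 / x ^ 2)" using x by (simp add: field_simps)
    have e: "emeasure lborel (ball (0::st) (real k + 1)) = ennreal (c * x ^ 4)"
      by (subst emeasure_ball) (simp_all add: dim c_def x_def add.commute power4_eq_xxxx mult.assoc)
    have "ennreal (1 / (1 + real k) ^ 6) * emeasure lborel (ball (0::st) (real k + 1))
        = ennreal (1 / x ^ 6 * (c * x ^ 4))"
      unfolding e using x c by (subst ennreal_mult) (auto simp: x_def)
    also have "1 / x ^ 6 * (c * x ^ 4) = c * (1 / (real (Suc k))^2)"
      unfolding xx by (simp add: x_def add.commute)
    finally show "ennreal (1 / (1 + real k) ^ 6) * emeasure lborel (ball (0::st) (real k + 1))
        = ennreal (c * (1 / (real (Suc k))^2))" .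
  qed
  also have "\<dots> < \<infinity>"
  proof -
    have "summable (\<lambda>k. 1 / (real (Suc k))^2)"
      using inverse_power_summable[of 2, where 'a=real]
      by (subst summable_Suc_iff) (simp add: inverse_eq_divide)
    then have "summable (\<lambda>k. c * (1 / (real (Suc k))^2))" by (rule summable_mult)
    then show ?thesis using c
      by (subst suminf_ennreal2) auto
  qed
  finally show ?thesis .
qed

lemma integrable_decay:
  fixes f :: "st \<Rightarrow> complex"
  assumes [measurable]: "f \<in> borel_measurable borel"
    and C: "\<And>z. (1 + norm z) ^ 6 * norm (f z) \<le> C"
  shows "integrable lborel f"
proof (rule integrableI_bounded)
  show "f \<in> borel_measurable lborel" by simp
  have C0: "C \<ge> 0" using order_trans[OF norm_ge_zero[of "f 0"], of C] C[of 0] by simp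
  have "(\<integral>\<^sup>+z. ennreal (norm (f z)) \<partial>lborel) \<le> (\<integral>\<^sup>+z. ennreal C * ennreal (1 / (1 + norm (z::st)) ^ 6) \<partial>lborel)"
  proof (rule nn_integral_mono)
    fix z
    have "norm (f z) \<le> C * (1 / (1 + norm z)^6)"
      using C[of z] by (subst times_divide_eq_right, subst pos_le_divide_eq[OF zero_less_power[OF add_pos_nonneg]]) (simp_all add: mult.commute)
    then show "ennreal (norm (f z)) \<le> ennreal C * ennreal (1 / (1 + norm (z::st)) ^ 6)"
      using C0 by (simp add: ennreal_mult[symmetric] ennreal_leI)
  qed
  also have "\<dots> = ennreal C * (\<integral>\<^sup>+z. ennreal (1 / (1 + norm (z::st)) ^ 6) \<partial>lborel)"
    by (rule nn_integral_cmult) simp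
  also have "\<dots> < \<infinity>" using nn_integral_decay_finite by (simp add: ennreal_mult_less_top)
  finally show "(\<integral>\<^sup>+z. ennreal (norm (f z)) \<partial>lborel) < \<infinity>" .
qed

definition dderiv :: "st \<Rightarrow> (st \<Rightarrow> complex) \<Rightarrow> st \<Rightarrow> complex" where
  "dderiv v f = (\<lambda>z. frechet_derivative f (at z) v)"

lemma iter_deriv_dderiv: "iter_deriv (dderiv v f) vs = iter_deriv f (vs @ [v])"
  by (induction vs) (auto simp: dderiv_def)

lemma schwartz_dderiv: "schwartz f \<Longrightarrow> schwartz (dderiv v f)"
  unfolding schwartz_def iter_deriv_dderiv by blast

lemma schwartz_differentiable: "schwartz f \<Longrightarrow> f differentiable (at z)"
  unfolding schwartz_def by (metis iter_deriv.simps(1))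

lemma schwartz_decay: "schwartz f \<Longrightarrow> \<exists>C. \<forall>z. (1 + norm z) ^ N * norm (f z) \<le> C"
  unfolding schwartz_def by (metis iter_deriv.simps(1))

lemma schwartz_measurable: "schwartz f \<Longrightarrow> f \<in> borel_measurable borel"
  by (intro borel_measurable_continuous_onI differentiable_imp_continuous_on)
     (auto simp: differentiable_on_def intro: schwartz_differentiable differentiable_at_withinI)

lemma schwartz_integrable: "schwartz f \<Longrightarrow> integrable lborel f"
  using integrable_decay schwartz_measurable schwartz_decay by metis

lemma schwartz_bounded: "schwartz f \<Longrightarrow> \<exists>C. \<forall>z. norm (f z) \<le> C"
  using schwartz_decay[of f 0] by simp

lemma ft_eq: "ft u p = (\<integral>z. cis (- (z \<bullet> p)) * u z \<partial>lborel)"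
  by (cases p) (simp add: ft_def inner_prod_def case_prod_unfold)

lemma measurable_cis [measurable]: "cis \<in> borel_measurable borel"
  by (intro borel_measurable_continuous_onI continuous_intros)

lemma integrable_cis_mult:
  fixes f :: "st \<Rightarrow> complex"
  assumes "integrable lborel f" and [measurable]: "g \<in> borel_measurable borel"
  shows "integrable lborel (\<lambda>z. cis (g z) * f z)"
  using assms(1) borel_measurable_integrable[OF assms(1)] by - (rule Bochner_Integration.integrable_bound, auto simp: norm_mult)

lemma norm_ft_le: "norm (ft u p) \<le> (\<integral>z. norm (u z) \<partial>lborel)"
  unfolding ft_eq by (rule order_trans[OF integral_norm_bound]) (simp add: norm_mult)

lemma ft_measurable:
  assumes [measurable]: "u \<in> borel_measurable borel"
  shows "ft u \<in> borel_measurable borel"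
proof -
  have "(\<lambda>p. \<integral>z. cis (- (z \<bullet> p)) * u z \<partial>lborel) \<in> borel_measurable borel"
    by (rule lborel.borel_measurable_lebesgue_integral) measurable
  then show ?thesis by (simp add: ft_eq[abs_def])
qed

lemma integral_translate:
  fixes f :: "st \<Rightarrow> complex"
  assumes [measurable]: "f \<in> borel_measurable borel"
  shows "(\<integral>z. f (a + z) \<partial>lborel) = (\<integral>z. f z \<partial>lborel)"
  by (subst (2) lborel_distr_plus[of a, symmetric], subst integral_distr) auto

text \<open>Mean value inequality along the segment from z to z + h v. Since h is at most 1, the
  decay of the derivative at an intermediate point passes to z through 1 + |z| \<le> (1 + |z + s v|)
  (1 + |v|). The difference quotient thus has an integrable majorant independent of h, as dominated
  convergence requires.\<close>

lemma schwartz_difference_bound: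
  assumes f: "schwartz f"
  shows "\<exists>C. \<forall>z h. 0 < h \<and> h \<le> 1 \<longrightarrow>
     norm (f (z + h *\<^sub>R v) - f z) \<le> h * (C / (1 + norm z)^6)"
proof -
  obtain C where C: "\<And>z. (1 + norm z) ^ 6 * norm (dderiv v f z) \<le> C"
    using schwartz_decay[OF schwartz_dderiv[OF f]] by blast
  have "norm (f (z + h *\<^sub>R v) - f z) \<le> h * (C * (1 + norm v)^6 / (1 + norm z)^6)" if h: "0 < h" "h \<le> 1" for z h
  proof -
    define B where "B = C * (1 + norm v)^6 / (1 + norm z)^6"
    have der: "((\<lambda>s. f (z + s *\<^sub>R v)) has_derivative (\<lambda>t. t *\<^sub>R dderiv v f (z + s *\<^sub>R v))) (at s within {0..h})" for s
    proof -
      have "(f has_derivative frechet_derivative f (at (z + s *\<^sub>R v))) (at (z + s *\<^sub>R v))"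
        using schwartz_differentiable[OF f] frechet_derivative_works by blast
      moreover have "((\<lambda>s. z + s *\<^sub>R v) has_derivative (\<lambda>t. t *\<^sub>R v)) (at s within {0..h})"
        by (auto intro!: derivative_eq_intros)
      ultimately have "((\<lambda>s. f (z + s *\<^sub>R v)) has_derivative (\<lambda>t. frechet_derivative f (at (z + s *\<^sub>R v)) (t *\<^sub>R v))) (at s within {0..h})"
        by (rule has_derivative_compose[rotated])
      moreover have "linear (frechet_derivative f (at (z + s *\<^sub>R v)))"
        using schwartz_differentiable[OF f] linear_frechet_derivative by blast
      ultimately show ?thesis by (simp add: dderiv_def linear_cmul)
    qed
    have bd: "norm (dderiv v f (z + s *\<^sub>R v)) \<le> B" if "s \<in> {0..h}" for s
    proof -
      have "norm z \<le> norm (z + s *\<^sub>R v) + norm (s *\<^sub>R v)"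
        by (metis add_diff_cancel_right' norm_triangle_ineq4)
      also have "norm (s *\<^sub>R v) \<le> norm v" using that h
        by (simp add: mult_left_le_one_le)
      finally have "1 + norm z \<le> (1 + norm (z + s *\<^sub>R v)) * (1 + norm v)"
        using mult_nonneg_nonneg[OF norm_ge_zero[of v] norm_ge_zero[of "z + s *\<^sub>R v"]]
        unfolding distrib_left distrib_right mult_1_left mult_1_right
        by (simp only: mult.commute) linarith
      then have "(1 + norm z)^6 \<le> (1 + norm (z + s *\<^sub>R v))^6 * (1 + norm v)^6"
        by (metis norm_ge_zero add_nonneg_nonneg power_mono power_mult_distrib zero_le_one)
      then have "(1 + norm z)^6 * norm (dderiv v f (z + s *\<^sub>R v)) \<le>
         ((1 + norm (z + s *\<^sub>R v))^6 * (1 + norm v)^6) * norm (dderiv v f (z + s *\<^sub>R v))"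
        by (rule mult_right_mono) simp
      also have "\<dots> = ((1 + norm (z + s *\<^sub>R v))^6 * norm (dderiv v f (z + s *\<^sub>R v))) * (1 + norm v)^6"
        by (simp add: mult_ac)
      also have "\<dots> \<le> C * (1 + norm v)^6"
        by (intro mult_right_mono C) simp
      finally show ?thesis unfolding B_def
        by (subst pos_le_divide_eq[OF zero_less_power[OF add_pos_nonneg]]) (simp_all add: mult.commute)
    qed
    have "norm (f (z + h *\<^sub>R v) - f (z + 0 *\<^sub>R v)) \<le> B * norm (h - 0)"
    proof (rule differentiable_bound[OF _ der])
      show "onorm (\<lambda>t. t *\<^sub>R dderiv v f (z + s *\<^sub>R v)) \<le> B" if "s \<in> {0..h}" for s
      proof (rule onorm_bound)
        show "0 \<le> B" by (rule order_trans[OF norm_ge_zero bd[OF that]])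
        show "norm (t *\<^sub>R dderiv v f (z + s *\<^sub>R v)) \<le> B * norm t" for t
          using mult_right_mono[OF bd[OF that], of "norm t"] by (simp add: mult.commute)
      qed
    qed (use h in auto)
    then show ?thesis using h by (simp add: B_def mult.commute)
  qed
  then show ?thesis by blast
qed

lemma has_vector_derivative_quotient_tendsto:
  fixes g :: "real \<Rightarrow> complex"
  assumes "(g has_vector_derivative D) (at 0)"
  shows "((\<lambda>s. (g s - g 0) / of_real s) \<longlongrightarrow> D) (at 0)"
proof -
  have "(\<lambda>s. norm (g s - g 0 - s *\<^sub>R D) / norm s) \<midarrow>0\<rightarrow> 0"
    using assms by (simp add: has_vector_derivative_def has_derivative_at)
  then have "(\<lambda>s. norm ((g s - g 0) / of_real s - D)) \<midarrow>0\<rightarrow> 0"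
  proof (rule Lim_transform_eventually)
    show "\<forall>\<^sub>F s in at 0. norm (g s - g 0 - s *\<^sub>R D) / norm s = norm ((g s - g 0) / of_real s - D)"
      unfolding eventually_at
    proof (intro exI[of _ 1] conjI ballI impI)
      fix s :: real assume "s \<noteq> 0 \<and> dist s 0 < 1"
      then have "(g s - g 0) / of_real s - D = (g s - g 0 - s *\<^sub>R D) / of_real s"
        by (simp add: scaleR_conv_of_real field_simps)
      then show "norm (g s - g 0 - s *\<^sub>R D) / norm s = norm ((g s - g 0) / of_real s - D)"
        by (simp add: norm_divide)
    qed simp
  qed
  then show ?thesis
    by (rule LIM_zero_cancel[OF tendsto_norm_zero_cancel])
qed

text \<open>Instead of integrating by parts, one transforms the difference quotient: translation by
  h v multiplies the transform by \<open>cis (h * (v \<bullet> p))\<close>. Then h tends to 0, under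
  the integral by dominated convergence and in the factor by differentiating the
  exponential.\<close>

lemma ft_dderiv:
  assumes f: "schwartz f"
  shows "ft (dderiv v f) p = \<i> * of_real (v \<bullet> p) * ft f p"
proof -
  define h :: "nat \<Rightarrow> real" where "h n = 1 / real (Suc n)" for n
  have h: "0 < h n" "h n \<le> 1" for n by (auto simp: h_def)
  have h0: "h \<longlonglongrightarrow> 0" unfolding h_def by (rule LIMSEQ_Suc[OF lim_1_over_n])
  have h0': "filterlim h (at 0) sequentially"
    using h0 h by (auto simp: filterlim_at intro!: always_eventually) (metis less_irrefl)
  have [measurable]: "f \<in> borel_measurable borel" "dderiv v f \<in> borel_measurable borel"
    using f schwartz_dderiv schwartz_measurable by auto
  obtain C where C: "\<And>z h. 0 < h \<Longrightarrow> h \<le> 1 \<Longrightarrow> norm (f (z + h *\<^sub>R v) - f z) \<le> h * (C / (1 + norm z)^6)"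
    using schwartz_difference_bound[OF f, of v] by auto
  have C0: "C \<ge> 0" using C[of 1 0] norm_ge_zero[of "f (0 + 1 *\<^sub>R v) - f 0"] by (simp del: norm_ge_zero)
  have int: "integrable lborel f" by (rule schwartz_integrable[OF f])
  have dq: "((\<lambda>n. (f (z + h n *\<^sub>R v) - f z) / of_real (h n)) \<longlonglongrightarrow> dderiv v f z)" for z
  proof -
    have "(f has_derivative frechet_derivative f (at z)) (at z)"
      using schwartz_differentiable[OF f] frechet_derivative_works by blast
    then have "(f has_derivative frechet_derivative f (at z)) (at (z + 0 *\<^sub>R v))" by simp
    moreover have "((\<lambda>s. z + s *\<^sub>R v) has_derivative (\<lambda>t. t *\<^sub>R v)) (at 0)"
      by (auto intro!: derivative_eq_intros)
    ultimately have "((\<lambda>s. f (z + s *\<^sub>R v)) has_derivative (\<lambda>t. frechet_derivative f (at z) (t *\<^sub>R v))) (at 0)"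
      by (rule has_derivative_compose[rotated])
    moreover have "linear (frechet_derivative f (at z))"
        using schwartz_differentiable[OF f] linear_frechet_derivative by blast
    ultimately have "((\<lambda>s. f (z + s *\<^sub>R v)) has_vector_derivative dderiv v f z) (at 0)"
      by (simp add: dderiv_def linear_cmul has_vector_derivative_def)
    from filterlim_compose[OF has_vector_derivative_quotient_tendsto[OF this] h0'] show ?thesis by simp
  qed
  have lim1: "(\<lambda>n. \<integral>z. cis (- (z \<bullet> p)) * ((f (z + h n *\<^sub>R v) - f z) / of_real (h n)) \<partial>lborel)
      \<longlonglongrightarrow> ft (dderiv v f) p"
    unfolding ft_eq
  proof (rule integral_dominated_convergence)
    show "integrable lborel (\<lambda>z::st. C * (1 / (1 + norm z)^6))"
      using nn_integral_decay_finite
      by (intro integrable_mult_right integrableI_bounded) auto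
    show "AE z in lborel. (\<lambda>n. cis (- (z \<bullet> p)) * ((f (z + h n *\<^sub>R v) - f z) / of_real (h n)))
        \<longlonglongrightarrow> cis (- (z \<bullet> p)) * dderiv v f z"
      by (intro AE_I2 tendsto_intros dq)
    show "AE z in lborel. norm (cis (- (z \<bullet> p)) * ((f (z + h n *\<^sub>R v) - f z) / of_real (h n)))
        \<le> C * (1 / (1 + norm z)^6)" for n
      using C[OF h(1) h(2)] h(1)[of n]
      by (intro AE_I2) (auto simp: norm_mult norm_divide pos_divide_le_eq mult.commute)
  qed auto
  have lim2: "(\<lambda>n. (cis (h n * (v \<bullet> p)) - 1) / of_real (h n)) \<longlonglongrightarrow> \<i> * of_real (v \<bullet> p)"
  proof -
    have "((\<lambda>x. exp (\<i> * (x * of_real (v \<bullet> p)))) has_field_derivative \<i> * of_real (v \<bullet> p)) (at (of_real 0))"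
      by (auto intro!: derivative_eq_intros)
    then have "((\<lambda>s. cis (s * (v \<bullet> p))) has_vector_derivative \<i> * of_real (v \<bullet> p)) (at 0)"
      by (drule_tac has_vector_derivative_real_field) (simp add: cis_conv_exp)
    from filterlim_compose[OF has_vector_derivative_quotient_tendsto[OF this] h0'] show ?thesis by simp
  qed
  have eq: "(\<integral>z. cis (- (z \<bullet> p)) * ((f (z + h n *\<^sub>R v) - f z) / of_real (h n)) \<partial>lborel)
      = (cis (h n * (v \<bullet> p)) - 1) / of_real (h n) * ft f p" for n
  proof -
    have i1: "integrable lborel (\<lambda>z. cis (- (z \<bullet> p)) * f z)"
      using int by (rule integrable_cis_mult) simp
    have i2: "integrable lborel (\<lambda>z. cis (- (z \<bullet> p)) * f (h n *\<^sub>R v + z))"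
    proof (rule integrable_cis_mult)
      have "integrable (distr lborel borel ((+) (h n *\<^sub>R v))) f" using int by (simp add: lborel_distr_plus)
      then show "integrable lborel (\<lambda>z. f (h n *\<^sub>R v + z))" by (subst (asm) integrable_distr_eq) auto
    qed simp
    have "(\<integral>z. cis (- (z \<bullet> p)) * f (h n *\<^sub>R v + z) \<partial>lborel)
        = (\<integral>z. cis (h n * (v \<bullet> p)) * (cis (- ((h n *\<^sub>R v + z) \<bullet> p)) * f (h n *\<^sub>R v + z)) \<partial>lborel)"
      by (intro Bochner_Integration.integral_cong) (auto simp: mult.assoc[symmetric] cis_mult inner_simps)
    also have "\<dots> = cis (h n * (v \<bullet> p)) * ft f p"
      unfolding ft_eq
      by (subst integral_mult_right_zero, subst integral_translate[of "\<lambda>z. cis (- (z \<bullet> p)) * f z"]) auto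
    finally have *: "(\<integral>z. cis (- (z \<bullet> p)) * f (h n *\<^sub>R v + z) \<partial>lborel) = cis (h n * (v \<bullet> p)) * ft f p" .
    have "(\<integral>z. cis (- (z \<bullet> p)) * ((f (z + h n *\<^sub>R v) - f z) / of_real (h n)) \<partial>lborel)
      = (\<integral>z. (cis (- (z \<bullet> p)) * f (h n *\<^sub>R v + z) - cis (- (z \<bullet> p)) * f z) / of_real (h n) \<partial>lborel)"
      by (intro Bochner_Integration.integral_cong) (auto simp: algebra_simps)
    also have "\<dots> = (cis (h n * (v \<bullet> p)) * ft f p - ft f p) / of_real (h n)"
      using i1 i2 by (simp add: * ft_eq)
    finally show ?thesis by (simp add: algebra_simps)
  qed
  show ?thesis
    using LIMSEQ_unique[OF lim1[unfolded eq] tendsto_mult_right[OF lim2]] by simp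
qed

text \<open>Six derivatives in a coordinate direction b multiply the transform by a factor of
  modulus |p . b|^6, and the result is still bounded. Applied to the largest coordinate of p this
  gives decay of order 6, the order that \<open>integrable_decay\<close> asks for.\<close>

lemma ft_decay:
  assumes f: "schwartz f"
  shows "\<exists>C. \<forall>p. (1 + norm p) ^ 6 * norm (ft f p) \<le> C"
proof -
  have iter: "schwartz ((dderiv b ^^ n) f) \<and> ft ((dderiv b ^^ n) f) p = (\<i> * of_real (b \<bullet> p)) ^ n * ft f p" for b n p
    by (induction n) (use f in \<open>auto simp: schwartz_dderiv ft_dderiv\<close>)
  define K where "K b = (\<integral>z. norm ((dderiv b ^^ 6) f z) \<partial>lborel)" for b
  define K0 where "K0 = (\<integral>z. norm (f z) \<partial>lborel)"
  have K: "\<bar>p \<bullet> b\<bar> ^ 6 * norm (ft f p) \<le> K b" for b p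
    using norm_ft_le[of "(dderiv b ^^ 6) f" p] iter[where b=b and n=6 and p=p]
    by (simp add: K_def norm_mult norm_power inner_commute)
  have K0: "norm (ft f p) \<le> K0" for p using norm_ft_le by (simp add: K0_def)
  have "(1 + norm p) ^ 6 * norm (ft f p) \<le> 5 ^ 6 * (K0 + (\<Sum>b\<in>Basis. K b))" for p
  proof -
    define M where "M = Max (insert 1 ((\<lambda>b. \<bar>p \<bullet> b\<bar>) ` Basis))"
    have M1: "1 \<le> M" and Mb: "b \<in> Basis \<Longrightarrow> \<bar>p \<bullet> b\<bar> \<le> M" for b
      unfolding M_def by (rule Max_ge; auto)+
    have "norm p \<le> (\<Sum>b\<in>Basis. \<bar>p \<bullet> b\<bar>)" by (rule norm_le_l1)
    also have "\<dots> \<le> (\<Sum>b\<in>(Basis::st set). M)" by (intro sum_mono Mb)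
    also have "\<dots> = 4 * M" by simp
    \<comment> \<open>M is at least 1 and bounds each of the 4 coordinates, so 1 + |p| \<le> M + 4
      M.\<close>
    finally have "(1 + norm p)^6 \<le> (5 * M)^6" using M1 by (intro power_mono) auto
    also have "\<dots> = 5^6 * M^6" by (rule power_mult_distrib)
    finally have A: "(1 + norm p)^6 * norm (ft f p) \<le> 5^6 * (M^6 * norm (ft f p))"
      by (metis mult.assoc mult_right_mono norm_ge_zero)
    have Kn: "K b \<ge> 0" "K0 \<ge> 0" for b unfolding K_def K0_def by auto
    have "M \<in> insert 1 ((\<lambda>b. \<bar>p \<bullet> b\<bar>) ` Basis)" unfolding M_def by (rule Max_in) auto
    then have "M^6 * norm (ft f p) \<le> K0 + (\<Sum>b\<in>Basis. K b)"
    proof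
      assume "M = 1" then show ?thesis using K0[of p] Kn by (simp add: add_increasing2 sum_nonneg)
    next
      assume "M \<in> (\<lambda>b. \<bar>p \<bullet> b\<bar>) ` Basis"
      then obtain b where b: "b \<in> Basis" "M = \<bar>p \<bullet> b\<bar>" by auto
      have "M^6 * norm (ft f p) \<le> K b" using K b by simp
      also have "\<dots> \<le> (\<Sum>b\<in>Basis. K b)" using b Kn by (intro member_le_sum) auto
      finally show ?thesis using Kn(2) by simp
    qed
    then show ?thesis using A by simp
  qed
  then show ?thesis by blast
qed

lemma ft_integrable: "schwartz f \<Longrightarrow> integrable lborel (ft f)"
  using integrable_decay ft_measurable schwartz_measurable ft_decay by metis

section \<open>Gaussian regularisation and the inversion formula\<close>

lemma gauss_ft_1d:
  "integrable lborel (\<lambda>t::real. of_real (exp (- t\<^sup>2 / 2)) * cis (t * x))"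
  "(\<integral>t. of_real (exp (- t\<^sup>2 / 2)) * cis (t * x) \<partial>lborel) = of_real (sqrt (2 * pi) * exp (- x\<^sup>2 / 2))"
proof -
  have eq: "std_normal_density t *\<^sub>R iexp (x * t) = of_real (exp (- t\<^sup>2 / 2)) * cis (t * x) / of_real (sqrt (2 * pi))" for t
    by (simp add: std_normal_density_def scaleR_conv_of_real cis_conv_exp mult_ac)
  have n: "integrable lborel std_normal_density"
    by (rule integrable_normal_density) simp
  show int: "integrable lborel (\<lambda>t::real. of_real (exp (- t\<^sup>2 / 2)) * cis (t * x))"
  proof (rule Bochner_Integration.integrable_bound[OF integrable_mult_right[OF n, of "sqrt (2 * pi)"]])
    show "AE t in lborel. norm (complex_of_real (exp (- t\<^sup>2 / 2)) * cis (t * x)) \<le> norm (sqrt (2 * pi) * std_normal_density t)"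
      by (intro AE_I2) (simp add: norm_mult std_normal_density_def)
  qed measurable
  \<comment> \<open>The one-dimensional transform is the characteristic function of the standard
    normal distribution, freed of its normalisation.\<close>
  have "complex_of_real (exp (- x\<^sup>2 / 2)) = char std_normal_distribution x"
    by (simp add: char_std_normal_distribution)
  also have "\<dots> = (\<integral>t. std_normal_density t *\<^sub>R iexp (x * t) \<partial>lborel)"
    unfolding char_def by (subst integral_density) auto
  also have "\<dots> = (\<integral>t. of_real (exp (- t\<^sup>2 / 2)) * cis (t * x) \<partial>lborel) / of_real (sqrt (2 * pi))"
    unfolding eq by simp
  finally show "(\<integral>t. of_real (exp (- t\<^sup>2 / 2)) * cis (t * x) \<partial>lborel) = of_real (sqrt (2 * pi) * exp (- x\<^sup>2 / 2))"
    by (simp add: field_simps)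
qed

definition gauss :: "st \<Rightarrow> real" where "gauss z = exp (- (norm z)\<^sup>2 / 2)"

lemma gauss_measurable [measurable]: "gauss \<in> borel_measurable borel"
  unfolding gauss_def by measurable

text \<open>The Gaussian and the character are both products over the coordinates, and
  \<open>lborel\<close> on \<open>st\<close> is the image of a product measure, so the integral is a
  product of four one-dimensional ones. The four factors sqrt (2 \<pi>) give (2 \<pi>)^2.\<close>

lemma gauss_ft:
  "integrable lborel (\<lambda>z. of_real (gauss z) * cis (z \<bullet> p))"
  "(\<integral>z. of_real (gauss z) * cis (z \<bullet> p) \<partial>lborel) = of_real ((2 * pi)\<^sup>2 * gauss p)"
proof -
  define F where "F b t = complex_of_real (exp (- t\<^sup>2 / 2)) * cis (t * (b \<bullet> p))" for b :: st and t
  interpret product_sigma_finite "\<lambda>_::st. lborel :: real measure" ..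
  define T where "T f = (\<Sum>b\<in>Basis. f b *\<^sub>R b)" for f :: "st \<Rightarrow> real"
  have T [measurable]: "T \<in> measurable (\<Pi>\<^sub>M b\<in>Basis. lborel) borel"
    unfolding T_def by measurable
  have norm2: "(norm (T f))\<^sup>2 = (\<Sum>b\<in>Basis. (f b)\<^sup>2)" for f
  proof -
    have "T f \<bullet> b = f b" if "b \<in> Basis" for b using that by (simp add: T_def)
    then show ?thesis
      unfolding power2_norm_eq_inner by (subst euclidean_inner) (simp add: power2_eq_square)
  qed
  have eqF: "of_real (gauss (T f)) * cis (T f \<bullet> p) = (\<Prod>b\<in>Basis. F b (f b))" for f
  proof -
    have "cis (T f \<bullet> p) = (\<Prod>b\<in>Basis. cis (f b * (b \<bullet> p)))"
      by (simp add: T_def inner_sum_left cis_conv_exp exp_sum[symmetric] sum_distrib_left)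
    moreover have "complex_of_real (gauss (T f)) = (\<Prod>b\<in>Basis. of_real (exp (- (f b)\<^sup>2 / 2)))"
      by (simp add: gauss_def norm2 exp_sum[symmetric] sum_negf sum_divide_distrib flip: of_real_prod)
    ultimately show ?thesis by (simp add: F_def prod.distrib)
  qed
  have I: "integrable lborel (F b)" for b unfolding F_def by (rule gauss_ft_1d)
  have lb: "(lborel :: st measure) = distr (\<Pi>\<^sub>M b\<in>Basis. lborel) borel T"
    unfolding T_def by (rule lborel_eq)
  have P: "integrable (\<Pi>\<^sub>M b\<in>(Basis::st set). lborel) (\<lambda>f. \<Prod>b\<in>Basis. F b (f b))"
    by (rule product_integrable_prod) (auto intro: I)
  show "integrable lborel (\<lambda>z. of_real (gauss z) * cis (z \<bullet> p))"
    unfolding lb by (subst integrable_distr_eq) (auto simp: eqF P)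
  have "(\<integral>z. of_real (gauss z) * cis (z \<bullet> p) \<partial>lborel) = (\<integral>f. (\<Prod>b\<in>Basis. F b (f b)) \<partial>(\<Pi>\<^sub>M b\<in>(Basis::st set). lborel))"
    unfolding lb by (subst integral_distr) (auto simp: eqF)
  also have "\<dots> = (\<Prod>b\<in>(Basis::st set). integral\<^sup>L lborel (F b))"
    by (rule product_integral_prod) (auto intro: I)
  also have "\<dots> = (\<Prod>b\<in>(Basis::st set). of_real (sqrt (2 * pi) * exp (- (b \<bullet> p)\<^sup>2 / 2)))"
    unfolding F_def gauss_ft_1d ..
  also have "\<dots> = of_real ((sqrt (2 * pi)) ^ 4 * exp (\<Sum>b\<in>(Basis::st set). - (b \<bullet> p)\<^sup>2 / 2))"
    by (subst exp_sum) (simp_all add: prod.distrib)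
  also have "(\<Sum>b\<in>(Basis::st set). - (b \<bullet> p)\<^sup>2 / 2) = - (norm p)\<^sup>2 / 2"
    by (subst power2_norm_eq_inner)
       (simp add: euclidean_inner[of p] inner_commute power2_eq_square sum_negf sum_divide_distrib)
  also have "(sqrt (2 * pi)) ^ 4 = (2 * pi)\<^sup>2"
    by (simp add: power4_eq_xxxx power2_eq_square)
  finally show "(\<integral>z. of_real (gauss z) * cis (z \<bullet> p) \<partial>lborel) = of_real ((2 * pi)\<^sup>2 * gauss p)"
    by (simp add: gauss_def)
qed

lemma gauss_zero [simp]: "gauss 0 = 1" and gauss_minus [simp]: "gauss (- z) = gauss z"
  and gauss_pos: "gauss z > 0" and gauss_le_1: "gauss z \<le> 1"
  by (auto simp: gauss_def)

lemma gauss_integrable: "integrable lborel gauss"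
proof -
  have "integrable lborel (\<lambda>z. complex_of_real (gauss z))" using gauss_ft(1)[of 0] by simp
  then have "integrable lborel (\<lambda>z. norm (complex_of_real (gauss z)))" by (rule integrable_norm)
  then show ?thesis using gauss_pos by (simp add: less_imp_le)
qed

lemma gauss_integral: "(\<integral>z. gauss z \<partial>lborel) = (2 * pi)\<^sup>2"
  using gauss_ft(2)[of 0] by (simp add: integral_complex_of_real flip: of_real_power of_real_mult)

lemma lborel_scale:
  assumes "h > 0"
  shows "(lborel::st measure) = density (distr lborel borel (\<lambda>x. t + h *\<^sub>R x)) (\<lambda>_. h ^ 4)"
  using lborel_affine[of h t] assms by simp

lemma integral_scale:
  fixes f :: "st \<Rightarrow> complex"
  assumes [measurable]: "f \<in> borel_measurable borel" and h: "h > 0"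
  shows "(\<integral>z. f z \<partial>lborel) = of_real (h ^ 4) * (\<integral>z. f (t + h *\<^sub>R z) \<partial>lborel)"
  using h
  by (subst lborel_scale[OF h, of t], subst integral_density)
     (auto simp: integral_distr scaleR_conv_of_real)

lemma integrable_scale:
  fixes f :: "st \<Rightarrow> complex"
  assumes f: "integrable lborel f" and h: "h > 0"
  shows "integrable lborel (\<lambda>z. f (t + h *\<^sub>R z))"
proof -
  have [measurable]: "f \<in> borel_measurable borel" using borel_measurable_integrable[OF f] by simp
  have "integrable lborel (\<lambda>z. h ^ 4 *\<^sub>R f (t + h *\<^sub>R z))"
    using f h by (subst (asm) lborel_scale[OF h, of t], subst (asm) integrable_density)
       (auto simp: integrable_distr_eq)
  then have "integrable lborel (\<lambda>z. inverse (h ^ 4) *\<^sub>R (h ^ 4 *\<^sub>R f (t + h *\<^sub>R z)))"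
    by (rule integrable_scaleR_right)
  then show ?thesis using h by simp
qed

lemma integrable_prod_bound:
  fixes f g :: "st \<Rightarrow> complex" and F :: "st \<times> st \<Rightarrow> complex"
  assumes f: "integrable lborel f" and g: "integrable lborel g"
    and F: "F \<in> borel_measurable (borel \<Otimes>\<^sub>M borel)" and b: "\<And>x y. norm (F (x, y)) = norm (f x) * norm (g y)"
  shows "integrable (lborel \<Otimes>\<^sub>M lborel) F"
proof (rule lborel_pair.Fubini_integrable)
  have [measurable]: "f \<in> borel_measurable borel" "g \<in> borel_measurable borel"
    using borel_measurable_integrable[OF f] borel_measurable_integrable[OF g] by simp_all
  note F [measurable]
  show F': "F \<in> borel_measurable (lborel \<Otimes>\<^sub>M lborel)"
  proof -
    have "borel_measurable ((lborel :: st measure) \<Otimes>\<^sub>M (lborel :: st measure)) = (borel_measurable (borel \<Otimes>\<^sub>M borel) :: (st \<times> st \<Rightarrow> complex) set)"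
      by (intro measurable_cong_sets sets_pair_measure_cong) simp_all
    then show ?thesis using F by blast
  qed
  show "integrable lborel (\<lambda>x. LBINT y. norm (F (x, y)))"
    using integrable_norm[OF f] by (simp add: b)
  show "AE x in lborel. integrable lborel (\<lambda>y. F (x, y))"
  proof (rule AE_I2)
    fix x
    have "(\<lambda>y. F (x, y)) \<in> borel_measurable lborel"
      using F' by (rule measurable_compose[rotated]) simp
    then show "integrable lborel (\<lambda>y. F (x, y))"
      by (rule Bochner_Integration.integrable_bound[OF integrable_mult_right[OF integrable_norm[OF g], of "norm (f x)"]])
         (simp add: b)
  qed
qed

text \<open>The factor \<open>gauss (h n *\<^sub>R q)\<close> makes the double integral absolutely
  convergent. Exchanging the integrals turns it into an average of v around x at scale
  \<open>h n\<close>, which tends to a multiple of v x. One factor (2 \<pi>)^2 comes from the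
  transform of the Gaussian, the other is its total mass.\<close>

lemma ft_inversion:
  assumes v: "schwartz v"
  shows "(\<integral>q. ft v q * cis (x \<bullet> q) \<partial>lborel) = of_real ((2 * pi) ^ 4) * v x"
proof -
  define h :: "nat \<Rightarrow> real" where "h n = 1 / real (Suc n)" for n
  have h: "0 < h n" for n by (auto simp: h_def)
  have h0: "h \<longlonglongrightarrow> 0" unfolding h_def by (rule LIMSEQ_Suc[OF lim_1_over_n])
  have [measurable]: "v \<in> borel_measurable borel" using v schwartz_measurable by auto
  have [measurable]: "ft v \<in> borel_measurable borel" using v schwartz_measurable ft_measurable by auto
  have iv: "integrable lborel v" by (rule schwartz_integrable[OF v])
  have ig: "integrable lborel (\<lambda>q. complex_of_real (gauss (h n *\<^sub>R q)))" for n
    using integrable_scale[OF _ h, of "\<lambda>q. complex_of_real (gauss q)" 0 n] gauss_ft(1)[of 0] by simp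
  have lim1: "(\<lambda>n. \<integral>q. ft v q * cis (x \<bullet> q) * of_real (gauss (h n *\<^sub>R q)) \<partial>lborel)
      \<longlonglongrightarrow> (\<integral>q. ft v q * cis (x \<bullet> q) \<partial>lborel)"
  proof (rule integral_dominated_convergence)
    show "integrable lborel (\<lambda>q. norm (ft v q))" by (intro integrable_norm ft_integrable v)
    show "AE q in lborel. norm (ft v q * cis (x \<bullet> q) * of_real (gauss (h n *\<^sub>R q))) \<le> norm (ft v q)" for n
      using gauss_le_1 gauss_pos by (intro AE_I2) (simp add: norm_mult mult_left_le abs_of_pos)
    show "AE q in lborel. (\<lambda>n. ft v q * cis (x \<bullet> q) * of_real (gauss (h n *\<^sub>R q))) \<longlonglongrightarrow> ft v q * cis (x \<bullet> q)"
    proof (rule AE_I2)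
      fix q
      have "(\<lambda>n. gauss (h n *\<^sub>R q)) \<longlonglongrightarrow> gauss (0 *\<^sub>R q)"
        unfolding gauss_def by (intro tendsto_intros h0) auto
      then have "(\<lambda>n. ft v q * cis (x \<bullet> q) * of_real (gauss (h n *\<^sub>R q))) \<longlonglongrightarrow> ft v q * cis (x \<bullet> q) * of_real (gauss (0 *\<^sub>R q))"
        by (intro tendsto_intros)
      then show "(\<lambda>n. ft v q * cis (x \<bullet> q) * of_real (gauss (h n *\<^sub>R q))) \<longlonglongrightarrow> ft v q * cis (x \<bullet> q)" by simp
    qed
  qed measurable
  obtain C where C: "\<And>z. norm (v z) \<le> C" using schwartz_bounded[OF v] by blast
  have lim2: "(\<lambda>n. \<integral>w. v (x + h n *\<^sub>R w) * of_real (gauss w) \<partial>lborel) \<longlonglongrightarrow> (\<integral>w. v x * of_real (gauss w) \<partial>lborel)"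
  proof (rule integral_dominated_convergence)
    show "integrable lborel (\<lambda>w. C * gauss w)" by (intro integrable_mult_right gauss_integrable)
    show "AE w in lborel. norm (v (x + h n *\<^sub>R w) * of_real (gauss w)) \<le> C * gauss w" for n
      using C gauss_pos by (intro AE_I2) (simp add: norm_mult abs_of_pos less_imp_le mult_right_mono)
    show "AE w in lborel. (\<lambda>n. v (x + h n *\<^sub>R w) * of_real (gauss w)) \<longlonglongrightarrow> v x * of_real (gauss w)"
    proof (intro AE_I2 tendsto_intros)
      fix w
      have "isCont v x" by (intro differentiable_imp_continuous_within schwartz_differentiable v)
      moreover have "(\<lambda>n. x + h n *\<^sub>R w) \<longlonglongrightarrow> x + 0 *\<^sub>R w" by (intro tendsto_intros h0)
      ultimately show "(\<lambda>n. v (x + h n *\<^sub>R w)) \<longlonglongrightarrow> v x"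
        using isCont_tendsto_compose by fastforce
    qed
  qed measurable
  have eq: "(\<integral>q. ft v q * cis (x \<bullet> q) * of_real (gauss (h n *\<^sub>R q)) \<partial>lborel)
      = of_real ((2 * pi)\<^sup>2) * (\<integral>w. v (x + h n *\<^sub>R w) * of_real (gauss w) \<partial>lborel)" for n
  proof -
    have g: "(\<integral>q. cis ((x - y) \<bullet> q) * of_real (gauss (h n *\<^sub>R q)) \<partial>lborel)
        = of_real ((2 * pi)\<^sup>2 / h n ^ 4 * gauss ((x - y) /\<^sub>R h n))" for y
    proof -
      have "of_real (h n ^ 4) * (\<integral>q. cis ((x - y) \<bullet> q) * of_real (gauss (h n *\<^sub>R q)) \<partial>lborel)
        = of_real (h n ^ 4) * (\<integral>q. (\<lambda>q. of_real (gauss q) * cis (q \<bullet> ((x - y) /\<^sub>R h n))) (0 + h n *\<^sub>R q) \<partial>lborel)"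
      proof -
        have "(0 + h n *\<^sub>R q) \<bullet> ((x - y) /\<^sub>R h n) = (x - y) \<bullet> q" for q
          using h[of n] by (simp add: inner_commute)
        then show ?thesis by (simp only: add_0_left mult.commute)
      qed
      also have "\<dots> = of_real ((2 * pi)\<^sup>2 * gauss ((x - y) /\<^sub>R h n))"
        by (subst integral_scale[OF _ h, symmetric]) (measurable, rule gauss_ft)
      finally show ?thesis using h[of n] by (simp add: field_simps)
    qed
    have "(\<integral>q. ft v q * cis (x \<bullet> q) * of_real (gauss (h n *\<^sub>R q)) \<partial>lborel)
       = (\<integral>q. (\<integral>y. v y * cis ((x - y) \<bullet> q) * of_real (gauss (h n *\<^sub>R q)) \<partial>lborel) \<partial>lborel)"
    proof (rule Bochner_Integration.integral_cong[OF refl])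
      fix q
      have "(\<integral>y. v y * cis ((x - y) \<bullet> q) * of_real (gauss (h n *\<^sub>R q)) \<partial>lborel)
         = (\<integral>y. (cis (- (y \<bullet> q)) * v y) * (cis (x \<bullet> q) * of_real (gauss (h n *\<^sub>R q))) \<partial>lborel)"
      proof -
        have "cis ((x - y) \<bullet> q) = cis (- (y \<bullet> q)) * cis (x \<bullet> q)" for y
          by (simp add: cis_mult inner_diff_left)
        then show ?thesis by (simp only: mult_ac)
      qed
      then show "ft v q * cis (x \<bullet> q) * of_real (gauss (h n *\<^sub>R q)) =
         (\<integral>y. v y * cis ((x - y) \<bullet> q) * of_real (gauss (h n *\<^sub>R q)) \<partial>lborel)"
        by (simp add: ft_eq) auto
    qed
    also have "\<dots> = (\<integral>y. (\<integral>q. v y * cis ((x - y) \<bullet> q) * of_real (gauss (h n *\<^sub>R q)) \<partial>lborel) \<partial>lborel)"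
    proof (rule lborel_pair.Fubini_integral)
      show "integrable (lborel \<Otimes>\<^sub>M lborel) (\<lambda>(y, q). v y * cis ((x - y) \<bullet> q) * of_real (gauss (h n *\<^sub>R q)))"
        by (rule integrable_prod_bound[OF iv ig[of n]])
           (measurable, simp add: norm_mult)
    qed
    also have "\<dots> = (\<integral>y. v y * of_real ((2 * pi)\<^sup>2 / h n ^ 4 * gauss ((x - y) /\<^sub>R h n)) \<partial>lborel)"
      unfolding mult.assoc by (subst integral_mult_right_zero, subst g) simp
    also have "\<dots> = of_real (h n ^ 4) * (\<integral>w. v (x + h n *\<^sub>R w) * of_real ((2 * pi)\<^sup>2 / h n ^ 4 * gauss w) \<partial>lborel)"
      using h[of n] by (subst integral_scale[OF _ h[of n], where t=x]) simp_all
    also have "\<dots> = of_real (h n ^ 4) * (\<integral>w. of_real ((2 * pi)\<^sup>2 / h n ^ 4) * (v (x + h n *\<^sub>R w) * of_real (gauss w)) \<partial>lborel)"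
      by (simp only: of_real_mult mult_ac)
    also have "\<dots> = of_real ((2 * pi)\<^sup>2) * (\<integral>w. v (x + h n *\<^sub>R w) * of_real (gauss w) \<partial>lborel)"
      using h[of n] by (subst integral_mult_right_zero) simp
    finally show ?thesis .
  qed
  have "(\<integral>q. ft v q * cis (x \<bullet> q) \<partial>lborel) = of_real ((2 * pi)\<^sup>2) * (\<integral>w. v x * of_real (gauss w) \<partial>lborel)"
    using LIMSEQ_unique[OF lim1 tendsto_mult_left[OF lim2, of "of_real ((2 * pi)\<^sup>2)", folded eq]] .
  also have "(\<integral>w. v x * of_real (gauss w) \<partial>lborel) = v x * of_real ((2 * pi)\<^sup>2)"
    by (simp add: integral_complex_of_real gauss_integral)
  finally show ?thesis by (simp add: power_mult_distrib flip: power_add)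
qed

section \<open>Transforms of products as convolutions\<close>

lemma ft_mult:
  assumes u: "schwartz u" and v: "schwartz v"
  shows "of_real ((2 * pi) ^ 4) * ft (\<lambda>z. u z * v z) p = (\<integral>q. ft u (p - q) * ft v q \<partial>lborel)"
proof -
  have [measurable]: "u \<in> borel_measurable borel" "v \<in> borel_measurable borel" "ft v \<in> borel_measurable borel"
    using u v schwartz_measurable ft_measurable by auto
  have iu: "integrable lborel u" and iv: "integrable lborel (ft v)"
    using schwartz_integrable ft_integrable u v by auto
  have "of_real ((2 * pi) ^ 4) * ft (\<lambda>z. u z * v z) p
     = (\<integral>z. cis (- (z \<bullet> p)) * u z * (of_real ((2 * pi) ^ 4) * v z) \<partial>lborel)"
    unfolding ft_eq by (subst integral_mult_right_zero[symmetric]) (simp add: mult_ac)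
  \<comment> \<open>Inserting the inversion formula for v makes the product a superposition of
    modulated copies of u, whose transforms are translates of that of u.\<close>
  also have "\<dots> = (\<integral>z. (\<integral>q. cis (- (z \<bullet> p)) * u z * (ft v q * cis (z \<bullet> q)) \<partial>lborel) \<partial>lborel)"
    unfolding ft_inversion[OF v, symmetric] by simp
  also have "\<dots> = (\<integral>q. (\<integral>z. cis (- (z \<bullet> p)) * u z * (ft v q * cis (z \<bullet> q)) \<partial>lborel) \<partial>lborel)"
  proof (rule lborel_pair.Fubini_integral[symmetric])
    show "integrable (lborel \<Otimes>\<^sub>M lborel) (\<lambda>(z, q). cis (- (z \<bullet> p)) * u z * (ft v q * cis (z \<bullet> q)))"
      by (rule integrable_prod_bound[OF iu iv]) (measurable, simp add: norm_mult)
  qed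
  also have "\<dots> = (\<integral>q. ft u (p - q) * ft v q \<partial>lborel)"
  proof (rule Bochner_Integration.integral_cong[OF refl])
    fix q
    have "(\<integral>z. cis (- (z \<bullet> p)) * u z * (ft v q * cis (z \<bullet> q)) \<partial>lborel)
       = (\<integral>z. cis (- (z \<bullet> (p - q))) * u z * ft v q \<partial>lborel)"
    proof (rule Bochner_Integration.integral_cong[OF refl])
      fix z
      have "cis (- (z \<bullet> p)) * cis (z \<bullet> q) = cis (- (z \<bullet> (p - q)))"
        by (simp add: cis_mult inner_diff_right)
      then show "cis (- (z \<bullet> p)) * u z * (ft v q * cis (z \<bullet> q)) = cis (- (z \<bullet> (p - q))) * u z * ft v q"
        by (metis (no_types, lifting) mult.assoc mult.commute)
    qed
    then show "(\<integral>z. cis (- (z \<bullet> p)) * u z * (ft v q * cis (z \<bullet> q)) \<partial>lborel) = ft u (p - q) * ft v q"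
      by (simp add: ft_eq)
  qed
  finally show ?thesis .
qed

lemma norm_ft_mult_le:
  assumes u: "schwartz u" and v: "schwartz v"
  shows "ennreal (norm (ft (\<lambda>z. u z * v z) p)) \<le> (\<integral>\<^sup>+q. ennreal (norm (ft u (p - q))) * ennreal (norm (ft v q)) \<partial>lborel)"
proof -
  have pi1: "(1::real) \<le> (2 * pi) ^ 4" using pi_gt3 by (intro one_le_power) simp
  have "norm (ft (\<lambda>z. u z * v z) p) \<le> (2 * pi) ^ 4 * norm (ft (\<lambda>z. u z * v z) p)"
    using mult_right_mono[OF pi1 norm_ge_zero[of "ft (\<lambda>z. u z * v z) p"]] by simp
  also have "\<dots> = norm (\<integral>q. ft u (p - q) * ft v q \<partial>lborel)"
    unfolding ft_mult[OF u v, symmetric] by (simp add: norm_mult norm_power)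
  finally have "ennreal (norm (ft (\<lambda>z. u z * v z) p)) \<le> ennreal (norm (\<integral>q. ft u (p - q) * ft v q \<partial>lborel))"
    by (rule ennreal_leI)
  also have "\<dots> \<le> (\<integral>\<^sup>+q. norm (ft u (p - q) * ft v q) \<partial>lborel)"
  proof (rule integral_norm_bound_ennreal)
    have [measurable]: "ft u \<in> borel_measurable borel" "ft v \<in> borel_measurable borel"
      using u v schwartz_measurable ft_measurable by auto
    define K where "K = (\<integral>z. norm (u z) \<partial>lborel)"
    show "integrable lborel (\<lambda>q. ft u (p - q) * ft v q)"
    proof (rule Bochner_Integration.integrable_bound)
      show "integrable lborel (\<lambda>q. K * norm (ft v q))"
        by (intro integrable_mult_right integrable_norm ft_integrable v)
      show "AE q in lborel. norm (ft u (p - q) * ft v q) \<le> norm (K * norm (ft v q))"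
        using norm_ft_le[of u] by (intro AE_I2) (auto simp: norm_mult K_def intro!: mult_right_mono order_trans[OF norm_ft_le])
    qed measurable
  qed
  finally show ?thesis by (simp add: norm_mult ennreal_mult)
qed

subsection \<open>Square roots in the extended nonnegative reals\<close>

text \<open>Norms are carried as squares with values in \<open>ennreal\<close>; this root is made so
  that its square is x without exception, the value \<open>\<top>\<close> included.\<close>

definition esqrt :: "ennreal \<Rightarrow> ennreal" where
  "esqrt x = (if x = \<top> then \<top> else ennreal (sqrt (enn2real x)))"

lemma esqrt_measurable [measurable]: "esqrt \<in> borel_measurable borel"
  unfolding esqrt_def by measurable

lemma esqrt_square [simp]: "(esqrt x)\<^sup>2 = x"
  by (cases x) (auto simp: esqrt_def power2_eq_square ennreal_mult_top simp flip: ennreal_mult)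

lemma power2_mono_ennreal: "x \<le> y \<Longrightarrow> x\<^sup>2 \<le> (y::ennreal)\<^sup>2"
  by (simp add: power_mono)

subsection \<open>Trilinear forms\<close>

lemma nn_integral_reflect:
  fixes f :: "'a::euclidean_space \<Rightarrow> ennreal"
  assumes [measurable]: "f \<in> borel_measurable borel"
  shows "(\<integral>\<^sup>+q. f (c - q) \<partial>lborel) = (\<integral>\<^sup>+q. f q \<partial>lborel)"
proof -
  have "(lborel :: 'a measure) = distr lborel borel (\<lambda>x. c - x)"
    using lborel_affine[of "-1" c] by (simp add: density_1)
  then have "(\<integral>\<^sup>+q. f q \<partial>lborel) = (\<integral>\<^sup>+q. f q \<partial>distr lborel borel (\<lambda>x. c - x))" by simp
  also have "\<dots> = (\<integral>\<^sup>+q. f (c - q) \<partial>lborel)" by (subst nn_integral_distr) auto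
  finally show ?thesis by simp
qed

lemma nn_integral_translate:
  fixes f :: "'a::euclidean_space \<Rightarrow> ennreal"
  assumes [measurable]: "f \<in> borel_measurable borel"
  shows "(\<integral>\<^sup>+q. f (c + q) \<partial>lborel) = (\<integral>\<^sup>+q. f q \<partial>lborel)"
  by (subst (2) lborel_distr_plus[of c, symmetric], subst nn_integral_distr) auto

definition sqn :: "(st \<Rightarrow> ennreal) \<Rightarrow> ennreal" where
  "sqn F = (\<integral>\<^sup>+p. (F p)\<^sup>2 \<partial>lborel)"

text \<open>The integral over the hyperplane p + q + r = 0, parametrised by its first two entries.
  The two transpositions treated next generate all permutations, so each of the three variables can
  be made the outer one.\<close>

definition tri :: "(st \<times> st \<times> st \<Rightarrow> ennreal) \<Rightarrow> ennreal" where
  "tri \<Phi> = (\<integral>\<^sup>+p. \<integral>\<^sup>+q. \<Phi> (p, q, - p - q) \<partial>lborel \<partial>lborel)"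

abbreviation st3 :: "(st \<times> st \<times> st) measure" where "st3 \<equiv> borel \<Otimes>\<^sub>M borel \<Otimes>\<^sub>M borel"

lemma tri_swap01:
  assumes [measurable]: "\<Phi> \<in> borel_measurable st3"
  shows "tri (\<lambda>(p, q, r). \<Phi> (q, p, r)) = tri \<Phi>"
proof -
  have "tri (\<lambda>(p, q, r). \<Phi> (q, p, r)) = (\<integral>\<^sup>+q. \<integral>\<^sup>+p. \<Phi> (q, p, - p - q) \<partial>lborel \<partial>lborel)"
    unfolding tri_def by (subst lborel_pair.Fubini') auto
  then show ?thesis by (simp add: tri_def minus_diff_commute)
qed

lemma tri_swap12:
  assumes [measurable]: "\<Phi> \<in> borel_measurable st3"
  shows "tri (\<lambda>(p, q, r). \<Phi> (p, r, q)) = tri \<Phi>"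
  unfolding tri_def
proof (rule nn_integral_cong)
  fix p :: st
  have "(\<integral>\<^sup>+q. (\<lambda>q. \<Phi> (p, q, - p - q)) (- p - q) \<partial>lborel) = (\<integral>\<^sup>+q. \<Phi> (p, q, - p - q) \<partial>lborel)"
    by (rule nn_integral_reflect) measurable
  then show "(\<integral>\<^sup>+q. (case (p, q, - p - q) of (p, q, r) \<Rightarrow> \<Phi> (p, r, q)) \<partial>lborel) = (\<integral>\<^sup>+q. \<Phi> (p, q, - p - q) \<partial>lborel)"
    by simp
qed

section \<open>Trilinear forms restricted to a set of frequency triples\<close>

definition trX :: "(st \<times> st \<times> st) set \<Rightarrow> (st \<Rightarrow> ennreal) \<Rightarrow> (st \<Rightarrow> ennreal) \<Rightarrow> (st \<Rightarrow> ennreal) \<Rightarrow> ennreal" where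
  "trX X F G H = tri (\<lambda>x. indicator X x * (F (fst x) * G (fst (snd x)) * H (snd (snd x))))"

text \<open>M bounds the square of the form and therefore has the size of a volume, not of the root
  of one.\<close>

definition tb :: "(st \<times> st \<times> st) set \<Rightarrow> ennreal \<Rightarrow> bool" where
  "tb X M \<longleftrightarrow> (\<forall>F G H. F \<in> borel_measurable borel \<longrightarrow> G \<in> borel_measurable borel \<longrightarrow> H \<in> borel_measurable borel \<longrightarrow>
     (trX X F G H)\<^sup>2 \<le> M * sqn F * sqn G * sqn H)"

lemma tbI:
  assumes "\<And>F G H. F \<in> borel_measurable borel \<Longrightarrow> G \<in> borel_measurable borel \<Longrightarrow> H \<in> borel_measurable borel \<Longrightarrow>
     (trX X F G H)\<^sup>2 \<le> M * sqn F * sqn G * sqn H"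
  shows "tb X M"
  using assms by (auto simp: tb_def)

lemma tri_mono: "(\<And>x. \<Phi> x \<le> \<Psi> x) \<Longrightarrow> tri \<Phi> \<le> tri \<Psi>"
  unfolding tri_def by (intro nn_integral_mono) auto

lemma trX_mono: "X \<subseteq> Y \<Longrightarrow> trX X F G H \<le> trX Y F G H"
  unfolding trX_def by (rule tri_mono) (auto split: split_indicator)

lemma tb_mono:
  assumes "tb Y M" "X \<subseteq> Y" "M \<le> M'"
  shows "tb X M'"
proof (rule tbI)
  fix F G H :: "st \<Rightarrow> ennreal" assume "F \<in> borel_measurable borel" "G \<in> borel_measurable borel" "H \<in> borel_measurable borel"
  then have "(trX Y F G H)\<^sup>2 \<le> M * sqn F * sqn G * sqn H" using assms(1) by (auto simp: tb_def)
  with assms(3) show "(trX X F G H)\<^sup>2 \<le> M' * sqn F * sqn G * sqn H"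
    by (meson power2_mono_ennreal trX_mono[OF assms(2)] order_trans mult_right_mono zero_le)
qed

lemma tb_swap01:
  assumes X [measurable]: "X \<in> sets st3" and t: "tb {(p, q, r). (q, p, r) \<in> X} M"
  shows "tb X M"
proof (rule tbI)
  fix F G H :: "st \<Rightarrow> ennreal" assume [measurable]: "F \<in> borel_measurable borel" "G \<in> borel_measurable borel" "H \<in> borel_measurable borel"
  have "trX X F G H = trX {(p, q, r). (q, p, r) \<in> X} G F H"
    unfolding trX_def by (subst tri_swap01[symmetric])
      (auto intro!: arg_cong[where f=tri] simp: fun_eq_iff mult_ac split: split_indicator)
  then show "(trX X F G H)\<^sup>2 \<le> M * sqn F * sqn G * sqn H"
    using t[unfolded tb_def, rule_format, of G F H] by (simp add: mult_ac)
qed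

lemma tb_swap12:
  assumes X [measurable]: "X \<in> sets st3" and t: "tb {(p, q, r). (p, r, q) \<in> X} M"
  shows "tb X M"
proof (rule tbI)
  fix F G H :: "st \<Rightarrow> ennreal" assume [measurable]: "F \<in> borel_measurable borel" "G \<in> borel_measurable borel" "H \<in> borel_measurable borel"
  have "trX X F G H = trX {(p, q, r). (p, r, q) \<in> X} F H G"
    unfolding trX_def by (subst tri_swap12[symmetric])
      (auto intro!: arg_cong[where f=tri] simp: fun_eq_iff mult_ac split: split_indicator)
  then show "(trX X F G H)\<^sup>2 \<le> M * sqn F * sqn G * sqn H"
    using t[unfolded tb_def, rule_format, of F H G] by (simp add: mult_ac)
qed

lemma trX_CS1:
  assumes [measurable]: "X \<in> sets st3" "F \<in> borel_measurable borel" "G \<in> borel_measurable borel" "H \<in> borel_measurable borel"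
  shows "(trX X F G H)\<^sup>2 \<le> sqn F * (\<integral>\<^sup>+p. (\<integral>\<^sup>+q. indicator X (p, q, - p - q) * (G q * H (- p - q)) \<partial>lborel)\<^sup>2 \<partial>lborel)"
proof -
  have "trX X F G H = (\<integral>\<^sup>+p. F p * (\<integral>\<^sup>+q. indicator X (p, q, - p - q) * (G q * H (- p - q)) \<partial>lborel) \<partial>lborel)"
    unfolding trX_def tri_def by (subst nn_integral_cmult[symmetric]) (auto simp: mult_ac)
  then show ?thesis unfolding sqn_def by (simp only:) (rule Cauchy_Schwarz_nn_integral, measurable)
qed

lemma sqn_conv:
  assumes [measurable]: "G \<in> borel_measurable borel" "H \<in> borel_measurable borel"
  shows "(\<integral>\<^sup>+p. (\<integral>\<^sup>+q. (G q)\<^sup>2 * (H (- p - q))\<^sup>2 \<partial>lborel) \<partial>lborel) = sqn G * sqn H"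
proof -
  have "(\<integral>\<^sup>+p. (\<integral>\<^sup>+q. (G q)\<^sup>2 * (H (- p - q))\<^sup>2 \<partial>lborel) \<partial>lborel)
      = (\<integral>\<^sup>+q. (\<integral>\<^sup>+p. (G q)\<^sup>2 * (H (- q - p))\<^sup>2 \<partial>lborel) \<partial>lborel)"
    by (subst lborel_pair.Fubini') (auto simp: minus_diff_commute)
  also have "\<dots> = (\<integral>\<^sup>+q. (G q)\<^sup>2 * sqn H \<partial>lborel)"
  proof (rule nn_integral_cong)
    fix q
    show "(\<integral>\<^sup>+p. (G q)\<^sup>2 * (H (- q - p))\<^sup>2 \<partial>lborel) = (G q)\<^sup>2 * sqn H"
      using nn_integral_reflect[of "\<lambda>p. (H p)\<^sup>2" "- q"] by (subst nn_integral_cmult) (auto simp: sqn_def)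
  qed
  also have "\<dots> = sqn G * sqn H" unfolding sqn_def by (rule nn_integral_multc) measurable
  finally show ?thesis .
qed

text \<open>Cauchy--Schwarz twice: in p against F, and for fixed p in q against the indicator of the
  fibre. What remains is the supremum of the fibre volumes, and the double integral of the squares
  of G and H factors.\<close>

lemma tb_CS:
  assumes [measurable]: "X \<in> sets st3"
    and M: "\<And>p. emeasure lborel {q. (p, q, - p - q) \<in> X} \<le> M"
  shows "tb X M"
proof (rule tbI)
  fix F G H :: "st \<Rightarrow> ennreal" assume [measurable]: "F \<in> borel_measurable borel" "G \<in> borel_measurable borel" "H \<in> borel_measurable borel"
  have "(trX X F G H)\<^sup>2 \<le> sqn F * (\<integral>\<^sup>+p. (\<integral>\<^sup>+q. indicator X (p, q, - p - q) * (G q * H (- p - q)) \<partial>lborel)\<^sup>2 \<partial>lborel)"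
    by (rule trX_CS1) measurable
  also have "\<dots> \<le> sqn F * (\<integral>\<^sup>+p. M * (\<integral>\<^sup>+q. (G q)\<^sup>2 * (H (- p - q))\<^sup>2 \<partial>lborel) \<partial>lborel)"
  proof (intro mult_left_mono nn_integral_mono)
    fix p :: st
    have "(\<integral>\<^sup>+q. indicator X (p, q, - p - q) * (G q * H (- p - q)) \<partial>lborel)\<^sup>2
      \<le> (\<integral>\<^sup>+q. (indicator X (p, q, - p - q))\<^sup>2 \<partial>lborel) * (\<integral>\<^sup>+q. (G q * H (- p - q))\<^sup>2 \<partial>lborel)"
      by (rule Cauchy_Schwarz_nn_integral) measurable
    also have "(\<integral>\<^sup>+q. (indicator X (p, q, - p - q))\<^sup>2 \<partial>lborel) = (\<integral>\<^sup>+q. indicator {q. (p, q, - p - q) \<in> X} q \<partial>lborel)"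
      by (intro nn_integral_cong) (auto split: split_indicator)
    also have "\<dots> = emeasure lborel {q. (p, q, - p - q) \<in> X}"
    proof (rule nn_integral_indicator)
      have "{q \<in> space borel. (p, q, - p - q) \<in> X} \<in> sets borel" by measurable
      then show "{q. (p, q, - p - q) \<in> X} \<in> sets lborel" by simp
    qed
    finally show "(\<integral>\<^sup>+q. indicator X (p, q, - p - q) * (G q * H (- p - q)) \<partial>lborel)\<^sup>2 \<le> M * (\<integral>\<^sup>+q. (G q)\<^sup>2 * (H (- p - q))\<^sup>2 \<partial>lborel)"
      unfolding power_mult_distrib by (rule order_trans[OF _ mult_right_mono[OF M]]) simp
  qed simp
  also have "\<dots> = sqn F * (M * (sqn G * sqn H))"
    by (subst nn_integral_cmult) (auto simp: sqn_conv)
  finally show "(trX X F G H)\<^sup>2 \<le> M * sqn F * sqn G * sqn H" by (simp add: mult_ac)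
qed

text \<open>The \<open>L\<^sup>2\<close> norm of a convolution does not change when one factor is reflected: both sides are
  the pairing of the two autocorrelations.\<close>

definition acor :: "(st \<Rightarrow> ennreal) \<Rightarrow> st \<Rightarrow> ennreal" where
  "acor F r = (\<integral>\<^sup>+p. F p * F (p + r) \<partial>lborel)"

text \<open>Expanding the square gives an integral over p, q and r. After shifting r by q, the
  integration in p involves only G and yields its autocorrelation at r; the integration in q then
  does the same for F.\<close>

lemma conv_acor:
  assumes [measurable]: "F \<in> borel_measurable borel" "G \<in> borel_measurable borel"
  shows "(\<integral>\<^sup>+p. (\<integral>\<^sup>+q. F q * G (p - q) \<partial>lborel)\<^sup>2 \<partial>lborel) = (\<integral>\<^sup>+r. acor F r * acor G r \<partial>lborel)"
proof -
  have "(\<integral>\<^sup>+p. (\<integral>\<^sup>+q. F q * G (p - q) \<partial>lborel)\<^sup>2 \<partial>lborel)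
    = (\<integral>\<^sup>+p. (\<integral>\<^sup>+q. (\<integral>\<^sup>+r. F q * G (p - q) * (F r * G (p - r)) \<partial>lborel) \<partial>lborel) \<partial>lborel)"
    unfolding power2_eq_square
    by (subst nn_integral_multc[symmetric], measurable, subst nn_integral_cmult[symmetric]) auto
  also have "\<dots> = (\<integral>\<^sup>+p. (\<integral>\<^sup>+q. (\<integral>\<^sup>+r. F q * G (p - q) * (F (q + r) * G (p - (q + r))) \<partial>lborel) \<partial>lborel) \<partial>lborel)"
    by (intro nn_integral_cong nn_integral_translate[symmetric]) measurable
  also have "\<dots> = (\<integral>\<^sup>+q. (\<integral>\<^sup>+p. (\<integral>\<^sup>+r. F q * G (p - q) * (F (q + r) * G (p - (q + r))) \<partial>lborel) \<partial>lborel) \<partial>lborel)"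
    by (subst lborel_pair.Fubini') auto
  also have "\<dots> = (\<integral>\<^sup>+q. (\<integral>\<^sup>+r. (\<integral>\<^sup>+p. F q * G (p - q) * (F (q + r) * G (p - (q + r))) \<partial>lborel) \<partial>lborel) \<partial>lborel)"
    by (subst lborel_pair.Fubini') auto
  also have "\<dots> = (\<integral>\<^sup>+q. (\<integral>\<^sup>+r. F q * F (q + r) * acor G r \<partial>lborel) \<partial>lborel)"
  proof (intro nn_integral_cong)
    fix q r
    have "(\<integral>\<^sup>+p. F q * G (p - q) * (F (q + r) * G (p - (q + r))) \<partial>lborel)
      = (\<integral>\<^sup>+p. F q * F (q + r) * (G (p - (q + r)) * G (p - q)) \<partial>lborel)"
      by (intro nn_integral_cong) (simp add: mult_ac)
    also have "\<dots> = F q * F (q + r) * (\<integral>\<^sup>+p. G (p - (q + r)) * G (p - q) \<partial>lborel)"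
      by (rule nn_integral_cmult) measurable
    also have "(\<integral>\<^sup>+p. G (p - (q + r)) * G (p - q) \<partial>lborel) = acor G r"
      unfolding acor_def
      by (subst nn_integral_translate[of _ "q + r", symmetric]) (auto simp: algebra_simps)
    finally show "(\<integral>\<^sup>+p. F q * G (p - q) * (F (q + r) * G (p - (q + r))) \<partial>lborel) = F q * F (q + r) * acor G r" .
  qed
  also have "\<dots> = (\<integral>\<^sup>+r. (\<integral>\<^sup>+q. F q * F (q + r) * acor G r \<partial>lborel) \<partial>lborel)"
    unfolding acor_def by (subst lborel_pair.Fubini') auto
  also have "\<dots> = (\<integral>\<^sup>+r. acor F r * acor G r \<partial>lborel)"
    by (intro nn_integral_cong, subst nn_integral_multc) (auto simp: acor_def)
  finally show ?thesis .
qed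

lemma acor_reflect:
  assumes [measurable]: "G \<in> borel_measurable borel"
  shows "acor (\<lambda>p. G (- p)) r = acor G r"
proof -
  have "acor (\<lambda>p. G (- p)) r = (\<integral>\<^sup>+p. G (- (- r - p)) * G (- (- r - p + r)) \<partial>lborel)"
    unfolding acor_def by (rule nn_integral_reflect[symmetric]) measurable
  also have "\<dots> = acor G r" unfolding acor_def by (simp add: mult.commute add.commute)
  finally show ?thesis .
qed

lemma conv_reflect:
  fixes F G :: "st \<Rightarrow> ennreal"
  assumes [measurable]: "F \<in> borel_measurable borel" "G \<in> borel_measurable borel"
  shows "(\<integral>\<^sup>+p. (\<integral>\<^sup>+q. F q * G (p - q) \<partial>lborel)\<^sup>2 \<partial>lborel) = (\<integral>\<^sup>+p. (\<integral>\<^sup>+q. F q * G (q - p) \<partial>lborel)\<^sup>2 \<partial>lborel)"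
proof -
  have "(\<integral>\<^sup>+p. (\<integral>\<^sup>+q. F q * G (q - p) \<partial>lborel)\<^sup>2 \<partial>lborel)
    = (\<integral>\<^sup>+p. (\<integral>\<^sup>+q. F q * (\<lambda>s. G (- s)) (p - q) \<partial>lborel)\<^sup>2 \<partial>lborel)" by simp
  also have "\<dots> = (\<integral>\<^sup>+r. acor F r * acor (\<lambda>s. G (- s)) r \<partial>lborel)"
    by (rule conv_acor) measurable
  finally show ?thesis by (simp add: conv_acor acor_reflect)
qed

text \<open>The norm over p is evaluated after reflecting the second factor, so the fibre consists
  of q in A with q - p in B instead of - p - q in B. If A lies near a and B near - a, the relevant p
  lie near 2 a and not near 0. Reflection is only possible for conditions on q and r separately,
  which is why X is first enlarged to the set given by A and B.\<close>

lemma tb_conj: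
  assumes [measurable]: "A \<in> sets borel" "B \<in> sets borel"
    and X: "X \<subseteq> {(p, q, r). q \<in> A \<and> r \<in> B}"
    and M: "\<And>p. emeasure lborel {q \<in> A. q - p \<in> B} \<le> M"
  shows "tb X M"
proof (rule tb_mono[OF _ X order_refl], rule tbI)
  fix F G H :: "st \<Rightarrow> ennreal" assume [measurable]: "F \<in> borel_measurable borel" "G \<in> borel_measurable borel" "H \<in> borel_measurable borel"
  define Y :: "(st \<times> st \<times> st) set" where "Y = {(p, q, r). q \<in> A \<and> r \<in> B}"
  have "{x \<in> space st3. fst (snd x) \<in> A \<and> snd (snd x) \<in> B} \<in> sets st3" by measurable
  moreover have "{x \<in> space st3. fst (snd x) \<in> A \<and> snd (snd x) \<in> B} = Y" by (auto simp: Y_def space_pair_measure)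
  ultimately have [measurable]: "Y \<in> sets st3" by simp
  define G' where "G' q = G q * indicator A q" for q
  define H' where "H' q = H q * indicator B q" for q
  have [measurable]: "G' \<in> borel_measurable borel" "H' \<in> borel_measurable borel"
    unfolding G'_def H'_def by measurable
  have "(\<integral>\<^sup>+p. (\<integral>\<^sup>+q. indicator Y (p, q, - p - q) * (G q * H (- p - q)) \<partial>lborel)\<^sup>2 \<partial>lborel)
     = (\<integral>\<^sup>+p. (\<integral>\<^sup>+q. G' q * H' (- p - q) \<partial>lborel)\<^sup>2 \<partial>lborel)"
    by (intro nn_integral_cong arg_cong[where f="\<lambda>x. x\<^sup>2"]) (auto simp: Y_def G'_def H'_def split: split_indicator)
  also have "\<dots> = (\<integral>\<^sup>+p. (\<integral>\<^sup>+q. G' q * H' (p - q) \<partial>lborel)\<^sup>2 \<partial>lborel)"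
    using nn_integral_reflect[of "\<lambda>p. (\<integral>\<^sup>+q. G' q * H' (p - q) \<partial>lborel)\<^sup>2" 0] by simp
  also have "\<dots> = (\<integral>\<^sup>+p. (\<integral>\<^sup>+q. G' q * H' (q - p) \<partial>lborel)\<^sup>2 \<partial>lborel)"
    by (rule conv_reflect) measurable
  also have "\<dots> \<le> (\<integral>\<^sup>+p. M * (\<integral>\<^sup>+q. (G q)\<^sup>2 * (H (q - p))\<^sup>2 \<partial>lborel) \<partial>lborel)"
  proof (intro nn_integral_mono)
    fix p :: st
    have m [measurable]: "{q \<in> A. q - p \<in> B} \<in> sets borel"
    proof -
      have "{q \<in> space borel. q \<in> A \<and> q - p \<in> B} \<in> sets borel" by measurable
      then show ?thesis by simp
    qed
    have "(\<integral>\<^sup>+q. G' q * H' (q - p) \<partial>lborel) = (\<integral>\<^sup>+q. indicator {q \<in> A. q - p \<in> B} q * (G q * H (q - p)) \<partial>lborel)"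
      by (intro nn_integral_cong) (auto simp: G'_def H'_def split: split_indicator)
    then have "(\<integral>\<^sup>+q. G' q * H' (q - p) \<partial>lborel)\<^sup>2
      \<le> (\<integral>\<^sup>+q. (indicator {q \<in> A. q - p \<in> B} q)\<^sup>2 \<partial>lborel) * (\<integral>\<^sup>+q. (G q * H (q - p))\<^sup>2 \<partial>lborel)"
      by (simp only:) (rule Cauchy_Schwarz_nn_integral, measurable)
    also have "(\<integral>\<^sup>+q. (indicator {q \<in> A. q - p \<in> B} q)\<^sup>2 \<partial>lborel) = (\<integral>\<^sup>+q. indicator {q \<in> A. q - p \<in> B} q \<partial>lborel)"
      by (intro nn_integral_cong) (auto split: split_indicator)
    also have "\<dots> = emeasure lborel {q \<in> A. q - p \<in> B}"
      by (rule nn_integral_indicator) simp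
    finally show "(\<integral>\<^sup>+q. G' q * H' (q - p) \<partial>lborel)\<^sup>2 \<le> M * (\<integral>\<^sup>+q. (G q)\<^sup>2 * (H (q - p))\<^sup>2 \<partial>lborel)"
      unfolding power_mult_distrib by (rule order_trans[OF _ mult_right_mono[OF M]]) simp
  qed
  also have "\<dots> = M * (sqn G * sqn H)"
  proof -
    have "(\<integral>\<^sup>+p. (\<integral>\<^sup>+q. (G q)\<^sup>2 * (H (q - p))\<^sup>2 \<partial>lborel) \<partial>lborel) = (\<integral>\<^sup>+p. (\<integral>\<^sup>+q. (G q)\<^sup>2 * ((\<lambda>s. H (- s)) (p - q))\<^sup>2 \<partial>lborel) \<partial>lborel)"
      by simp
    also have "\<dots> = (\<integral>\<^sup>+p. (\<integral>\<^sup>+q. (G q)\<^sup>2 * ((\<lambda>s. H (- s)) (- p - q))\<^sup>2 \<partial>lborel) \<partial>lborel)"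
      using nn_integral_reflect[of "\<lambda>p. (\<integral>\<^sup>+q. (G q)\<^sup>2 * (H (- (p - q)))\<^sup>2 \<partial>lborel)" 0] by simp
    also have "\<dots> = sqn G * sqn (\<lambda>s. H (- s))" by (rule sqn_conv) measurable
    also have "sqn (\<lambda>s. H (- s)) = sqn H"
      using nn_integral_reflect[of "\<lambda>p. (H p)\<^sup>2" 0] by (simp add: sqn_def)
    finally show ?thesis by (subst nn_integral_cmult) auto
  qed
  finally have "(\<integral>\<^sup>+p. (\<integral>\<^sup>+q. indicator Y (p, q, - p - q) * (G q * H (- p - q)) \<partial>lborel)\<^sup>2 \<partial>lborel) \<le> M * (sqn G * sqn H)" .
  then have "sqn F * (\<integral>\<^sup>+p. (\<integral>\<^sup>+q. indicator Y (p, q, - p - q) * (G q * H (- p - q)) \<partial>lborel)\<^sup>2 \<partial>lborel) \<le> sqn F * (M * (sqn G * sqn H))"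
    by (rule mult_left_mono) simp
  moreover have "(trX Y F G H)\<^sup>2 \<le> sqn F * (\<integral>\<^sup>+p. (\<integral>\<^sup>+q. indicator Y (p, q, - p - q) * (G q * H (- p - q)) \<partial>lborel)\<^sup>2 \<partial>lborel)"
    by (rule trX_CS1) measurable
  ultimately show "(trX {(p, q, r). q \<in> A \<and> r \<in> B} F G H)\<^sup>2 \<le> M * sqn F * sqn G * sqn H"
    by (simp add: Y_def mult_ac)
qed

lemma power2_le_ennreal: "x\<^sup>2 \<le> y\<^sup>2 \<Longrightarrow> x \<le> (y::ennreal)"
  by (cases x; cases y) (auto simp: ennreal_power top_unique power2_eq_square ennreal_mult_eq_top_iff ennreal_top_mult simp flip: ennreal_mult
       intro!: ennreal_leI dest: power2_le_imp_le[unfolded power2_eq_square])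

lemma dist_uminus: "dist (- a) x = norm (x + (a :: 'a::real_normed_vector))"
  by (metis dist_norm dist_commute diff_minus_eq_add)

text \<open>If the output has spatial frequency at most R, then q in the ball of radius R around a
  forces r into the ball of radius 2 R around - a. Integrating over a counts every q with the volume
  c of its ball, while the localised pieces have total squared norm c for the second function and 8
  c for the third. Cancelling c squared leaves the factor 8.\<close>

lemma tb_avg:
  assumes X [measurable]: "X \<in> sets st3" and R: "0 < R"
    and XR: "\<And>p q r. (p, q, r) \<in> X \<Longrightarrow> norm (snd p) \<le> R"
    and M: "\<And>a. tb (X \<inter> {(p, q, r). norm (snd q - a) \<le> R \<and> norm (snd r + a) \<le> 2 * R}) M"
  shows "tb X (8 * M)"
proof (rule tbI)
  fix F G H :: "st \<Rightarrow> ennreal" assume [measurable]: "F \<in> borel_measurable borel" "G \<in> borel_measurable borel" "H \<in> borel_measurable borel"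
  define c where "c = unit_ball_vol 3 * R ^ 3"
  have c: "c > 0" using R by (simp add: c_def)
  have vol: "emeasure lborel (cball (a::real^3) R) = ennreal c" "emeasure lborel (cball (a::real^3) (2 * R)) = ennreal (8 * c)" for a
    using R by (simp_all add: emeasure_cball c_def power_mult_distrib mult_ac)
  define Q where "Q a = X \<inter> {(p, q, r). norm (snd q - a) \<le> R \<and> norm (snd r + a) \<le> 2 * R}" for a
  define Ga where "Ga a q = G q * indicator (cball a R) (snd q)" for a q
  define Ha where "Ha a r = H r * indicator (cball (- a) (2 * R)) (snd r)" for a r
  have Qi: "indicator (Q a) x = (indicator X x * (indicator {..R} (norm (snd (fst (snd x)) - a)) * indicator {..2*R} (norm (snd (snd (snd x)) + a))) :: ennreal)" for a x
    by (cases x) (auto simp: Q_def split: split_indicator)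
  have ind: "indicator (cball a R) (snd q) = (indicator {..R} (norm (snd q - a)) :: ennreal)" for a and q :: st
    by (auto simp: dist_norm norm_minus_commute[of a] split: split_indicator)
  have ind': "indicator (cball (- a) (2 * R)) (snd r) = (indicator {..2*R} (norm (snd r + a)) :: ennreal)" for a and r :: st
    by (auto simp: dist_uminus split: split_indicator)
  note ind = ind ind'
  have [measurable]: "(\<lambda>(a, q). Ga a q) \<in> borel_measurable (borel \<Otimes>\<^sub>M borel)" "(\<lambda>(a, q). Ha a q) \<in> borel_measurable (borel \<Otimes>\<^sub>M borel)"
  proof -
    have [measurable]: "(\<lambda>x::(real^3) \<times> st. norm (snd (snd x) - fst x)) \<in> borel_measurable (borel \<Otimes>\<^sub>M borel)"
       "(\<lambda>x::(real^3) \<times> st. norm (snd (snd x) + fst x)) \<in> borel_measurable (borel \<Otimes>\<^sub>M borel)"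
      unfolding borel_prod by (intro borel_measurable_continuous_onI continuous_intros)+
    show "(\<lambda>(a, q). Ga a q) \<in> borel_measurable (borel \<Otimes>\<^sub>M borel)" "(\<lambda>(a, q). Ha a q) \<in> borel_measurable (borel \<Otimes>\<^sub>M borel)"
      unfolding Ga_def Ha_def ind case_prod_unfold by measurable
  qed
  have 1: "ennreal c * trX X F G H = (\<integral>\<^sup>+a. trX (Q a) F G H \<partial>lborel)"
  proof -
    define g where "g a p q = indicator X (p, q, - p - q) * (indicator {..R} (norm (snd q - a)) * indicator {..2*R} (norm (snd (- p - q) + a)))
       * (F p * G q * H (- p - q))" for a p q
    have [measurable]: "(\<lambda>x::(real^3) \<times> st \<times> st. norm (snd (snd (snd x)) - fst x)) \<in> borel_measurable (borel \<Otimes>\<^sub>M borel \<Otimes>\<^sub>M borel)"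
       "(\<lambda>x::(real^3) \<times> st \<times> st. norm (snd (- fst (snd x) - snd (snd x)) + fst x)) \<in> borel_measurable (borel \<Otimes>\<^sub>M borel \<Otimes>\<^sub>M borel)"
      unfolding borel_prod by (intro borel_measurable_continuous_onI continuous_intros)+
    have gm: "(\<lambda>(a, p, q). g a p q) \<in> borel_measurable (borel \<Otimes>\<^sub>M borel \<Otimes>\<^sub>M borel)"
      unfolding g_def case_prod_unfold by measurable
    have [measurable (raw)]: "(\<lambda>x. g (u x) (v x) (w x)) \<in> borel_measurable M"
      if "u \<in> measurable M borel" "v \<in> measurable M borel" "w \<in> measurable M borel" for u v w and M :: "'z measure"
      using measurable_compose[OF measurable_Pair[OF that(1) measurable_Pair[OF that(2,3)]] gm] by simp
    have g: "indicator (Q a) (p, q, - p - q) * (F p * G q * H (- p - q)) = g a p q" for a p q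
      unfolding Qi g_def by simp
    have "(\<integral>\<^sup>+a. trX (Q a) F G H \<partial>lborel) = (\<integral>\<^sup>+a. \<integral>\<^sup>+p. \<integral>\<^sup>+q. g a p q \<partial>lborel \<partial>lborel \<partial>lborel)"
      unfolding trX_def tri_def by (simp add: g)
    also have "\<dots> = (\<integral>\<^sup>+p. \<integral>\<^sup>+a. \<integral>\<^sup>+q. g a p q \<partial>lborel \<partial>lborel \<partial>lborel)"
      by (rule lborel_pair.Fubini'[symmetric]) measurable
    also have "\<dots> = (\<integral>\<^sup>+p. \<integral>\<^sup>+q. \<integral>\<^sup>+a. g a p q \<partial>lborel \<partial>lborel \<partial>lborel)"
      by (intro nn_integral_cong lborel_pair.Fubini'[symmetric]) measurable
    also have "\<dots> = (\<integral>\<^sup>+p. \<integral>\<^sup>+q. \<integral>\<^sup>+a. indicator (Q a) (p, q, - p - q) * (F p * G q * H (- p - q)) \<partial>lborel \<partial>lborel \<partial>lborel)"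
      by (simp add: g)
    also have "\<dots> = (\<integral>\<^sup>+p. \<integral>\<^sup>+q. ennreal c * (indicator X (p, q, - p - q) * (F p * G q * H (- p - q))) \<partial>lborel \<partial>lborel)"
    proof (intro nn_integral_cong)
      fix p q :: st
      have "indicator (Q a) (p, q, - p - q) = (indicator X (p, q, - p - q) * indicator (cball (snd q) R) a :: ennreal)" for a
      proof (cases "(p, q, - p - q) \<in> X \<and> norm (snd q - a) \<le> R")
        case True
        have "norm (snd (- p - q) + a) \<le> norm (snd p) + norm (snd q - a)"
          using norm_triangle_ineq4[of "- snd p" "snd q - a"] by (simp add: algebra_simps)
        then show ?thesis using True XR[of p q "- p - q"] by (auto simp: Q_def dist_norm)
      qed (auto simp: Q_def dist_norm)
      moreover have [measurable]: "cball (snd q) R \<in> sets borel" by simp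
      ultimately show "(\<integral>\<^sup>+a. indicator (Q a) (p, q, - p - q) * (F p * G q * H (- p - q)) \<partial>lborel)
         = ennreal c * (indicator X (p, q, - p - q) * (F p * G q * H (- p - q)))"
        by (simp add: nn_integral_multc nn_integral_cmult vol mult_ac)
    qed
    also have "\<dots> = ennreal c * trX X F G H"
      unfolding trX_def tri_def by (simp add: nn_integral_cmult)
    finally show ?thesis by simp
  qed
  have 2: "trX (Q a) F G H \<le> esqrt (M * sqn F * sqn (Ga a)) * esqrt (sqn (Ha a))" for a
  proof (rule power2_le_ennreal)
    have "trX (Q a) F G H = trX (Q a) F (Ga a) (Ha a)"
      unfolding trX_def Ga_def Ha_def ind Qi
      by (auto intro!: arg_cong[where f=tri] simp: fun_eq_iff split: split_indicator)
    moreover have [measurable]: "(\<lambda>q::st. norm (snd q - a)) \<in> borel_measurable borel" "(\<lambda>q::st. norm (snd q + a)) \<in> borel_measurable borel"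
      by (intro borel_measurable_continuous_onI continuous_intros)+
    moreover have "Ga a \<in> borel_measurable borel" "Ha a \<in> borel_measurable borel" unfolding Ga_def Ha_def ind by measurable
    ultimately have "(trX (Q a) F G H)\<^sup>2 \<le> M * sqn F * sqn (Ga a) * sqn (Ha a)"
      using M[of a] unfolding Q_def[symmetric] tb_def by simp
    then show "(trX (Q a) F G H)\<^sup>2 \<le> (esqrt (M * sqn F * sqn (Ga a)) * esqrt (sqn (Ha a)))\<^sup>2"
      by (simp add: power_mult_distrib)
  qed
  have cb [simp, measurable]: "cball x r \<in> sets borel" for x :: "real^3" and r by simp
  have 3: "(\<integral>\<^sup>+a. sqn (Ga a) \<partial>lborel) = ennreal c * sqn G" "(\<integral>\<^sup>+a. sqn (Ha a) \<partial>lborel) = ennreal (8 * c) * sqn H"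
  proof -
    have "(\<integral>\<^sup>+a. sqn (Ga a) \<partial>lborel) = (\<integral>\<^sup>+q. \<integral>\<^sup>+a. (Ga a q)\<^sup>2 \<partial>lborel \<partial>lborel)"
      unfolding sqn_def by (rule lborel_pair.Fubini') measurable
    also have "\<dots> = (\<integral>\<^sup>+q. \<integral>\<^sup>+a. (G q)\<^sup>2 * indicator (cball (snd q) R) a \<partial>lborel \<partial>lborel)"
      by (intro nn_integral_cong) (auto simp: Ga_def dist_commute split: split_indicator)
    also have "\<dots> = ennreal c * sqn G"
      by (simp add: nn_integral_cmult_indicator vol sqn_def, subst nn_integral_cmult[symmetric]) (simp_all add: mult.commute)
    finally show "(\<integral>\<^sup>+a. sqn (Ga a) \<partial>lborel) = ennreal c * sqn G" .
    have "(\<integral>\<^sup>+a. sqn (Ha a) \<partial>lborel) = (\<integral>\<^sup>+q. \<integral>\<^sup>+a. (Ha a q)\<^sup>2 \<partial>lborel \<partial>lborel)"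
      unfolding sqn_def by (rule lborel_pair.Fubini') measurable
    also have "\<dots> = (\<integral>\<^sup>+q. \<integral>\<^sup>+a. (H q)\<^sup>2 * indicator (cball (- snd q) (2 * R)) a \<partial>lborel \<partial>lborel)"
      by (intro nn_integral_cong) (auto simp: Ha_def ind dist_uminus add.commute split: split_indicator)
    also have "\<dots> = ennreal (8 * c) * sqn H"
      by (simp add: nn_integral_cmult_indicator vol sqn_def, subst nn_integral_cmult[symmetric]) (simp_all add: mult.commute)
    finally show "(\<integral>\<^sup>+a. sqn (Ha a) \<partial>lborel) = ennreal (8 * c) * sqn H" .
  qed
  have [measurable]: "(\<lambda>a. sqn (Ga a)) \<in> borel_measurable borel" "(\<lambda>a. sqn (Ha a)) \<in> borel_measurable borel"
    unfolding sqn_def by measurable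
  have "(ennreal c * trX X F G H)\<^sup>2 \<le> (\<integral>\<^sup>+a. esqrt (M * sqn F * sqn (Ga a)) * esqrt (sqn (Ha a)) \<partial>lborel)\<^sup>2"
    unfolding 1 by (intro power2_mono_ennreal nn_integral_mono 2)
  also have "\<dots> \<le> (\<integral>\<^sup>+a. (esqrt (M * sqn F * sqn (Ga a)))\<^sup>2 \<partial>lborel) * (\<integral>\<^sup>+a. (esqrt (sqn (Ha a)))\<^sup>2 \<partial>lborel)"
    by (rule Cauchy_Schwarz_nn_integral) measurable
  also have "\<dots> = (M * sqn F * (ennreal c * sqn G)) * (ennreal (8 * c) * sqn H)"
    by (simp add: nn_integral_cmult 3)
  also have "\<dots> = (ennreal c)\<^sup>2 * (8 * M * sqn F * sqn G * sqn H)"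
    using c by (simp add: ennreal_mult power2_eq_square mult_ac)
  finally have "(ennreal c)\<^sup>2 * (trX X F G H)\<^sup>2 \<le> (ennreal c)\<^sup>2 * (8 * M * sqn F * sqn G * sqn H)"
    by (simp add: power_mult_distrib)
  then show "(trX X F G H)\<^sup>2 \<le> 8 * M * sqn F * sqn G * sqn H"
    using c by (subst (asm) ennreal_mult_le_mult_iff) (auto simp: ennreal_power)
qed

subsection \<open>Volumes of conic shells\<close>

text \<open>The area of a disc is linear in the squared radius, so the squared radius is distributed
  uniformly on the half-line, with density \<pi>.\<close>

lemma nn_integral_sum_squares:
  assumes [measurable]: "h \<in> borel_measurable borel"
  shows "(\<integral>\<^sup>+z. h ((fst z)\<^sup>2 + (snd z)\<^sup>2) \<partial>(lborel :: (real \<times> real) measure)) = ennreal pi * (\<integral>\<^sup>+s. h s * indicator {0..} s \<partial>lborel)"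
proof -
  \<comment> \<open>The minus sign turns the preimages of the half-lines \<open>{t<..}\<close> into
    discs, which have the finite measure that the comparison on half-lines demands.\<close>
  define f where "f z = - ((fst z)\<^sup>2 + (snd z)\<^sup>2)" for z :: "real \<times> real"
  have [measurable]: "f \<in> borel_measurable borel"
    unfolding f_def by (intro borel_measurable_continuous_onI continuous_intros)
  have f: "f z = - (norm z)\<^sup>2" for z by (simp add: f_def norm_prod_def)
  have "distr lborel borel f = density lborel (\<lambda>s. ennreal pi * indicator {..0} s)"
  proof (rule measure_eqI_lessThan)
    fix t :: real
    have E: "emeasure (distr lborel borel f) {t<..} = ennreal (pi * max 0 (- t))"
    proof (cases "t < 0")
      case True
      have "norm z < sqrt (- t) \<longleftrightarrow> (norm z)\<^sup>2 < - t" for z :: "real \<times> real"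
        using real_sqrt_less_iff[of "(norm z)\<^sup>2" "- t"] by simp
      then have "f -` {t<..} = ball 0 (sqrt (- t))"
        by (auto simp: f)
      then show ?thesis using True
        by (subst emeasure_distr) (auto simp: emeasure_ball unit_ball_vol_2 real_sqrt_pow2)
    next
      case False
      then have "\<not> t < - (norm z)\<^sup>2" for z :: "real \<times> real" using zero_le_power2[of "norm z"] by linarith
      then have "f -` {t<..} = {}" by (auto simp: f)
      then show ?thesis using False by (subst emeasure_distr) auto
    qed
    have "emeasure (density lborel (\<lambda>s. ennreal pi * indicator {..0} s)) {t<..} = (\<integral>\<^sup>+s. ennreal pi * indicator {t<..0} s \<partial>lborel)"
      by (subst emeasure_density) (auto intro!: nn_integral_cong split: split_indicator)
    also have "\<dots> = ennreal (pi * max 0 (- t))"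
      by (subst nn_integral_cmult_indicator) (cases "t \<le> 0", auto simp: ennreal_mult max_def)
    finally show "emeasure (distr lborel borel f) {t<..} = emeasure (density lborel (\<lambda>s. ennreal pi * indicator {..0} s)) {t<..}"
      using E by simp
    show "emeasure (distr lborel borel f) {t<..} < \<infinity>" using E by simp
  qed auto
  then have "(\<integral>\<^sup>+s. h (- s) \<partial>distr lborel borel f) = (\<integral>\<^sup>+s. h (- s) \<partial>density lborel (\<lambda>s. ennreal pi * indicator {..0} s))"
    by simp
  also have "\<dots> = (\<integral>\<^sup>+s. ennreal pi * (h (- s) * indicator {0..} (- s)) \<partial>lborel)"
    by (subst nn_integral_density) (auto intro!: nn_integral_cong simp: mult_ac split: split_indicator)
  also have "\<dots> = ennreal pi * (\<integral>\<^sup>+s. h (- s) * indicator {0..} (- s) \<partial>lborel)"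
    by (rule nn_integral_cmult) measurable
  also have "(\<integral>\<^sup>+s. h (- s) * indicator {0..} (- s) \<partial>lborel) = (\<integral>\<^sup>+s. h s * indicator {0..} s \<partial>lborel)"
    using nn_integral_reflect[of "\<lambda>s. h s * indicator {0..} s" 0] by simp
  finally show ?thesis by (subst (asm) nn_integral_distr) (simp_all add: f_def add.commute)
qed

text \<open>The third coordinate is listed first so that Fubini splits off the axis and leaves the
  plane orthogonal to it.\<close>

lemma lborel_real3: "(lborel :: (real^3) measure) = distr lborel borel (\<lambda>(z, x, y). vector [x, y, z])"
proof (rule lborel_eqI)
  have v: "(\<lambda>(z, x, y). vector [x, y, z] :: real^3) = (\<lambda>w. fst (snd w) *\<^sub>R axis 1 1 + snd (snd w) *\<^sub>R axis 2 1 + fst w *\<^sub>R axis 3 1)"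
    by (auto simp: fun_eq_iff vec_eq_iff forall_3 axis_def)
  have [measurable]: "(\<lambda>(z, x, y). vector [x, y, z] :: real^3) \<in> borel_measurable borel"
    unfolding v by (intro borel_measurable_continuous_onI continuous_intros)
  fix l u :: "real^3" assume lu: "\<And>b. b \<in> Basis \<Longrightarrow> l \<bullet> b \<le> u \<bullet> b"
  have le: "l $ i \<le> u $ i" for i using lu[of "axis i 1"] by (simp add: inner_axis)
  have pre: "(\<lambda>(z, x, y). vector [x, y, z] :: real^3) -` box l u = {l$3<..<u$3} \<times> ({l$1<..<u$1} \<times> {l$2<..<u$2})"
    by (auto simp: mem_box_cart forall_3)
  have "emeasure (distr lborel borel (\<lambda>(z, x, y). vector [x, y, z])) (box l u)
     = emeasure lborel ({l$3<..<u$3} \<times> ({l$1<..<u$1} \<times> {l$2<..<u$2}))"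
    by (subst emeasure_distr) (auto simp: pre)
  also have "\<dots> = ennreal (u$3 - l$3) * (ennreal (u$1 - l$1) * ennreal (u$2 - l$2))"
    using le by (simp add: lborel_prod[symmetric] lborel.emeasure_pair_measure_Times sigma_finite_measure.emeasure_pair_measure_Times[OF lborel_pair.P.sigma_finite_measure_axioms])
  also have "\<dots> = (\<Prod>b\<in>Basis. (u - l) \<bullet> b)"
  proof -
    have B: "Basis = (\<lambda>i. axis i (1::real)) ` (UNIV :: 3 set)" by (auto simp: Basis_vec_def)
    have i: "inj (\<lambda>i::3. axis i (1::real))" by (auto simp: inj_def axis_eq_axis)
    have "(\<Prod>b\<in>Basis. (u - l) \<bullet> b) = (\<Prod>i\<in>UNIV. (u - l) $ i)"
      unfolding B by (subst prod.reindex[OF i]) (simp add: inner_axis)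
    also have "\<dots> = (u$3 - l$3) * ((u$1 - l$1) * (u$2 - l$2))"
    proof -
      have "prod f (UNIV :: 3 set) = f 3 * (f 1 * f 2)" for f :: "3 \<Rightarrow> real" unfolding UNIV_3 by simp
      then show ?thesis by simp
    qed
    finally have "(\<Prod>b\<in>Basis. (u - l) \<bullet> b) = (u$3 - l$3) * ((u$1 - l$1) * (u$2 - l$2))" .
    then show ?thesis using le by (simp only:) (simp add: ennreal_mult)
  qed
  finally show "emeasure (distr lborel borel (\<lambda>(z, x, y). vector [x, y, z])) (box l u) = (\<Prod>b\<in>Basis. (u - l) \<bullet> b)" .
qed simp

lemma nn_integral_real3:
  fixes f :: "real^3 \<Rightarrow> ennreal"
  assumes [measurable]: "f \<in> borel_measurable borel"
  shows "(\<integral>\<^sup>+\<xi>. f \<xi> \<partial>lborel) = (\<integral>\<^sup>+z. \<integral>\<^sup>+w. f (vector [fst w, snd w, z]) \<partial>(lborel :: (real \<times> real) measure) \<partial>lborel)"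
proof -
  define v where "v = (\<lambda>(z, x, y). vector [x, y, z] :: real^3)"
  have "v = (\<lambda>w. fst (snd w) *\<^sub>R axis 1 1 + snd (snd w) *\<^sub>R axis 2 1 + fst w *\<^sub>R axis 3 1)"
    by (auto simp: v_def fun_eq_iff vec_eq_iff forall_3 axis_def)
  then have "v \<in> borel_measurable borel"
    by (simp only:) (intro borel_measurable_continuous_onI continuous_intros)
  then have v [measurable]: "v \<in> borel_measurable (borel \<Otimes>\<^sub>M borel)" by (simp add: borel_prod)
  have "(\<integral>\<^sup>+\<xi>. f \<xi> \<partial>lborel) = (\<integral>\<^sup>+x. f (v x) \<partial>lborel)"
    unfolding lborel_real3 v_def[symmetric] using v by (subst nn_integral_distr) (auto simp: borel_prod)
  also have "\<dots> = (\<integral>\<^sup>+x. f (v x) \<partial>(lborel \<Otimes>\<^sub>M lborel))" by (simp add: lborel_prod)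
  also have "\<dots> = (\<integral>\<^sup>+z. \<integral>\<^sup>+w. f (v (z, w)) \<partial>lborel \<partial>lborel)"
    by (rule lborel.nn_integral_fst[symmetric]) measurable
  finally show ?thesis by (simp add: v_def case_prod_unfold)
qed

lemma norm_vector3: "(norm (vector [x, y, z] :: real^3))\<^sup>2 = x\<^sup>2 + y\<^sup>2 + z\<^sup>2"
  by (simp only: power2_norm_eq_inner inner_vec_def sum_3) (simp add: power2_eq_square)

text \<open>The pair of \<open>(norm \<xi>)\<^sup>2\<close> and \<open>\<xi> $ 3\<close> has density
  at most \<pi>: for a fixed third coordinate the squared radius in the plane is uniform, and adding
  the square of the third coordinate only shifts it. For a fixed norm the condition confines the
  third coordinate to an interval of length 2 l / k, whatever measurable function g is.\<close>

lemma emeasure_axial_shell: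
  assumes k: "k > 0" and w: "w1 \<le> w2" and l: "l \<ge> 0" and [measurable]: "g \<in> borel_measurable borel"
  shows "emeasure lborel {\<xi>::real^3. (norm \<xi>)\<^sup>2 \<in> {w1..w2} \<and> \<bar>k * \<xi> $ 3 - g ((norm \<xi>)\<^sup>2)\<bar> \<le> l} \<le> ennreal (pi * (w2 - w1) * (2 * l / k))"
proof -
  define I :: "real \<Rightarrow> real \<Rightarrow> ennreal" where "I s z = indicator {w1..w2} s * indicator {..l} \<bar>k * z - g s\<bar>" for s z
  have I [measurable (raw)]: "(\<lambda>x. I (u x) (v x)) \<in> borel_measurable M"
    if [measurable]: "u \<in> borel_measurable M" "v \<in> borel_measurable M" for u v and M :: "'z measure"
    unfolding I_def by measurable
  have [measurable]: "(\<lambda>\<xi>::real^3. \<xi> $ 3) \<in> borel_measurable borel" "(\<lambda>\<xi>::real^3. (norm \<xi>)\<^sup>2) \<in> borel_measurable borel"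
    by (intro borel_measurable_continuous_onI continuous_intros)+
  define S where "S = {\<xi>::real^3. (norm \<xi>)\<^sup>2 \<in> {w1..w2} \<and> \<bar>k * \<xi> $ 3 - g ((norm \<xi>)\<^sup>2)\<bar> \<le> l}"
  have Sm: "S \<in> sets lborel"
  proof -
    have "{\<xi> \<in> space borel. (norm \<xi>)\<^sup>2 \<in> {w1..w2} \<and> \<bar>k * \<xi> $ 3 - g ((norm \<xi>)\<^sup>2)\<bar> \<le> l} \<in> sets (borel :: (real^3) measure)"
      by measurable
    then show ?thesis by (simp add: S_def)
  qed
  have fin: "(\<integral>\<^sup>+z. I s z \<partial>lborel) \<le> indicator {w1..w2} s * ennreal (2 * l / k)" for s
  proof -
    have "(\<integral>\<^sup>+z. I s z \<partial>lborel) \<le> (\<integral>\<^sup>+z. indicator {w1..w2} s * indicator {(g s - l) / k..(g s + l) / k} z \<partial>lborel)"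
      using k by (intro nn_integral_mono) (auto simp: I_def divide_le_eq le_divide_eq mult.commute split: split_indicator)
    also have "\<dots> = indicator {w1..w2} s * ennreal (2 * l / k)"
      using k l by (subst nn_integral_cmult_indicator) (auto simp: divide_right_mono diff_divide_distrib[symmetric])
    finally show ?thesis .
  qed
  have "emeasure lborel S = (\<integral>\<^sup>+\<xi>. indicator S \<xi> \<partial>lborel)" using Sm by simp
  also have "\<dots> = (\<integral>\<^sup>+\<xi>. I ((norm \<xi>)\<^sup>2) (\<xi> $ 3) \<partial>(lborel :: (real^3) measure))"
  proof -
    have "indicator S = (\<lambda>\<xi>. I ((norm \<xi>)\<^sup>2) (\<xi> $ 3))"
      by (auto simp: fun_eq_iff S_def I_def split: split_indicator)
    then show ?thesis by simp
  qed
  also have "\<dots> = (\<integral>\<^sup>+z. \<integral>\<^sup>+w. I ((fst w)\<^sup>2 + (snd w)\<^sup>2 + z\<^sup>2) z \<partial>(lborel :: (real \<times> real) measure) \<partial>lborel)"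
    by (subst nn_integral_real3) (simp_all add: norm_vector3)
  also have "\<dots> = (\<integral>\<^sup>+z. ennreal pi * (\<integral>\<^sup>+s. I (s + z\<^sup>2) z * indicator {0..} s \<partial>lborel) \<partial>lborel)"
    by (intro nn_integral_cong nn_integral_sum_squares[where h="\<lambda>s. I (s + _\<^sup>2) _"]) measurable
  also have "\<dots> \<le> (\<integral>\<^sup>+z. ennreal pi * (\<integral>\<^sup>+s. I (z\<^sup>2 + s) z \<partial>lborel) \<partial>lborel)"
    by (intro nn_integral_mono mult_left_mono) (auto simp: add.commute split: split_indicator)
  also have "\<dots> = (\<integral>\<^sup>+z. ennreal pi * (\<integral>\<^sup>+s. I s z \<partial>lborel) \<partial>lborel)"
    by (intro nn_integral_cong arg_cong2[where f="(*)"] refl nn_integral_translate[where f="\<lambda>s. I s _"]) measurable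
  also have "\<dots> = ennreal pi * (\<integral>\<^sup>+z. \<integral>\<^sup>+s. I s z \<partial>lborel \<partial>lborel)"
    by (rule nn_integral_cmult) measurable
  also have "(\<integral>\<^sup>+z. \<integral>\<^sup>+s. I s z \<partial>lborel \<partial>lborel) = (\<integral>\<^sup>+s. \<integral>\<^sup>+z. I s z \<partial>lborel \<partial>lborel)"
    by (rule lborel_pair.Fubini') measurable
  also have "ennreal pi * (\<integral>\<^sup>+s. \<integral>\<^sup>+z. I s z \<partial>lborel \<partial>lborel) \<le> ennreal pi * (\<integral>\<^sup>+s. indicator {w1..w2} s * ennreal (2 * l / k) \<partial>lborel)"
    by (intro mult_left_mono nn_integral_mono fin) simp
  also have "\<dots> = ennreal (pi * (w2 - w1) * (2 * l / k))"
  proof -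
    have "0 \<le> 2 * l / k" using k l by simp
    then have "ennreal pi * (ennreal (w2 - w1) * ennreal (2 * l / k)) = ennreal (pi * (w2 - w1) * (2 * l / k))"
      using w by (simp add: ennreal_mult mult.assoc del: times_divide_eq_right times_divide_eq_left)
    then show ?thesis using w by (subst nn_integral_multc) auto
  qed
  finally show ?thesis by (simp add: S_def)
qed

text \<open>A rotation of \<eta> onto the third axis reduces this to the axial case. The sets are
  bounded Borel sets, so the invariance of Lebesgue measure under orthogonal maps carries over to
  \<open>lborel\<close>.\<close>

lemma emeasure_shell:
  fixes \<eta> :: "real^3"
  assumes \<eta>: "\<eta> \<noteq> 0" and w: "w1 \<le> w2" and l: "l \<ge> 0" and [measurable]: "g \<in> borel_measurable borel"
  shows "emeasure lborel {\<xi>::real^3. (norm \<xi>)\<^sup>2 \<in> {w1..w2} \<and> \<bar>\<eta> \<bullet> \<xi> - g ((norm \<xi>)\<^sup>2)\<bar> \<le> l} \<le> ennreal (pi * (w2 - w1) * (2 * l / norm \<eta>))"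
proof -
  define k where "k = norm \<eta>"
  have k: "k > 0" using \<eta> by (simp add: k_def)
  define S where "S = {\<xi>::real^3. (norm \<xi>)\<^sup>2 \<in> {w1..w2} \<and> \<bar>\<eta> \<bullet> \<xi> - g ((norm \<xi>)\<^sup>2)\<bar> \<le> l}"
  define S' where "S' = {\<xi>::real^3. (norm \<xi>)\<^sup>2 \<in> {w1..w2} \<and> \<bar>k * \<xi> $ 3 - g ((norm \<xi>)\<^sup>2)\<bar> \<le> l}"
  have "norm \<eta> = norm (k *\<^sub>R (axis 3 1 :: real^3))" using k by (simp add: k_def)
  then obtain f :: "real^3 \<Rightarrow> real^3" where f: "orthogonal_transformation f" "f \<eta> = k *\<^sub>R axis 3 1"
    by (rule orthogonal_transformation_exists)
  have fi: "f x \<bullet> f y = x \<bullet> y" "norm (f x) = norm x" for x y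
    using f(1) orthogonal_transformation_norm[of f] by (simp_all add: orthogonal_transformation_def)
  have "k * f \<xi> $ 3 = \<eta> \<bullet> \<xi>" for \<xi>
    using fi(1)[of \<eta> \<xi>] unfolding f(2) by (simp add: inner_axis')
  then have im: "f ` S \<subseteq> S'" by (auto simp: S_def S'_def fi)
  have m [measurable]: "(\<lambda>\<xi>::real^3. \<xi> $ 3) \<in> borel_measurable borel" "(\<lambda>\<xi>::real^3. \<eta> \<bullet> \<xi>) \<in> borel_measurable borel"
     "(\<lambda>\<xi>::real^3. (norm \<xi>)\<^sup>2) \<in> borel_measurable borel"
    by (intro borel_measurable_continuous_onI continuous_intros)+
  have bd: "T \<in> lmeasurable" if "T \<in> sets borel" "\<And>\<xi>. \<xi> \<in> T \<Longrightarrow> (norm \<xi>)\<^sup>2 \<le> w2" for T :: "(real^3) set"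
  proof (rule bounded_set_imp_lmeasurable)
    have "norm \<xi> \<le> sqrt w2" if "\<xi> \<in> T" for \<xi>
      using \<open>\<And>\<xi>. \<xi> \<in> T \<Longrightarrow> (norm \<xi>)\<^sup>2 \<le> w2\<close>[OF that] by (rule real_le_rsqrt)
    then show "bounded T" by (auto simp: bounded_iff)
  qed (use that in auto)
  have Sb: "S \<in> sets borel"
  proof -
    have "{\<xi> \<in> space borel. (norm \<xi>)\<^sup>2 \<in> {w1..w2} \<and> \<bar>\<eta> \<bullet> \<xi> - g ((norm \<xi>)\<^sup>2)\<bar> \<le> l} \<in> sets (borel :: (real^3) measure)"
      by measurable
    then show ?thesis by (simp add: S_def)
  qed
  have S'b: "S' \<in> sets borel"
  proof -
    have "{\<xi> \<in> space borel. (norm \<xi>)\<^sup>2 \<in> {w1..w2} \<and> \<bar>k * \<xi> $ 3 - g ((norm \<xi>)\<^sup>2)\<bar> \<le> l} \<in> sets (borel :: (real^3) measure)"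
      by measurable
    then show ?thesis by (simp add: S'_def)
  qed
  have SS: "S \<in> lmeasurable" "S' \<in> lmeasurable" by (rule bd; use Sb S'b in \<open>auto simp: S_def S'_def\<close>)+
  have "measure lebesgue S = measure lebesgue (f ` S)"
    using measure_orthogonal_image[OF f(1) SS(1)] by simp
  also have "\<dots> \<le> measure lebesgue S'"
    using im SS measurable_orthogonal_image[OF f(1) SS(1)] by (intro measure_mono_fmeasurable) auto
  finally have le: "measure lebesgue S \<le> measure lebesgue S'" .
  have e: "emeasure lborel T = ennreal (measure lebesgue T)" if "T \<in> lmeasurable" "T \<in> sets borel" for T :: "(real^3) set"
  proof -
    have "emeasure lebesgue T = emeasure lborel T" using that(2) by (simp add: emeasure_completion main_part_sets)
    then show ?thesis using emeasure_eq_measure2[OF that(1)] by simp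
  qed
  have "emeasure lborel S \<le> emeasure lborel S'"
    unfolding e[OF SS(1) Sb] e[OF SS(2) S'b] using le by (rule ennreal_leI)
  also have "\<dots> \<le> ennreal (pi * (w2 - w1) * (2 * l / k))"
    unfolding S'_def by (rule emeasure_axial_shell) (use k w l in auto)
  finally show ?thesis by (simp add: S_def k_def)
qed

section \<open>Modulation tubes, intersections of thickened cones, and sets with short
  fibres\<close>

lemma emeasure_tau:
  assumes "L \<ge> 0"
  shows "emeasure lborel {\<tau>::real. \<bar>\<bar>c - \<tau>\<bar> - \<rho>\<bar> \<le> L} \<le> ennreal (4 * L)"
proof -
  have "emeasure lborel {\<tau>::real. \<bar>\<bar>c - \<tau>\<bar> - \<rho>\<bar> \<le> L} \<le> emeasure lborel ({c - \<rho> - L..c - \<rho> + L} \<union> {c + \<rho> - L..c + \<rho> + L})"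
    by (intro emeasure_mono) auto
  also have "\<dots> \<le> emeasure lborel {c - \<rho> - L..c - \<rho> + L} + emeasure lborel {c + \<rho> - L..c + \<rho> + L}"
    by (rule emeasure_subadditive) auto
  also have "\<dots> = ennreal (4 * L)" using assms by (simp add: ennreal_plus[symmetric] del: ennreal_plus)
  finally show ?thesis .
qed

lemma emeasure_st_le:
  assumes S: "S \<in> sets (borel :: st measure)" and B: "B \<in> sets borel"
    and fib: "\<And>\<xi>. emeasure lborel {\<tau>. (\<tau>, \<xi>) \<in> S} \<le> A * indicator B \<xi>"
  shows "emeasure lborel S \<le> A * emeasure lborel B"
proof -
  have S': "S \<in> sets (lborel \<Otimes>\<^sub>M lborel)" unfolding lborel_prod using S by simp
  have "emeasure lborel S = emeasure (lborel \<Otimes>\<^sub>M lborel) S" by (simp add: lborel_prod)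
  also have "\<dots> = (\<integral>\<^sup>+\<xi>. emeasure lborel ((\<lambda>\<tau>. (\<tau>, \<xi>)) -` S) \<partial>lborel)"
    by (rule lborel_pair.emeasure_pair_measure_alt2[OF S'])
  also have "\<dots> \<le> (\<integral>\<^sup>+\<xi>. A * indicator B \<xi> \<partial>lborel)"
    using fib by (intro nn_integral_mono) (simp add: vimage_def)
  also have "\<dots> = A * emeasure lborel B" using B by (intro nn_integral_cmult_indicator) simp
  finally show ?thesis .
qed

lemma emeasure_ball3: "R \<ge> 0 \<Longrightarrow> emeasure lborel (cball (a::real^3) R) \<le> ennreal (8 * R ^ 3)"
proof -
  assume R: "R \<ge> 0"
  have "unit_ball_vol 3 \<le> 8" using pi_less_4 by (simp add: unit_ball_vol_3)
  then show ?thesis using R by (simp add: emeasure_cball ennreal_leI mult_right_mono)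
qed

definition tube :: "st \<Rightarrow> real" where "tube p = \<bar>\<bar>fst p\<bar> - norm (snd p)\<bar>"

lemma continuous_on_tube [continuous_intros]: "continuous_on A f \<Longrightarrow> continuous_on A (\<lambda>x. tube (f x))"
  unfolding tube_def by (intro continuous_intros)

lemma tube_uminus [simp]: "tube (- p) = tube p" by (simp add: tube_def)

lemma emeasure_tube:
  assumes R: "R \<ge> 0" and L: "L \<ge> 0"
  shows "emeasure lborel {q. norm (snd q) \<le> R \<and> tube (p - q) \<le> L} \<le> ennreal (32 * R ^ 3 * L)"
proof -
  have "emeasure lborel {q. norm (snd q) \<le> R \<and> tube (p - q) \<le> L} \<le> ennreal (4 * L) * emeasure lborel (cball (0::real^3) R)"
  proof (rule emeasure_st_le)
    show "{q. norm (snd q) \<le> R \<and> tube (p - q) \<le> L} \<in> sets borel"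
      by (intro borel_closed closed_Collect_conj closed_Collect_le continuous_intros)
    fix \<xi> :: "real^3"
    show "emeasure lborel {\<tau>. (\<tau>, \<xi>) \<in> {q. norm (snd q) \<le> R \<and> tube (p - q) \<le> L}} \<le> ennreal (4 * L) * indicator (cball 0 R) \<xi>"
      using emeasure_tau[OF L, of "fst p" "norm (snd p - \<xi>)"] by (cases "norm \<xi> \<le> R") (simp_all add: tube_def)
  qed simp
  also have "\<dots> \<le> ennreal (4 * L) * ennreal (8 * R ^ 3)" by (intro mult_left_mono emeasure_ball3 R) simp
  also have "\<dots> = ennreal (32 * R ^ 3 * L)" using R L by (simp add: ennreal_mult[symmetric] mult_ac)
  finally show ?thesis .
qed

text \<open>If the fibre over \<open>\<xi>\<close> is nonempty, then squaring \<open>\<bar>\<eta> - \<xi>\<bar> = \<bar>t \<mp> \<bar>\<xi>\<bar>\<bar> + O(L1 + L2)\<close> shows that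
  \<open>\<eta> \<bullet> \<xi>\<close> is determined by \<open>\<bar>\<xi>\<bar>\<close> up to an error.\<close>

lemma emeasure_cone_intersection:
  assumes \<eta>: "snd p \<noteq> 0" and w: "w1 \<le> w2" and V: "V \<ge> 0" and L: "L1 \<ge> 0" "L2 \<ge> 0"
  shows "emeasure lborel {q. (norm (snd q))\<^sup>2 \<in> {w1..w2} \<and> norm (snd (p - q)) \<le> V \<and> tube q \<le> L1 \<and> tube (p - q) \<le> L2}
     \<le> ennreal (16 * pi * (w2 - w1) * L1 * L2 * (2 * V + L1 + L2) / norm (snd p))"
proof -
  define S where "S = {q. (norm (snd q))\<^sup>2 \<in> {w1..w2} \<and> norm (snd (p - q)) \<le> V \<and> tube q \<le> L1 \<and> tube (p - q) \<le> L2}"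
  define \<eta> t where "\<eta> = snd p" and "t = fst p"
  define L where "L = L1 + L2"
  \<comment> \<open>Below, b = |t - e r| and v differ by at most L and v \<le> V, so b + v \<le> 2 V
    + L; hence half of |b^2 - v^2| is at most l.\<close>
  define l where "l = L * (2 * V + L) / 2"
  define g where "g e w = ((norm \<eta>)\<^sup>2 + w - (t - e * sqrt w)\<^sup>2) / 2" for e w :: real
  define B where "B e = {\<xi>::real^3. (norm \<xi>)\<^sup>2 \<in> {w1..w2} \<and> \<bar>\<eta> \<bullet> \<xi> - g e ((norm \<xi>)\<^sup>2)\<bar> \<le> l}" for e
  have l: "l \<ge> 0" using L V by (simp add: l_def L_def)
  have gm [measurable]: "g e \<in> borel_measurable borel" for e unfolding g_def by measurable
  have [measurable]: "(\<lambda>\<xi>::real^3. \<eta> \<bullet> \<xi>) \<in> borel_measurable borel" "(\<lambda>\<xi>::real^3. (norm \<xi>)\<^sup>2) \<in> borel_measurable borel"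
    by (intro borel_measurable_continuous_onI continuous_intros)+
  have Bm: "B e \<in> sets borel" for e
  proof -
    have "{\<xi> \<in> space borel. (norm \<xi>)\<^sup>2 \<in> {w1..w2} \<and> \<bar>\<eta> \<bullet> \<xi> - g e ((norm \<xi>)\<^sup>2)\<bar> \<le> l} \<in> sets (borel :: (real^3) measure)"
      by measurable
    then show ?thesis by (simp add: B_def)
  qed
  have key: "\<xi> \<in> B 1 \<union> B (-1)" if "(\<tau>, \<xi>) \<in> S" for \<tau> \<xi>
  proof -
    \<comment> \<open>The sign of the time frequency tells near which sheet of the cone the point
      lies, and thus which of the radial functions \<open>g 1\<close> and \<open>g (-1)\<close>
      applies.\<close>
    define e :: real where "e = (if \<tau> \<ge> 0 then 1 else -1)"
    define r v where "r = norm \<xi>" and "v = norm (\<eta> - \<xi>)"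
    define b where "b = \<bar>t - e * r\<bar>"
    have h: "r\<^sup>2 \<in> {w1..w2}" "v \<le> V" "\<bar>\<bar>\<tau>\<bar> - r\<bar> \<le> L1" "\<bar>\<bar>t - \<tau>\<bar> - v\<bar> \<le> L2"
      using that by (auto simp: S_def r_def v_def \<eta>_def t_def tube_def)
    have "\<bar>b - v\<bar> \<le> L" using h(3,4) unfolding b_def e_def L_def by (auto split: if_splits)
    moreover have "b \<ge> 0" "v \<ge> 0" by (auto simp: b_def v_def)
    ultimately have "\<bar>b - v\<bar> * (b + v) \<le> L * (2 * V + L)" using h(2) by (intro mult_mono) auto
    also have "\<bar>b - v\<bar> * (b + v) = \<bar>b\<^sup>2 - v\<^sup>2\<bar>"
      using \<open>b \<ge> 0\<close> \<open>v \<ge> 0\<close> by (simp add: power2_eq_square square_diff_square_factored abs_mult mult.commute)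
    finally have *: "\<bar>b\<^sup>2 - v\<^sup>2\<bar> \<le> 2 * l" by (simp add: l_def)
    have "b\<^sup>2 = (t - e * sqrt (r\<^sup>2))\<^sup>2" by (simp add: b_def r_def)
    moreover have "v\<^sup>2 = (norm \<eta>)\<^sup>2 - 2 * (\<eta> \<bullet> \<xi>) + r\<^sup>2"
      unfolding v_def r_def power2_norm_eq_inner by (simp add: inner_diff_left inner_diff_right inner_commute)
    ultimately have "\<eta> \<bullet> \<xi> - g e (r\<^sup>2) = (b\<^sup>2 - v\<^sup>2) / 2" by (simp add: g_def field_simps)
    then have "\<bar>\<eta> \<bullet> \<xi> - g e (r\<^sup>2)\<bar> \<le> l" using * by simp
    then show ?thesis using h(1) by (auto simp: B_def r_def e_def split: if_splits)
  qed
  \<comment> \<open>Over each admissible \<xi> both tubes restrict \<tau>, so the narrower one can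
    be taken; its product with the thickness L1 + L2 of the shell is then at most 2 L1 L2.\<close>
  have "emeasure lborel S \<le> ennreal (4 * min L1 L2) * emeasure lborel (B 1 \<union> B (-1))"
  proof (rule emeasure_st_le)
    show "S \<in> sets borel" unfolding S_def atLeastAtMost_iff
      by (intro borel_closed closed_Collect_conj closed_Collect_le continuous_intros)
    fix \<xi> :: "real^3"
    show "emeasure lborel {\<tau>. (\<tau>, \<xi>) \<in> S} \<le> ennreal (4 * min L1 L2) * indicator (B 1 \<union> B (-1)) \<xi>"
    proof (cases "\<xi> \<in> B 1 \<union> B (-1)")
      case False
      then have "{\<tau>. (\<tau>, \<xi>) \<in> S} = {}" using key by blast
      then show ?thesis by simp
    next
      case True
      have "emeasure lborel {\<tau>. (\<tau>, \<xi>) \<in> S} \<le> emeasure lborel {\<tau>. \<bar>\<bar>0 - \<tau>\<bar> - norm \<xi>\<bar> \<le> L1}"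
        by (intro emeasure_mono) (auto simp: S_def tube_def intro!: borel_closed closed_Collect_le continuous_intros)
      moreover have "emeasure lborel {\<tau>. (\<tau>, \<xi>) \<in> S} \<le> emeasure lborel {\<tau>. \<bar>\<bar>t - \<tau>\<bar> - norm (\<eta> - \<xi>)\<bar> \<le> L2}"
        by (intro emeasure_mono) (auto simp: S_def tube_def t_def \<eta>_def intro!: borel_closed closed_Collect_le continuous_intros)
      ultimately show ?thesis
        using emeasure_tau[OF L(1), of 0 "norm \<xi>"] emeasure_tau[OF L(2), of t "norm (\<eta> - \<xi>)"] True
        by (auto simp: min_def intro: order_trans)
    qed
  qed (use Bm in auto)
  also have "\<dots> \<le> ennreal (4 * min L1 L2) * (ennreal (pi * (w2 - w1) * (2 * l / norm \<eta>)) + ennreal (pi * (w2 - w1) * (2 * l / norm \<eta>)))"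
  proof (rule mult_left_mono)
    have "emeasure lborel (B 1 \<union> B (-1)) \<le> emeasure lborel (B 1) + emeasure lborel (B (-1))"
      by (rule emeasure_subadditive) (use Bm in auto)
    also have "\<dots> \<le> ennreal (pi * (w2 - w1) * (2 * l / norm \<eta>)) + ennreal (pi * (w2 - w1) * (2 * l / norm \<eta>))"
      unfolding B_def by (intro add_mono emeasure_shell w l gm) (use assms(1) in \<open>auto simp: \<eta>_def\<close>)
    finally show "emeasure lborel (B 1 \<union> B (-1)) \<le> \<dots>" .
  qed simp
  also have "\<dots> = ennreal (4 * min L1 L2 * (2 * (pi * (w2 - w1) * (2 * l / norm \<eta>))))"
  proof -
    define x where "x = pi * (w2 - w1) * (2 * l / norm \<eta>)"
    have x: "x \<ge> 0" using w l by (simp add: x_def)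
    have "ennreal x + ennreal x = ennreal (2 * x)" using x by (metis ennreal_plus mult_2)
    moreover have "ennreal (4 * min L1 L2) * ennreal (2 * x) = ennreal (4 * min L1 L2 * (2 * x))"
      using x L by (intro ennreal_mult[symmetric]) auto
    ultimately show ?thesis unfolding x_def by simp
  qed
  also have "\<dots> \<le> ennreal (16 * pi * (w2 - w1) * L1 * L2 * (2 * V + L1 + L2) / norm \<eta>)"
  proof (rule ennreal_leI)
    have "min L1 L2 * L \<le> 2 * L1 * L2"
    proof -
      have "min L1 L2 * L1 \<le> L2 * L1" "min L1 L2 * L2 \<le> L1 * L2" using L by (auto intro!: mult_right_mono)
      then show ?thesis unfolding L_def by (simp add: algebra_simps)
    qed
    then have "min L1 L2 * L * (8 * pi * (w2 - w1) * (2 * V + L) / norm \<eta>) \<le> 2 * L1 * L2 * (8 * pi * (w2 - w1) * (2 * V + L) / norm \<eta>)"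
      using w V L by (intro mult_right_mono) (auto simp: L_def)
    moreover have "4 * min L1 L2 * (2 * (pi * (w2 - w1) * (2 * l / norm \<eta>))) = min L1 L2 * L * (8 * pi * (w2 - w1) * (2 * V + L) / norm \<eta>)"
    proof -
      have l2: "2 * l = L * (2 * V + L)" by (simp add: l_def)
      show ?thesis unfolding l2 by simp
    qed
    moreover have "2 * L1 * L2 * (8 * pi * (w2 - w1) * (2 * V + L) / norm \<eta>) = 16 * pi * (w2 - w1) * L1 * L2 * (2 * V + L1 + L2) / norm \<eta>"
      unfolding L_def add.assoc by simp
    ultimately show "4 * min L1 L2 * (2 * (pi * (w2 - w1) * (2 * l / norm \<eta>))) \<le> 16 * pi * (w2 - w1) * L1 * L2 * (2 * V + L1 + L2) / norm \<eta>"
      by (simp only:)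
  qed
  finally show ?thesis by (simp add: S_def \<eta>_def)
qed

text \<open>Each line parallel to the third axis meets S in a subset of an interval of length 2 d
  centred at any of its points, and the lines that meet S at all pass through a square of side 2
  R.\<close>

lemma emeasure_fibred_axial:
  assumes S: "S \<in> sets borel" and SR: "S \<subseteq> cball (a::real^3) R" and R: "R \<ge> 0" and d: "d \<ge> 0"
    and fib: "\<And>\<xi> s. \<xi> \<in> S \<Longrightarrow> \<xi> + s *\<^sub>R axis 3 1 \<in> S \<Longrightarrow> s \<le> d"
  shows "emeasure lborel S \<le> ennreal (8 * R\<^sup>2 * d)"
proof -
  note S [measurable]
  define Q where "Q = {a$1 - R..a$1 + R} \<times> {a$2 - R..a$2 + R}"
  have vm [measurable]: "(\<lambda>x. vector [fst (snd x), snd (snd x), fst x] :: real^3) \<in> borel_measurable (borel \<Otimes>\<^sub>M borel)"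
  proof -
    have "(\<lambda>x. vector [fst (snd x), snd (snd x), fst x] :: real^3) = (\<lambda>w. fst (snd w) *\<^sub>R axis 1 1 + snd (snd w) *\<^sub>R axis 2 1 + fst w *\<^sub>R axis 3 1)"
      by (auto simp: fun_eq_iff vec_eq_iff forall_3 axis_def)
    then show ?thesis unfolding borel_prod by (simp only:) (intro borel_measurable_continuous_onI continuous_intros)
  qed
  have "emeasure lborel S = (\<integral>\<^sup>+\<xi>. indicator S \<xi> \<partial>lborel)" by simp
  also have "\<dots> = (\<integral>\<^sup>+z. \<integral>\<^sup>+w. indicator S (vector [fst w, snd w, z]) \<partial>(lborel :: (real \<times> real) measure) \<partial>lborel)"
    by (rule nn_integral_real3) simp
  also have "\<dots> = (\<integral>\<^sup>+w. \<integral>\<^sup>+z. indicator S (vector [fst w, snd w, z]) \<partial>lborel \<partial>(lborel :: (real \<times> real) measure))"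
  proof (rule lborel_pair.Fubini'[symmetric])
    have "(\<lambda>x. indicator S (vector [fst (snd x), snd (snd x), fst x]) :: ennreal) \<in> borel_measurable (borel \<Otimes>\<^sub>M borel)"
      by measurable
    then show "(\<lambda>(z, w). indicator S (vector [fst w, snd w, z]) :: ennreal) \<in> borel_measurable (lborel \<Otimes>\<^sub>M (lborel :: (real \<times> real) measure))"
      unfolding lborel_prod borel_prod by (simp add: case_prod_unfold)
  qed
  also have "\<dots> \<le> (\<integral>\<^sup>+w. ennreal (2 * d) * indicator Q w \<partial>lborel)"
  proof (rule nn_integral_mono)
    fix w :: "real \<times> real"
    define Z where "Z = {z. vector [fst w, snd w, z] \<in> S}"
    show "(\<integral>\<^sup>+z. indicator S (vector [fst w, snd w, z]) \<partial>lborel) \<le> ennreal (2 * d) * indicator Q w"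
    proof (cases "Z = {}")
      case True
      then have "(\<integral>\<^sup>+z. indicator S (vector [fst w, snd w, z]) \<partial>lborel) = (\<integral>\<^sup>+(z::real). 0 \<partial>lborel)"
        by (intro nn_integral_cong) (auto simp: Z_def split: split_indicator)
      then show ?thesis by simp
    next
      case False
      then obtain z0 where z0: "vector [fst w, snd w, z0] \<in> S" by (auto simp: Z_def)
      have "norm (a - vector [fst w, snd w, z0]) \<le> R" using z0 SR by (auto simp: dist_norm)
      then have "\<bar>(a - vector [fst w, snd w, z0]) $ i\<bar> \<le> R" for i using component_le_norm_cart order_trans by blast
      from this[of 1] this[of 2] have wQ: "w \<in> Q" by (cases w) (auto simp: Q_def)
      have "z \<in> {z0 - d..z0 + d}" if "vector [fst w, snd w, z] \<in> S" for z
      proof -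
        have v: "vector [fst w, snd w, z'] = vector [fst w, snd w, z''] + (z' - z'') *\<^sub>R (axis 3 1 :: real^3)" for z' z''
          by (auto simp: vec_eq_iff forall_3 axis_def)
        have "z - z0 \<le> d" by (rule fib[OF z0], fold v, rule that)
        moreover have "z0 - z \<le> d" by (rule fib[OF that], fold v, rule z0)
        ultimately show ?thesis by simp
      qed
      then have "(\<integral>\<^sup>+z. indicator S (vector [fst w, snd w, z]) \<partial>lborel) \<le> (\<integral>\<^sup>+z. indicator {z0 - d..z0 + d} z \<partial>lborel)"
        by (intro nn_integral_mono) (auto split: split_indicator)
      also have "\<dots> = ennreal (2 * d)" using d by simp
      finally show ?thesis using wQ by simp
    qed
  qed
  also have "\<dots> = ennreal (2 * d) * emeasure lborel Q"
  proof (rule nn_integral_cmult_indicator)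
    have "closed Q" unfolding Q_def by (intro closed_Times) auto
    then show "Q \<in> sets lborel" by simp
  qed
  also have "emeasure lborel Q = ennreal (2 * R) * ennreal (2 * R)"
    using R unfolding Q_def lborel_prod[symmetric] by (subst lborel.emeasure_pair_measure_Times) auto
  also have "ennreal (2 * d) * (ennreal (2 * R) * ennreal (2 * R)) = ennreal (8 * R\<^sup>2 * d)"
    using R d by (simp add: ennreal_mult[symmetric] power2_eq_square mult_ac)
  finally show ?thesis .
qed

text \<open>The direction e is rotated onto the third axis. Closedness makes the rotated image
  compact and hence Borel.\<close>

lemma emeasure_fibred:
  assumes S: "S \<in> sets borel" and SR: "S \<subseteq> cball (a::real^3) R" and R: "R \<ge> 0" and d: "d \<ge> 0"
    and e: "norm e = 1" and cl: "closed S"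
    and fib: "\<And>\<xi> s. \<xi> \<in> S \<Longrightarrow> \<xi> + s *\<^sub>R e \<in> S \<Longrightarrow> s \<le> d"
  shows "emeasure lborel S \<le> ennreal (8 * R\<^sup>2 * d)"
proof -
  have "norm e = norm (axis 3 1 :: real^3)" using e by simp
  then obtain f :: "real^3 \<Rightarrow> real^3" where f: "orthogonal_transformation f" "f e = axis 3 1"
    by (rule orthogonal_transformation_exists)
  have lin: "linear f" using f(1) by (simp add: orthogonal_transformation_linear)
  have inj: "inj f" using f(1) by (rule orthogonal_transformation_inj)
  have bd: "bounded S" using SR bounded_cball bounded_subset by blast
  have comp: "compact S" using bd cl by (simp add: compact_eq_bounded_closed)
  have fS: "compact (f ` S)"
    using comp lin by (intro compact_continuous_image linear_continuous_on linear_conv_bounded_linear[THEN iffD1])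
  have fSb: "f ` S \<in> sets borel" using fS by (intro borel_closed compact_imp_closed)
  have SS: "S \<in> lmeasurable" "f ` S \<in> lmeasurable" using comp fS by (auto intro: lmeasurable_compact)
  have eq: "emeasure lborel T = ennreal (measure lebesgue T)" if "T \<in> lmeasurable" "T \<in> sets borel" for T :: "(real^3) set"
  proof -
    have "emeasure lebesgue T = emeasure lborel T" using that(2) by (simp add: emeasure_completion main_part_sets)
    then show ?thesis using emeasure_eq_measure2[OF that(1)] by simp
  qed
  have "emeasure lborel S = emeasure lborel (f ` S)"
    using measure_orthogonal_image[OF f(1) SS(1)] eq[OF SS(1) S] eq[OF SS(2) fSb] by simp
  also have "\<dots> \<le> ennreal (8 * R\<^sup>2 * d)"
  proof (rule emeasure_fibred_axial[OF fSb _ R d])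
    show "f ` S \<subseteq> cball (f a) R"
    proof clarify
      fix x assume "x \<in> S"
      have "dist (f a) (f x) = dist a x"
        unfolding dist_norm linear_diff[OF lin, symmetric] by (rule orthogonal_transformation_norm[OF f(1)])
      then show "f x \<in> cball (f a) R" using SR \<open>x \<in> S\<close> by auto
    qed
    fix \<xi> s assume "\<xi> \<in> f ` S" "\<xi> + s *\<^sub>R axis 3 1 \<in> f ` S"
    then obtain x y where xy: "x \<in> S" "\<xi> = f x" "y \<in> S" "\<xi> + s *\<^sub>R axis 3 1 = f y" by auto
    have "f y = f (x + s *\<^sub>R e)" using xy lin f(2) by (simp add: linear_add linear_cmul)
    then have "y = x + s *\<^sub>R e" using inj by (simp add: inj_eq)
    then show "s \<le> d" using fib[OF xy(1), of s] xy(3) by simp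
  qed
  finally show ?thesis .
qed

subsection \<open>Dyadic blocks\<close>

definition dy :: "real \<Rightarrow> nat" where "dy x = nat \<lfloor>log 2 x\<rfloor>"

definition fN :: "st \<Rightarrow> nat" where "fN p = dy (jbr (norm (snd p)))"
definition fL :: "st \<Rightarrow> nat" where "fL p = dy (jbr (\<bar>fst p\<bar> - norm (snd p)))"

lemma dy_bounds:
  assumes "x \<ge> 1"
  shows "2 ^ dy x \<le> x" "x < 2 * 2 ^ dy x"
proof -
  define k where "k = \<lfloor>log 2 x\<rfloor>"
  have k0: "k \<ge> 0" using assms by (simp add: k_def)
  have pw: "2 powr real_of_int k = 2 ^ dy x"
    using k0 by (simp add: dy_def k_def powr_realpow[symmetric])
  have "2 powr real_of_int k \<le> 2 powr log 2 x" by (simp add: k_def)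
  then show "2 ^ dy x \<le> x" using assms by (simp add: pw)
  have "2 powr log 2 x < 2 powr (real_of_int k + 1)" unfolding k_def by (subst powr_less_cancel_iff) linarith+
  also have "\<dots> = 2 * 2 ^ dy x" by (simp add: powr_add pw)
  finally show "x < 2 * 2 ^ dy x" using assms by simp
qed

lemma jbr_ge: "jbr x \<ge> 1" "\<bar>x\<bar> \<le> jbr x"
  by (auto simp: jbr_def real_le_rsqrt)

lemma jbr_le: "jbr x \<le> 1 + \<bar>x\<bar>"
  unfolding jbr_def by (rule real_le_lsqrt) (auto simp: power2_eq_square algebra_simps)

lemma jbr_mono: "\<bar>x\<bar> \<le> \<bar>y\<bar> \<Longrightarrow> jbr x \<le> jbr y"
  by (auto simp: jbr_def abs_le_square_iff)

lemma jbr_add: "jbr (x + y) \<le> jbr x + \<bar>y\<bar>"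
  using real_sqrt_sum_squares_triangle_ineq[of 1 0 x y] by (simp add: jbr_def)

lemma fN_norm_le: "norm (snd p) \<le> 2 * 2 ^ fN p"
  using dy_bounds(2)[OF jbr_ge(1)[of "norm (snd p)"]] jbr_ge(2)[of "norm (snd p)"] by (simp add: fN_def)

lemma fL_tube_le: "tube p \<le> 2 * 2 ^ fL p"
  using dy_bounds(2)[OF jbr_ge(1)[of "\<bar>fst p\<bar> - norm (snd p)"]] jbr_ge(2)[of "\<bar>fst p\<bar> - norm (snd p)"]
  by (simp add: fL_def tube_def)

text \<open>At index 0 the frequency can vanish. From index 1 on, m = 2^n is at least 2, so in m^2
  \<le> 1 + |\<xi>|^2 the 1 is absorbed by m^2 / 4.\<close>

lemma fN_norm_ge:
  assumes "fN p \<ge> 1"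
  shows "2 ^ fN p / 2 \<le> norm (snd p)"
proof (rule power2_le_imp_le)
  define m :: real where "m = 2 ^ fN p"
  have m: "m \<ge> 2" using assms power_increasing[of 1 "fN p" "2::real"] by (simp add: m_def)
  have "m \<le> sqrt (1 + (norm (snd p))\<^sup>2)"
    using dy_bounds(1)[OF jbr_ge(1)[of "norm (snd p)"]] by (simp add: m_def fN_def jbr_def)
  then have "m\<^sup>2 \<le> 1 + (norm (snd p))\<^sup>2"
    using m real_sqrt_pow2[of "1 + (norm (snd p))\<^sup>2"] power_mono[of m "sqrt (1 + (norm (snd p))\<^sup>2)" 2] by simp
  moreover have "m\<^sup>2 \<ge> 2\<^sup>2" using m by (intro power_mono) auto
  ultimately have "m\<^sup>2 / 4 \<le> (norm (snd p))\<^sup>2" by simp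
  then show "(2 ^ fN p / 2)\<^sup>2 \<le> (norm (snd p))\<^sup>2" by (simp add: m_def power_divide)
qed simp

text \<open>Each bracket is strictly below twice its dyadic value, so the sum is strictly below 2 to
  the power max + 2; strictness turns the offset 2 into 1.\<close>

lemma fN_triangle:
  assumes "p + q + r = 0"
  shows "fN r \<le> max (fN p) (fN q) + 1"
proof -
  have "r = - (p + q)" using minus_unique[OF assms] by simp
  then have n: "norm (snd r) \<le> norm (snd p) + norm (snd q)"
    using norm_triangle_ineq4[of "- snd p" "snd q"] by simp
  have "2 ^ fN r \<le> jbr (norm (snd r))" unfolding fN_def by (rule dy_bounds(1)[OF jbr_ge(1)])
  also have "\<dots> \<le> jbr (norm (snd p) + norm (snd q))" using n by (intro jbr_mono) auto
  also have "\<dots> \<le> jbr (norm (snd p)) + jbr (norm (snd q))"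
    using jbr_add[of "norm (snd p)" "norm (snd q)"] jbr_ge(2)[of "norm (snd q)"] by simp
  also have "\<dots> < 2 * 2 ^ fN p + 2 * 2 ^ fN q"
    unfolding fN_def by (intro add_strict_mono dy_bounds(2) jbr_ge(1))
  also have "\<dots> \<le> 2 * 2 ^ max (fN p) (fN q) + 2 * 2 ^ max (fN p) (fN q)"
    by (intro add_mono mult_left_mono power_increasing) auto
  also have "\<dots> = 2 ^ (max (fN p) (fN q) + 2)" by simp
  finally have "fN r < max (fN p) (fN q) + 2" by (subst (asm) power_strict_increasing_iff) auto
  then show ?thesis by simp
qed

section \<open>Estimates on one block of spatial frequencies\<close>

lemma perm_sets:
  assumes [measurable]: "X \<in> sets st3"
  shows "{(p, q, r). (q, p, r) \<in> X} \<in> sets st3" "{(p, q, r). (p, r, q) \<in> X} \<in> sets st3"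
proof -
  have "(\<lambda>x. (fst (snd x), fst x, snd (snd x))) -` X \<inter> space st3 \<in> sets st3"
    by (rule measurable_sets[OF _ assms]) measurable
  moreover have "(\<lambda>x. (fst (snd x), fst x, snd (snd x))) -` X \<inter> space st3 = {(p, q, r). (q, p, r) \<in> X}"
    by (auto simp: space_pair_measure)
  ultimately show "{(p, q, r). (q, p, r) \<in> X} \<in> sets st3" by simp
  have "(\<lambda>x. (fst x, snd (snd x), fst (snd x))) -` X \<inter> space st3 \<in> sets st3"
    by (rule measurable_sets[OF _ assms]) measurable
  moreover have "(\<lambda>x. (fst x, snd (snd x), fst (snd x))) -` X \<inter> space st3 = {(p, q, r). (p, r, q) \<in> X}"
    by (auto simp: space_pair_measure)
  ultimately show "{(p, q, r). (p, r, q) \<in> X} \<in> sets st3" by simp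
qed

lemma tube_set_closed: "closed {q. norm (snd q) \<le> R \<and> tube (p - q) \<le> L}"
  by (intro closed_Collect_conj closed_Collect_le continuous_intros)

text \<open>The crudest bound: only the ball of the first frequency and one modulation enter.
  Exchanging the first two variables makes the first frequency the inner variable, so that its ball
  restricts the fibre.\<close>

lemma tb_V0:
  assumes X: "X \<in> sets st3" and R: "R \<ge> 0" and L: "L \<ge> 0"
    and sub: "\<And>p q r. (p, q, r) \<in> X \<Longrightarrow> norm (snd p) \<le> R \<and> tube p \<le> L"
  shows "tb X (ennreal (32 * R ^ 3 * L))"
proof (rule tb_swap01[OF X], rule tb_CS[OF perm_sets(1)[OF X]])
  fix p :: st
  have "emeasure lborel {q. (p, q, - p - q) \<in> {(p, q, r). (q, p, r) \<in> X}} \<le> emeasure lborel {q. norm (snd q) \<le> R \<and> tube (0 - q) \<le> L}"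
    using tube_set_closed[of R 0 L] by (intro emeasure_mono) (auto dest!: sub)
  also have "\<dots> \<le> ennreal (32 * R ^ 3 * L)" by (rule emeasure_tube[OF R L])
  finally show "emeasure lborel {q. (p, q, - p - q) \<in> {(p, q, r). (q, p, r) \<in> X}} \<le> ennreal (32 * R ^ 3 * L)" .
qed

lemma tb_V2:
  assumes X: "X \<in> sets st3" and R: "R \<ge> 0" and L: "L \<ge> 0"
    and sub: "\<And>p q r. (p, q, r) \<in> X \<Longrightarrow> norm (snd p) \<le> R \<and> tube r \<le> L"
  shows "tb X (ennreal (32 * R ^ 3 * L))"
proof (rule tb_swap01[OF X], rule tb_CS[OF perm_sets(1)[OF X]])
  fix p :: st
  have "emeasure lborel {q. (p, q, - p - q) \<in> {(p, q, r). (q, p, r) \<in> X}} \<le> emeasure lborel {q. norm (snd q) \<le> R \<and> tube (- p - q) \<le> L}"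
    using tube_set_closed[of R "- p" L] by (intro emeasure_mono) (auto dest!: sub)
  also have "\<dots> \<le> ennreal (32 * R ^ 3 * L)" by (rule emeasure_tube[OF R L])
  finally show "emeasure lborel {q. (p, q, - p - q) \<in> {(p, q, r). (q, p, r) \<in> X}} \<le> ennreal (32 * R ^ 3 * L)" .
qed

lemma tb_V1:
  assumes X: "X \<in> sets st3" and R: "R \<ge> 0" and L: "L \<ge> 0"
    and sub: "\<And>p q r. (p, q, r) \<in> X \<Longrightarrow> norm (snd p) \<le> R \<and> tube q \<le> L"
  shows "tb X (ennreal (32 * R ^ 3 * L))"
  by (rule tb_swap12[OF X], rule tb_V2[OF perm_sets(2)[OF X] R L]) (auto dest!: sub)

text \<open>One generous constant for all numerical factors of the block bounds. Its exponent is
  even, so that the root that enters the summation is exactly 2^15.\<close>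

definition KK :: real where "KK = 2 ^ 30"

definition blk :: "nat \<Rightarrow> nat \<Rightarrow> nat \<Rightarrow> (st \<times> st \<times> st) set" where
  "blk n0 n1 n2 = {(p, q, r). p + q + r = 0 \<and> fN p = n0 \<and> fN q = n1 \<and> fN r = n2}"

lemma tb_empty: "tb {} M"
  by (rule tbI) (simp add: trX_def tri_def)

lemma V_num: "32 * (2 * 2 ^ n) ^ 3 * (2 * 2 ^ l) = (512 * 2 ^ (3 * n + l) :: real)" for n l :: nat
  by (simp add: power_add power_mult_distrib power_mult[symmetric] mult.commute)

lemma blk_V:
  assumes X: "X \<in> sets st3" and sub: "X \<subseteq> blk n0 n1 n2"
  shows "(\<And>p q r. (p, q, r) \<in> X \<Longrightarrow> fL p = l) \<Longrightarrow> tb X (ennreal (KK * 2 ^ (3 * n0 + l)))"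
    "(\<And>p q r. (p, q, r) \<in> X \<Longrightarrow> fL q = l) \<Longrightarrow> tb X (ennreal (KK * 2 ^ (3 * n0 + l)))"
    "(\<And>p q r. (p, q, r) \<in> X \<Longrightarrow> fL r = l) \<Longrightarrow> tb X (ennreal (KK * 2 ^ (3 * n0 + l)))"
proof -
  have le: "ennreal (32 * (2 * 2 ^ n0) ^ 3 * (2 * 2 ^ l)) \<le> ennreal (KK * 2 ^ (3 * n0 + l))"
    unfolding V_num by (intro ennreal_leI) (simp add: KK_def)
  have R: "norm (snd p) \<le> 2 * 2 ^ n0" if "(p, q, r) \<in> X" for p q r
    using that sub fN_norm_le[of p] by (auto simp: blk_def)
  show "tb X (ennreal (KK * 2 ^ (3 * n0 + l)))" if "\<And>p q r. (p, q, r) \<in> X \<Longrightarrow> fL p = l"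
    by (rule tb_mono[OF tb_V0[OF X, of "2 * 2 ^ n0" "2 * 2 ^ l"] order_refl le]) (use R that fL_tube_le in fastforce)+
  show "tb X (ennreal (KK * 2 ^ (3 * n0 + l)))" if "\<And>p q r. (p, q, r) \<in> X \<Longrightarrow> fL q = l"
    by (rule tb_mono[OF tb_V1[OF X, of "2 * 2 ^ n0" "2 * 2 ^ l"] order_refl le]) (use R that fL_tube_le in fastforce)+
  show "tb X (ennreal (KK * 2 ^ (3 * n0 + l)))" if "\<And>p q r. (p, q, r) \<in> X \<Longrightarrow> fL r = l"
    by (rule tb_mono[OF tb_V2[OF X, of "2 * 2 ^ n0" "2 * 2 ^ l"] order_refl le]) (use R that fL_tube_le in fastforce)+
qed

lemma cone_num:
  assumes "0 < h" "h \<le> \<eta>" "0 \<le> W" "0 \<le> L1" "0 \<le> L2" "0 \<le> Y" "64 * W * L1 * L2 * Y \<le> T * h"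
  shows "16 * pi * W * L1 * L2 * Y / \<eta> \<le> T"
proof -
  have "16 * pi * W * L1 * L2 * Y \<le> 64 * W * L1 * L2 * Y"
    using assms pi_less_4 by (intro mult_right_mono) auto
  also have "\<dots> \<le> T * h" by fact
  also have "\<dots> \<le> T * \<eta>"
  proof (rule mult_left_mono)
    have "0 \<le> T * h" using assms(3-7) by (smt (verit) mult_nonneg_nonneg)
    then show "0 \<le> T" using assms(1) by (simp add: zero_le_mult_iff)
  qed fact
  finally show ?thesis using assms(1,2) by (simp add: pos_divide_le_eq)
qed

lemma blkD:
  assumes "(p, q, r) \<in> X" "X \<subseteq> blk n0 n1 n2"
  shows "r = - p - q" "fN p = n0" "fN q = n1" "fN r = n2" "n2 \<le> max n0 n1 + 1" "n1 \<le> max n0 n2 + 1"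
proof -
  have *: "p + q + r = 0" "fN p = n0" "fN q = n1" "fN r = n2" using assms by (auto simp: blk_def)
  show "r = - p - q" using minus_unique[OF *(1)] by simp
  show "n2 \<le> max n0 n1 + 1" using fN_triangle[OF *(1)] * by simp
  show "n1 \<le> max n0 n2 + 1" using fN_triangle[of p r q] * by (simp add: add_ac)
qed (use assms in \<open>auto simp: blk_def\<close>)

lemma cone_set_closed:
  "closed {q. (norm (snd q))\<^sup>2 \<in> {w1..w2} \<and> norm (snd (p - q)) \<le> V \<and> tube q \<le> L1 \<and> tube (p - q) \<le> L2}"
  unfolding atLeastAtMost_iff
  by (intro closed_Collect_conj closed_Collect_le continuous_intros)

lemma pow2_le: "a \<le> b \<Longrightarrow> (2::real) ^ a \<le> 2 ^ b" for a b :: nat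
  by (rule power_increasing) auto

lemma cone_arith: "64 * w * (2 * a) * (2 * b) * y = w * y * (256 * a * b)" for w a b y :: real
  by simp

text \<open>Comparable frequencies: the squared norm of the second frequency ranges over an interval
  of length about 2^(2 n1) and the fixed frequency has size 2^n0. The cone intersection gives 2^(3
  n1 - n0 + l1 + l2), which is of order 2^(n0 + n1 + l1 + l2) because n1 \<le> n0 + 5. The bounds
  l1, l2 < n0 yield n0 \<ge> 1, hence the lower bound for the fixed frequency, and keep 2 V + L1 +
  L2 of size 2^n1.\<close>

lemma tb_cone_direct:
  assumes X: "X \<in> sets st3" and sub: "X \<subseteq> blk n0 n1 n2" and n: "n0 \<le> n1" "n1 \<le> n0 + 5"
    and l: "l1 < n0" "l2 < n0"
    and L: "\<And>p q r. (p, q, r) \<in> X \<Longrightarrow> fL q = l1 \<and> fL r = l2"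
  shows "tb X (ennreal (KK * 2 ^ (n0 + n1 + l1 + l2)))"
proof (rule tb_CS[OF X])
  fix p :: st
  define S where "S = {q. (p, q, - p - q) \<in> X}"
  have "emeasure lborel S \<le> ennreal (KK * 2 ^ (n0 + n1 + l1 + l2))"
  proof (cases "S = {}")
    case True then show ?thesis by simp
  next
    case False
    then obtain q0 where q0: "(p, q0, - p - q0) \<in> X" by (auto simp: S_def)
    have n2: "n2 \<le> n1 + 1" using blkD(5)[OF q0 sub] n(1) by simp
    have p: "2 ^ n0 / 2 \<le> norm (snd p)" using blkD(2)[OF q0 sub] fN_norm_ge[of p] l by auto
    have "0 < norm (snd p)" by (rule less_le_trans[OF _ p]) simp
    then have p0: "snd (- p) \<noteq> 0" by simp
    define W :: real where "W = (2 * 2 ^ n1)\<^sup>2"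
    have "emeasure lborel S \<le> emeasure lborel {q. (norm (snd q))\<^sup>2 \<in> {0..W} \<and> norm (snd (- p - q)) \<le> 2 * 2 ^ n2 \<and> tube q \<le> 2 * 2 ^ l1 \<and> tube (- p - q) \<le> 2 * 2 ^ l2}"
    proof (intro emeasure_mono subsetI CollectI)
      fix q assume "q \<in> S"
      then have q: "(p, q, - p - q) \<in> X" by (simp add: S_def)
      show "(norm (snd q))\<^sup>2 \<in> {0..W} \<and> norm (snd (- p - q)) \<le> 2 * 2 ^ n2 \<and> tube q \<le> 2 * 2 ^ l1 \<and> tube (- p - q) \<le> 2 * 2 ^ l2"
        using power_mono[OF fN_norm_le[of q] norm_ge_zero, of 2] fN_norm_le[of "- p - q"] fL_tube_le[of q] fL_tube_le[of "- p - q"] L[OF q] blkD(1-4)[OF q sub]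
        by (auto simp: W_def simp del: snd_diff snd_uminus)
    qed (use cone_set_closed[of 0 W "- p" "2 * 2 ^ n2" "2 * 2 ^ l1" "2 * 2 ^ l2"] in simp)
    also have "\<dots> \<le> ennreal (16 * pi * (W - 0) * (2 * 2 ^ l1) * (2 * 2 ^ l2) * (2 * (2 * 2 ^ n2) + 2 * 2 ^ l1 + 2 * 2 ^ l2) / norm (snd (- p)))"
      by (rule emeasure_cone_intersection) (use p0 in \<open>auto simp: W_def\<close>)
    also have "\<dots> \<le> ennreal (KK * 2 ^ (n0 + n1 + l1 + l2))"
    proof (rule ennreal_leI, rule cone_num)
      have e1: "(2::real) ^ n1 \<le> 32 * 2 ^ n0" using pow2_le[OF n(2)] by (simp add: power_add)
      have e2: "(2::real) ^ n2 \<le> 2 * 2 ^ n1" using pow2_le[OF n2] by simp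
      have e3: "(2::real) ^ l1 \<le> 2 ^ n1" "(2::real) ^ l2 \<le> 2 ^ n1" using l n by (auto intro!: pow2_le)
      have y1: "(2 * (2 * 2 ^ n2) + 2 * 2 ^ l1 + 2 * 2 ^ l2) \<le> (12 * 2 ^ n1 :: real)" using e2 e3 by linarith
      have y2: "(2::real) ^ n1 * 2 ^ n1 \<le> (32 * 2 ^ n0) * (32 * 2 ^ n0)"
        by (rule mult_mono[OF e1 e1]) auto
      have "(2::real) ^ n1 * 2 ^ n1 * (2 * (2 * 2 ^ n2) + 2 * 2 ^ l1 + 2 * 2 ^ l2) \<le> (32 * 2 ^ n0) * (32 * 2 ^ n0) * (12 * 2 ^ n1)"
        by (rule mult_mono[OF y2 y1]) auto
      then have "(2::real) ^ n1 * 2 ^ n1 * (2 * (2 * 2 ^ n2) + 2 * 2 ^ l1 + 2 * 2 ^ l2) * (1024 * 2 ^ l1 * 2 ^ l2) \<le> (32 * 2 ^ n0) * (32 * 2 ^ n0) * (12 * 2 ^ n1) * (1024 * 2 ^ l1 * 2 ^ l2)"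
        by (rule mult_right_mono) simp
      also have "\<dots> = 12582912 * (2 ^ n0 * 2 ^ n0 * 2 ^ n1 * 2 ^ l1 * 2 ^ l2)" by simp
      also have "\<dots> \<le> KK / 2 * (2 ^ n0 * 2 ^ n0 * 2 ^ n1 * 2 ^ l1 * 2 ^ l2)" by (intro mult_right_mono) (auto simp: KK_def)
      finally show "64 * (W - 0) * (2 * 2 ^ l1) * (2 * 2 ^ l2) * (2 * (2 * 2 ^ n2) + 2 * 2 ^ l1 + 2 * 2 ^ l2) \<le> KK * 2 ^ (n0 + n1 + l1 + l2) * (2 ^ n0 / 2)"
        by (simp add: W_def power2_eq_square power_add mult_ac)
    qed (use p in \<open>auto simp: W_def\<close>)
    finally show ?thesis .
  qed
  then show "emeasure lborel {q. (p, q, - p - q) \<in> X} \<le> ennreal (KK * 2 ^ (n0 + n1 + l1 + l2))"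
    by (simp only: S_def)
qed

text \<open>The localisation to balls of radius about 2^n0 confines the squared norm of the second
  frequency to an interval of length about 2^(n0 + n1). The reflection raises the divisor from 2^n0
  to 2^n1, where it cancels the size of V.\<close>

lemma tb_cone_conj:
  assumes X: "X \<in> sets st3" and sub: "X \<subseteq> blk n0 n1 n2" and n: "n0 + 5 < n1"
    and l: "l1 < n0" "l2 < n0"
    and L: "\<And>p q r. (p, q, r) \<in> X \<Longrightarrow> fL q = l1 \<and> fL r = l2"
  shows "tb X (ennreal (KK * 2 ^ (n0 + n1 + l1 + l2)))"
proof (cases "X = {}")
  case True then show ?thesis by (simp add: tb_empty)
next
  case False
  define R :: real where "R = 2 * 2 ^ n0"
  have R: "R > 0" by (simp add: R_def)
  have n2: "n2 \<le> n1 + 1" using False blkD(5)[OF _ sub] n by fastforce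
  define T where "T = KK / 8 * 2 ^ (n0 + n1 + l1 + l2)"
  \<comment> \<open>A gap of more than 5 between the indices gives R \<le> 2^n1 / 32, so the balls
    are small compared with the frequencies of the second factor.\<close>
  have big: "64 * R \<le> 2 * 2 ^ n1" using pow2_le[of "n0 + 6" n1] n by (simp add: R_def power_add)
  have "tb X (8 * ennreal T)"
  proof (rule tb_avg[OF X R])
    show "norm (snd p) \<le> R" if "(p, q, r) \<in> X" for p q r
      using blkD(2)[OF that sub] fN_norm_le[of p] by (simp add: R_def)
    fix a :: "real^3"
    define A where "A = {q::st. norm (snd q - a) \<le> R \<and> 2 ^ n1 / 2 \<le> norm (snd q) \<and> norm (snd q) \<le> 2 * 2 ^ n1 \<and> tube q \<le> 2 * 2 ^ l1}"
    define B where "B = {r::st. norm (snd r + a) \<le> 2 * R \<and> norm (snd r) \<le> 2 * 2 ^ n2 \<and> tube r \<le> 2 * 2 ^ l2}"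
    have Ac: "closed A" unfolding A_def by (intro closed_Collect_conj closed_Collect_le continuous_intros)
    have Bc: "closed B" unfolding B_def by (intro closed_Collect_conj closed_Collect_le continuous_intros)
    show "tb (X \<inter> {(p, q, r). norm (snd q - a) \<le> R \<and> norm (snd r + a) \<le> 2 * R}) (ennreal T)"
    proof (rule tb_conj)
      show "A \<in> sets borel" "B \<in> sets borel" using Ac Bc by auto
      show "X \<inter> {(p, q, r). norm (snd q - a) \<le> R \<and> norm (snd r + a) \<le> 2 * R} \<subseteq> {(p, q, r). q \<in> A \<and> r \<in> B}"
      proof clarify
        fix p q r assume x: "(p, q, r) \<in> X" and h: "norm (snd q - a) \<le> R" "norm (snd r + a) \<le> 2 * R"
        have "fN q \<ge> 1" using blkD(3)[OF x sub] n by simp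
        from fN_norm_ge[OF this] show "q \<in> A \<and> r \<in> B"
          using fN_norm_le[of q] fN_norm_le[of r] fL_tube_le[of q] fL_tube_le[of r] L[OF x] blkD(2-4)[OF x sub] h
          by (simp add: A_def B_def)
      qed
      fix p :: st
      define S where "S = {q \<in> A. q - p \<in> B}"
      have "emeasure lborel S \<le> ennreal T"
      proof (cases "S = {}")
        case True then show ?thesis by simp
      next
        case False
        then obtain q where q: "q \<in> A" "q - p \<in> B" by (auto simp: S_def)
        have "norm (snd q + snd (q - p)) \<le> norm (snd q - a) + norm (snd (q - p) + a)"
          using norm_triangle_ineq[of "snd q - a" "snd (q - p) + a"] by simp
        then have "norm (snd q + snd (q - p)) \<le> 3 * R" using q by (simp add: A_def B_def)
        \<comment> \<open>q is near a and q - p is near - a, so their sum has norm at most 3 R and p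
          is nearly 2 q.\<close>
        moreover have "snd p = 2 *\<^sub>R snd q - (snd q + snd (q - p))" by (simp add: scaleR_2)
        then have "norm (snd p) \<ge> norm (2 *\<^sub>R snd q) - norm (snd q + snd (q - p))" by (metis norm_triangle_ineq2)
        ultimately have p: "norm (snd p) \<ge> 2 ^ n1 / 2" using q(1) big by (simp add: A_def)
        have "norm a \<le> norm (snd q) + norm (snd q - a)" using norm_triangle_ineq2[of a "snd q"] by (simp add: norm_minus_commute)
        then have aR: "norm a + R \<le> 4 * 2 ^ n1" using q(1) big by (simp add: A_def)
        define w1 w2 where "w1 = (max 0 (norm a - R))\<^sup>2" and "w2 = (norm a + R)\<^sup>2"
        have ww: "w2 - w1 \<le> 4 * R * (norm a + R)" "w1 \<le> w2"
        proof -
          define x where "x = norm a"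
          have x: "x \<ge> 0" by (simp add: x_def)
          show "w2 - w1 \<le> 4 * R * (norm a + R)"
          proof (cases "x \<ge> R")
            case True
            then have "w2 - w1 = 4 * R * x" unfolding w1_def w2_def x_def[symmetric] by (simp add: max_def power2_eq_square algebra_simps)
            also have "\<dots> \<le> 4 * R * (x + R)" using R by (intro mult_left_mono) auto
            finally show ?thesis by (simp add: x_def)
          next
            case False
            then have "w2 - w1 = (x + R) * (x + R)" unfolding w1_def w2_def x_def[symmetric] by (simp add: max_def power2_eq_square)
            also have "\<dots> \<le> 4 * R * (x + R)" using False R x by (intro mult_right_mono) auto
            finally show ?thesis by (simp add: x_def)
          qed
          show "w1 \<le> w2" unfolding w1_def w2_def using R x by (intro power_mono) (auto simp: x_def)
        qed
        have "emeasure lborel S \<le> emeasure lborel {q. (norm (snd q))\<^sup>2 \<in> {w1..w2} \<and> norm (snd (p - q)) \<le> 2 * 2 ^ n2 \<and> tube q \<le> 2 * 2 ^ l1 \<and> tube (p - q) \<le> 2 * 2 ^ l2}"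
        proof (intro emeasure_mono subsetI CollectI)
          fix q assume "q \<in> S"
          then have q: "q \<in> A" "q - p \<in> B" by (auto simp: S_def)
          have "norm (snd q) \<le> norm a + norm (snd q - a)" using norm_triangle_ineq2[of "snd q" a] by simp
          then have 1: "(norm (snd q))\<^sup>2 \<le> w2" unfolding w2_def using q by (intro power_mono) (auto simp: A_def)
          have "norm a - R \<le> norm (snd q)" using q(1) norm_triangle_ineq2[of a "snd q"] by (simp add: A_def norm_minus_commute)
          then have 2: "w1 \<le> (norm (snd q))\<^sup>2" unfolding w1_def by (intro power_mono) auto
          have "p - q = - (q - p)" by simp
          then show "(norm (snd q))\<^sup>2 \<in> {w1..w2} \<and> norm (snd (p - q)) \<le> 2 * 2 ^ n2 \<and> tube q \<le> 2 * 2 ^ l1 \<and> tube (p - q) \<le> 2 * 2 ^ l2"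
            using q 1 2 tube_uminus[of "q - p"] norm_minus_cancel[of "snd (q - p)"] unfolding A_def B_def by (simp add: norm_minus_commute)
        qed (use cone_set_closed[of w1 w2 p "2 * 2 ^ n2" "2 * 2 ^ l1" "2 * 2 ^ l2"] in simp)
        also have "\<dots> \<le> ennreal (16 * pi * (w2 - w1) * (2 * 2 ^ l1) * (2 * 2 ^ l2) * (2 * (2 * 2 ^ n2) + 2 * 2 ^ l1 + 2 * 2 ^ l2) / norm (snd p))"
        proof (rule emeasure_cone_intersection)
          have "0 < norm (snd p)" by (rule less_le_trans[OF _ p]) simp
          then show "snd p \<noteq> 0" by simp
        qed (use ww in auto)
        also have "\<dots> \<le> ennreal T"
        proof (rule ennreal_leI, rule cone_num)
          have "4 * R * (norm a + R) \<le> 4 * R * (4 * 2 ^ n1)" using aR R by (intro mult_left_mono) auto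
          moreover have "4 * R * (4 * 2 ^ n1) = 32 * 2 ^ n0 * 2 ^ n1" by (simp add: R_def)
          ultimately have W: "w2 - w1 \<le> 32 * 2 ^ n0 * 2 ^ n1" using ww(1) by linarith
          have e2: "(2::real) ^ n2 \<le> 2 * 2 ^ n1" using pow2_le[OF n2] by simp
          have e3: "(2::real) ^ l1 \<le> 2 ^ n1" "(2::real) ^ l2 \<le> 2 ^ n1" using l n by (auto intro!: pow2_le)
          have y1: "(2 * (2 * 2 ^ n2) + 2 * 2 ^ l1 + 2 * 2 ^ l2) \<le> (12 * 2 ^ n1 :: real)" using e2 e3 by linarith
          have "(w2 - w1) * (2 * (2 * 2 ^ n2) + 2 * 2 ^ l1 + 2 * 2 ^ l2) \<le> (32 * 2 ^ n0 * 2 ^ n1) * (12 * 2 ^ n1)"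
            by (rule mult_mono[OF W y1]) auto
          then have "(w2 - w1) * (2 * (2 * 2 ^ n2) + 2 * 2 ^ l1 + 2 * 2 ^ l2) * (256 * 2 ^ l1 * 2 ^ l2) \<le> (32 * 2 ^ n0 * 2 ^ n1) * (12 * 2 ^ n1) * (256 * 2 ^ l1 * 2 ^ l2)"
            by (rule mult_right_mono) simp
          also have "\<dots> = 98304 * (2 ^ n0 * 2 ^ n1 * 2 ^ n1 * 2 ^ l1 * 2 ^ l2)" by simp
          also have "\<dots> \<le> KK / 16 * (2 ^ n0 * 2 ^ n1 * 2 ^ n1 * 2 ^ l1 * 2 ^ l2)" by (intro mult_right_mono) (auto simp: KK_def)
          also have "\<dots> = T * (2 ^ n1 / 2)" by (simp add: T_def power_add)
          finally show "64 * (w2 - w1) * (2 * 2 ^ l1) * (2 * 2 ^ l2) * (2 * (2 * 2 ^ n2) + 2 * 2 ^ l1 + 2 * 2 ^ l2) \<le> T * (2 ^ n1 / 2)"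
            unfolding cone_arith .
        qed (use p ww in auto)
        finally show ?thesis .
      qed
      then show "emeasure lborel {q \<in> A. q - p \<in> B} \<le> ennreal T" by (simp only: S_def)
    qed
  qed
  moreover have "8 * ennreal T = ennreal (KK * 2 ^ (n0 + n1 + l1 + l2))"
    by (simp add: T_def ennreal_mult[symmetric] KK_def ennreal_numeral[symmetric] del: ennreal_numeral)
  ultimately show ?thesis by simp
qed

lemma KK_mono: "a \<le> b \<Longrightarrow> ennreal (KK * 2 ^ a) \<le> ennreal (KK * 2 ^ b)" for a b :: nat
  using pow2_le[of a b] by (intro ennreal_leI) (simp add: KK_def)

text \<open>If one of the two modulations reaches n0, the crude exponent, 3 n0 plus the other
  modulation, is already at most n0 + n1 + l1 + l2. Otherwise the cone intersection applies,
  directly or after reflection.\<close>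

lemma blk_A12:
  assumes X: "X \<in> sets st3" and sub: "X \<subseteq> blk n0 n1 n2" and n: "n0 \<le> n1"
    and L: "\<And>p q r. (p, q, r) \<in> X \<Longrightarrow> fL q = l1 \<and> fL r = l2"
  shows "tb X (ennreal (KK * 2 ^ (n0 + n1 + l1 + l2)))"
proof -
  consider "n0 \<le> l1" | "n0 \<le> l2" | "l1 < n0" "l2 < n0" by linarith
  then show ?thesis
  proof cases
    case 1
    have "tb X (ennreal (KK * 2 ^ (3 * n0 + l2)))" by (rule blk_V(3)[OF X sub]) (use L in blast)
    then show ?thesis by (rule tb_mono[OF _ order_refl KK_mono]) (use 1 n in simp)
  next
    case 2
    have "tb X (ennreal (KK * 2 ^ (3 * n0 + l1)))" by (rule blk_V(2)[OF X sub]) (use L in blast)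
    then show ?thesis by (rule tb_mono[OF _ order_refl KK_mono]) (use 2 n in simp)
  next
    case 3
    then show ?thesis using tb_cone_direct[OF X sub n _ 3 L] tb_cone_conj[OF X sub _ 3 L] by (cases "n1 \<le> n0 + 5") auto
  qed
qed

text \<open>The high-frequency variable r is fixed and the low-frequency variable p is integrated.
  The squared norm of the latter ranges over an interval of length about 2^(2 n0), and the divisor
  2^n2 cancels V, which has size 2^n1 with n1 \<le> n2 + 1. Since the fixed frequency is high, the
  cones can be intersected as they are.\<close>

lemma tb_cone_low:
  assumes X: "X \<in> sets st3" and sub: "X \<subseteq> blk n0 n1 n2" and n: "n0 \<le> n1" "n0 \<le> n2"
    and l: "l0 < n0" "l1 < n0"
    and L: "\<And>p q r. (p, q, r) \<in> X \<Longrightarrow> fL p = l0 \<and> fL q = l1"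
  shows "tb X (ennreal (KK * 2 ^ (2 * n0 + l0 + l1)))"
proof (rule tb_swap12[OF X], rule tb_swap01[OF perm_sets(2)[OF X]], rule tb_CS[OF perm_sets(1)[OF perm_sets(2)[OF X]]])
  fix r :: st
  define S where "S = {p. (p, - r - p, r) \<in> X}"
  have "emeasure lborel S \<le> ennreal (KK * 2 ^ (2 * n0 + l0 + l1))"
  proof (cases "S = {}")
    case True then show ?thesis by simp
  next
    case False
    then obtain p0 where p0: "(p0, - r - p0, r) \<in> X" by (auto simp: S_def)
    have n1: "n1 \<le> n2 + 1" using blkD(6)[OF p0 sub] n by simp
    have r: "2 ^ n2 / 2 \<le> norm (snd r)" using blkD(4)[OF p0 sub] fN_norm_ge[of r] l n by auto
    have "0 < norm (snd r)" by (rule less_le_trans[OF _ r]) simp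
    then have r0: "snd (- r) \<noteq> 0" by simp
    define W :: real where "W = (2 * 2 ^ n0)\<^sup>2"
    have "emeasure lborel S \<le> emeasure lborel {p. (norm (snd p))\<^sup>2 \<in> {0..W} \<and> norm (snd (- r - p)) \<le> 2 * 2 ^ n1 \<and> tube p \<le> 2 * 2 ^ l0 \<and> tube (- r - p) \<le> 2 * 2 ^ l1}"
    proof (intro emeasure_mono subsetI CollectI)
      fix p assume "p \<in> S"
      then have p: "(p, - r - p, r) \<in> X" by (simp add: S_def)
      show "(norm (snd p))\<^sup>2 \<in> {0..W} \<and> norm (snd (- r - p)) \<le> 2 * 2 ^ n1 \<and> tube p \<le> 2 * 2 ^ l0 \<and> tube (- r - p) \<le> 2 * 2 ^ l1"
        using power_mono[OF fN_norm_le[of p] norm_ge_zero, of 2] fN_norm_le[of "- r - p"] fL_tube_le[of p] fL_tube_le[of "- r - p"] L[OF p] blkD(2-4)[OF p sub]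
        by (auto simp: W_def simp del: snd_diff snd_uminus)
    qed (use cone_set_closed[of 0 W "- r" "2 * 2 ^ n1" "2 * 2 ^ l0" "2 * 2 ^ l1"] in simp)
    also have "\<dots> \<le> ennreal (16 * pi * (W - 0) * (2 * 2 ^ l0) * (2 * 2 ^ l1) * (2 * (2 * 2 ^ n1) + 2 * 2 ^ l0 + 2 * 2 ^ l1) / norm (snd (- r)))"
      by (rule emeasure_cone_intersection) (use r0 in \<open>auto simp: W_def\<close>)
    also have "\<dots> \<le> ennreal (KK * 2 ^ (2 * n0 + l0 + l1))"
    proof (rule ennreal_leI, rule cone_num)
      have e2: "(2::real) ^ n1 \<le> 2 * 2 ^ n2" using pow2_le[OF n1] by simp
      have e3: "(2::real) ^ l0 \<le> 2 ^ n2" "(2::real) ^ l1 \<le> 2 ^ n2" using l n by (auto intro!: pow2_le)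
      have y1: "(2 * (2 * 2 ^ n1) + 2 * 2 ^ l0 + 2 * 2 ^ l1) \<le> (12 * 2 ^ n2 :: real)" using e2 e3 by linarith
      have "(2 * (2 * 2 ^ n1) + 2 * 2 ^ l0 + 2 * 2 ^ l1) * (1024 * 2 ^ n0 * 2 ^ n0 * 2 ^ l0 * 2 ^ l1) \<le> (12 * 2 ^ n2 :: real) * (1024 * 2 ^ n0 * 2 ^ n0 * 2 ^ l0 * 2 ^ l1)"
        by (rule mult_right_mono[OF y1]) simp
      also have "\<dots> = 12288 * (2 ^ n2 * 2 ^ n0 * 2 ^ n0 * 2 ^ l0 * 2 ^ l1)" by simp
      also have "\<dots> \<le> KK / 2 * (2 ^ n2 * 2 ^ n0 * 2 ^ n0 * 2 ^ l0 * 2 ^ l1)" by (intro mult_right_mono) (auto simp: KK_def)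
      finally show "64 * (W - 0) * (2 * 2 ^ l0) * (2 * 2 ^ l1) * (2 * (2 * 2 ^ n1) + 2 * 2 ^ l0 + 2 * 2 ^ l1) \<le> KK * 2 ^ (2 * n0 + l0 + l1) * (2 ^ n2 / 2)"
        by (simp add: W_def power2_eq_square power_add power_mult mult_ac)
    qed (use r in \<open>auto simp: W_def\<close>)
    finally show ?thesis .
  qed
  moreover have "{q. (r, q, - r - q) \<in> {(p, q, r). (q, p, r) \<in> {(p, q, r). (p, r, q) \<in> X}}} = S"
    by (auto simp: S_def)
  ultimately show "emeasure lborel {q. (r, q, - r - q) \<in> {(p, q, r). (q, p, r) \<in> {(p, q, r). (p, r, q) \<in> X}}} \<le> ennreal (KK * 2 ^ (2 * n0 + l0 + l1))"
    by (simp only:)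
qed

lemma blk_A01:
  assumes X: "X \<in> sets st3" and sub: "X \<subseteq> blk n0 n1 n2" and n: "n0 \<le> n1" "n0 \<le> n2"
    and L: "\<And>p q r. (p, q, r) \<in> X \<Longrightarrow> fL p = l0 \<and> fL q = l1"
  shows "tb X (ennreal (KK * 2 ^ (2 * n0 + l0 + l1)))"
proof -
  consider "n0 \<le> l0" | "n0 \<le> l1" | "l0 < n0" "l1 < n0" by linarith
  then show ?thesis
  proof cases
    case 1
    have "tb X (ennreal (KK * 2 ^ (3 * n0 + l1)))" by (rule blk_V(2)[OF X sub]) (use L in blast)
    then show ?thesis by (rule tb_mono[OF _ order_refl KK_mono]) (use 1 in simp)
  next
    case 2
    have "tb X (ennreal (KK * 2 ^ (3 * n0 + l0)))" by (rule blk_V(1)[OF X sub]) (use L in blast)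
    then show ?thesis by (rule tb_mono[OF _ order_refl KK_mono]) (use 2 in simp)
  next
    case 3
    then show ?thesis by (rule tb_cone_low[OF X sub n _ _ L])
  qed
qed

lemma blk_A02:
  assumes X: "X \<in> sets st3" and sub: "X \<subseteq> blk n0 n1 n2" and n: "n0 \<le> n1" "n0 \<le> n2"
    and L: "\<And>p q r. (p, q, r) \<in> X \<Longrightarrow> fL p = l0 \<and> fL r = l2"
  shows "tb X (ennreal (KK * 2 ^ (2 * n0 + l0 + l2)))"
proof (rule tb_swap12[OF X], rule blk_A01[OF perm_sets(2)[OF X] _ n(2,1)])
  show "{(p, q, r). (p, r, q) \<in> X} \<subseteq> blk n0 n2 n1" using sub by (auto simp: blk_def add_ac)
qed (use L in auto)

text \<open>Convexity of the norm, whose gradient at x is x / |x|; here it is read off from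
  Cauchy--Schwarz for x and x + s e.\<close>

lemma norm_add_ge_inner:
  fixes x e :: "'a::real_inner"
  assumes "s \<ge> 0" "x \<noteq> 0"
  shows "norm x + s * ((x \<bullet> e) / norm x) \<le> norm (x + s *\<^sub>R e)"
proof -
  have "(norm x)\<^sup>2 + s * (x \<bullet> e) \<le> norm x * norm (x + s *\<^sub>R e)"
    using norm_cauchy_schwarz[of x "x + s *\<^sub>R e"] by (simp add: inner_add_right power2_norm_eq_inner)
  then have "((norm x)\<^sup>2 + s * (x \<bullet> e)) / norm x \<le> norm (x + s *\<^sub>R e)"
    using assms by (simp add: pos_divide_le_eq mult.commute)
  then show ?thesis using assms by (simp add: add_divide_distrib power2_eq_square)
qed

text \<open>For \<open>\<bar>\<tau>0\<bar> = \<bar>\<tau>1\<bar> + \<bar>\<tau>2\<bar>\<close> and low output frequency, \<open>\<bar>\<xi>1\<bar> + \<bar>\<xi>2\<bar>\<close> is nearly constant on the fibres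
  while \<open>\<xi>1\<close> and \<open>\<xi>2\<close> are nearly opposite, so it increases along the direction of \<open>\<xi>1\<close>.\<close>

lemma blk_T12:
  assumes X: "X \<in> sets st3" and sub: "X \<subseteq> blk n0 n1 n2" and n: "n0 + 5 < n1"
    and L: "\<And>p q r. (p, q, r) \<in> X \<Longrightarrow> fL q = l1 \<and> fL r = l2"
    and P: "\<And>p q r. (p, q, r) \<in> X \<Longrightarrow> \<bar>fst p\<bar> = \<bar>fst q\<bar> + \<bar>fst r\<bar>"
  shows "tb X (ennreal (KK * 2 ^ (2 * n0 + l1 + l2)))"
proof -
  define R :: real where "R = 2 * 2 ^ n0"
  have R: "R > 0" by (simp add: R_def)
  define T where "T = KK / 8 * 2 ^ (2 * n0 + l1 + l2)"
  define L1 L2 :: real where "L1 = 2 * 2 ^ l1" and "L2 = 2 * 2 ^ l2"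
  have L0: "L1 \<ge> 0" "L2 \<ge> 0" by (simp_all add: L1_def L2_def)
  have big: "64 * R \<le> 2 * 2 ^ n1" using pow2_le[of "n0 + 6" n1] n by (simp add: R_def power_add)
  have "tb X (8 * ennreal T)"
  proof (rule tb_avg[OF X R])
    show "norm (snd p) \<le> R" if "(p, q, r) \<in> X" for p q r
      using blkD(2)[OF that sub] fN_norm_le[of p] by (simp add: R_def)
    fix a :: "real^3"
    define Y where "Y = X \<inter> {(p, q, r). norm (snd q - a) \<le> R \<and> norm (snd r + a) \<le> 2 * R}"
    have Ym: "Y \<in> sets st3"
    proof -
      have [measurable]: "(\<lambda>x::st \<times> st \<times> st. norm (snd (fst (snd x)) - a)) \<in> borel_measurable st3"
        "(\<lambda>x::st \<times> st \<times> st. norm (snd (snd (snd x)) + a)) \<in> borel_measurable st3"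
        unfolding borel_prod by (intro borel_measurable_continuous_onI continuous_intros)+
      have "{x \<in> space st3. norm (snd (fst (snd x)) - a) \<le> R \<and> norm (snd (snd (snd x)) + a) \<le> 2 * R} \<in> sets st3"
        by measurable
      then have "X \<inter> {x \<in> space st3. norm (snd (fst (snd x)) - a) \<le> R \<and> norm (snd (snd (snd x)) + a) \<le> 2 * R} \<in> sets st3"
        using X by auto
      moreover have "Y = X \<inter> {x \<in> space st3. norm (snd (fst (snd x)) - a) \<le> R \<and> norm (snd (snd (snd x)) + a) \<le> 2 * R}"
        by (auto simp: Y_def space_pair_measure)
      ultimately show ?thesis by simp
    qed
    have "tb Y (ennreal T)"
    proof (rule tb_CS[OF Ym])
      fix p :: st
      define S where "S = {q. (p, q, - p - q) \<in> Y}"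
      have "emeasure lborel S \<le> ennreal T"
      proof (cases "S = {}")
        case True then show ?thesis by simp
      next
        case False
        then obtain q0 where q0: "(p, q0, - p - q0) \<in> X" "norm (snd q0 - a) \<le> R" by (auto simp: S_def Y_def)
        have p: "norm (snd p) \<le> R" using blkD(2)[OF q0(1) sub] fN_norm_le[of p] by (simp add: R_def)
        have "2 ^ n1 / 2 \<le> norm (snd q0)" using fN_norm_ge[of q0] blkD(3)[OF q0(1) sub] n by simp
        moreover have "norm (snd q0) \<le> norm a + norm (snd q0 - a)" using norm_triangle_ineq2[of "snd q0" a] by simp
        ultimately have a: "norm a \<ge> 15 * R" using q0(2) big by linarith
        define e where "e = a /\<^sub>R norm a"
        have an: "norm a > 0" using a R by linarith
        have e: "norm e = 1" "a \<bullet> e = norm a" using an by (auto simp: e_def power2_norm_eq_inner[symmetric] power2_eq_square)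
        define D where "D = L1 + L2"
        \<comment> \<open>By the sign pattern the two tube conditions add up to a condition on the
          sum of the two spatial norms in which the time variable of q no longer occurs.\<close>
        define U where "U = {\<xi>::real^3. norm (\<xi> - a) \<le> R \<and> \<bar>norm \<xi> + norm (snd p + \<xi>) - \<bar>fst p\<bar>\<bar> \<le> D}"
        have Uc: "closed U" unfolding U_def by (intro closed_Collect_conj closed_Collect_le continuous_intros)
        have inner_near: "norm a - norm (\<xi> - a) \<le> \<xi> \<bullet> e" for \<xi>
        proof -
          have "\<bar>(\<xi> - a) \<bullet> e\<bar> \<le> norm (\<xi> - a)" using Cauchy_Schwarz_ineq2[of "\<xi> - a" e] e by simp
          then show ?thesis using e by (simp add: inner_diff_left)
        qed
        \<comment> \<open>Moving by s along e, the norm of \<xi> grows at rate at least 1/2 because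
          \<xi> is near a, and the norm of \<open>snd p + \<xi>\<close> does not decrease. Their sum
          stays in a window of width 2 D, so s / 2 \<le> 2 D.\<close>
        have fib: "s \<le> 4 * D" if U: "\<xi> \<in> U" "\<xi> + s *\<^sub>R e \<in> U" for \<xi> s
        proof (cases "s \<ge> 0")
          case False
          then show ?thesis using L0 by (simp add: D_def)
        next
          case True
          have xi: "norm (\<xi> - a) \<le> R" using U by (simp add: U_def)
          have "norm \<xi> \<le> norm a + norm (\<xi> - a)" "norm a \<le> norm \<xi> + norm (\<xi> - a)"
            using norm_triangle_ineq2[of \<xi> a] norm_triangle_ineq2[of a \<xi>] by (simp_all add: norm_minus_commute)
          then have xn: "norm \<xi> \<le> norm a + R" "norm \<xi> > 0" using xi a R by linarith+
          have "\<xi> \<bullet> e \<ge> norm \<xi> / 2" using inner_near[of \<xi>] xi xn a R by linarith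
          then have "1 / 2 \<le> (\<xi> \<bullet> e) / norm \<xi>" using xn by (simp add: pos_le_divide_eq)
          then have "s * (1 / 2) \<le> s * ((\<xi> \<bullet> e) / norm \<xi>)" using True by (rule mult_left_mono)
          moreover have "norm \<xi> + s * ((\<xi> \<bullet> e) / norm \<xi>) \<le> norm (\<xi> + s *\<^sub>R e)"
            using norm_add_ge_inner[OF True, of \<xi> e] xn by auto
          ultimately have 1: "norm \<xi> + s / 2 \<le> norm (\<xi> + s *\<^sub>R e)" by linarith
          have "norm (snd p + \<xi> - a) \<le> norm (snd p) + norm (\<xi> - a)"
            using norm_triangle_ineq[of "snd p" "\<xi> - a"] by (simp add: algebra_simps)
          then have pos: "(snd p + \<xi>) \<bullet> e > 0" using inner_near[of "snd p + \<xi>"] xi p a R by linarith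
          then have ne: "snd p + \<xi> \<noteq> 0" by auto
          have "0 \<le> s * (((snd p + \<xi>) \<bullet> e) / norm (snd p + \<xi>))" using True pos by simp
          then have 2: "norm (snd p + \<xi>) \<le> norm (snd p + (\<xi> + s *\<^sub>R e))"
            using norm_add_ge_inner[OF True ne, of e] by (simp add: add.assoc)
          show ?thesis using 1 2 U unfolding U_def by (simp add: abs_le_iff)
        qed
        have "emeasure lborel U \<le> ennreal (8 * R\<^sup>2 * (4 * D))"
        proof (rule emeasure_fibred[OF _ _ _ _ e(1) Uc fib])
          show "U \<subseteq> cball a R" by (auto simp: U_def dist_norm norm_minus_commute)
        qed (use Uc R L0 in \<open>auto simp: D_def\<close>)
        have "emeasure lborel S \<le> emeasure lborel {q. tube q \<le> L1 \<and> tube (- p - q) \<le> L2 \<and> snd q \<in> U}"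
        proof (intro emeasure_mono subsetI CollectI)
          fix q assume "q \<in> S"
          then have q: "(p, q, - p - q) \<in> X" "norm (snd q - a) \<le> R" by (auto simp: S_def Y_def)
          have t: "tube q \<le> L1" "tube (- p - q) \<le> L2"
            using fL_tube_le[of q] fL_tube_le[of "- p - q"] L[OF q(1)] by (auto simp: L1_def L2_def)
          have "snd (- p - q) = - (snd p + snd q)" by simp
          then have "norm (snd (- p - q)) = norm (snd p + snd q)" by (simp only: norm_minus_cancel)
          then have "\<bar>norm (snd q) + norm (snd p + snd q) - \<bar>fst p\<bar>\<bar> \<le> D"
            using t P[OF q(1)] unfolding tube_def D_def by linarith
          then show "tube q \<le> L1 \<and> tube (- p - q) \<le> L2 \<and> snd q \<in> U" using t q(2) by (simp add: U_def)
        qed (auto simp: U_def intro!: borel_closed closed_Collect_conj closed_Collect_le continuous_intros)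
        also have "\<dots> \<le> ennreal (4 * min L1 L2) * emeasure lborel U"
        proof (rule emeasure_st_le)
          show "{q. tube q \<le> L1 \<and> tube (- p - q) \<le> L2 \<and> snd q \<in> U} \<in> sets borel"
            unfolding U_def mem_Collect_eq by (intro borel_closed closed_Collect_conj closed_Collect_le continuous_intros)
          fix \<xi> :: "real^3"
          have "emeasure lborel {\<tau>. (\<tau>, \<xi>) \<in> {q. tube q \<le> L1 \<and> tube (- p - q) \<le> L2 \<and> snd q \<in> U}} \<le> emeasure lborel {\<tau>. \<bar>\<bar>0 - \<tau>\<bar> - norm \<xi>\<bar> \<le> L1}"
            by (intro emeasure_mono) (auto simp: tube_def intro!: borel_closed closed_Collect_le continuous_intros)
          moreover have "emeasure lborel {\<tau>. (\<tau>, \<xi>) \<in> {q. tube q \<le> L1 \<and> tube (- p - q) \<le> L2 \<and> snd q \<in> U}} \<le> emeasure lborel {\<tau>. \<bar>\<bar>- fst p - \<tau>\<bar> - norm (- snd p - \<xi>)\<bar> \<le> L2}"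
            by (intro emeasure_mono) (auto simp: tube_def intro!: borel_closed closed_Collect_le continuous_intros)
          ultimately show "emeasure lborel {\<tau>. (\<tau>, \<xi>) \<in> {q. tube q \<le> L1 \<and> tube (- p - q) \<le> L2 \<and> snd q \<in> U}} \<le> ennreal (4 * min L1 L2) * indicator U \<xi>"
            using emeasure_tau[OF L0(1), of 0 "norm \<xi>"] emeasure_tau[OF L0(2), of "- fst p" "norm (- snd p - \<xi>)"]
            by (cases "\<xi> \<in> U") (auto simp: min_def intro: order_trans)
        qed (use Uc in simp)
        also have "\<dots> \<le> ennreal (4 * min L1 L2) * ennreal (8 * R\<^sup>2 * (4 * D))"
          by (rule mult_left_mono) (fact, simp)
        also have "\<dots> = ennreal (128 * R\<^sup>2 * (min L1 L2 * D))"
          using L0 by (subst ennreal_mult[symmetric]) (auto simp: D_def mult_ac)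
        also have "\<dots> \<le> ennreal T"
        proof (rule ennreal_leI)
          have "min L1 L2 * L1 \<le> L2 * L1" "min L1 L2 * L2 \<le> L1 * L2" using L0 by (auto intro!: mult_right_mono)
          then have "min L1 L2 * D \<le> 2 * L1 * L2" unfolding D_def by (simp add: algebra_simps)
          then have "128 * R\<^sup>2 * (min L1 L2 * D) \<le> 128 * R\<^sup>2 * (2 * L1 * L2)" by (rule mult_left_mono) simp
          also have "\<dots> = 4096 * (2 ^ n0 * 2 ^ n0 * 2 ^ l1 * 2 ^ l2)" by (simp add: R_def L1_def L2_def power2_eq_square)
          also have "\<dots> \<le> KK / 8 * (2 ^ n0 * 2 ^ n0 * 2 ^ l1 * 2 ^ l2)" by (intro mult_right_mono) (auto simp: KK_def)
          also have "\<dots> = T" by (simp add: T_def power_add mult_2)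
          finally show "128 * R\<^sup>2 * (min L1 L2 * D) \<le> T" .
        qed
        finally show ?thesis .
      qed
      then show "emeasure lborel {q. (p, q, - p - q) \<in> Y} \<le> ennreal T" by (simp only: S_def)
    qed
    then show "tb (X \<inter> {(p, q, r). norm (snd q - a) \<le> R \<and> norm (snd r + a) \<le> 2 * R}) (ennreal T)"
      by (simp only: Y_def)
  qed
  moreover have "8 * ennreal T = ennreal (KK * 2 ^ (2 * n0 + l1 + l2))"
    by (simp add: T_def ennreal_mult[symmetric] KK_def ennreal_numeral[symmetric] del: ennreal_numeral)
  ultimately show ?thesis by simp
qed

subsection \<open>Summation over dyadic blocks\<close>

lemma nn_integral_count_space_inj_le:
  fixes f :: "'b \<Rightarrow> ennreal"
  assumes "inj_on h I"
  shows "(\<integral>\<^sup>+t. f (h t) \<partial>count_space I) \<le> (\<integral>\<^sup>+y. f y \<partial>count_space UNIV)"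
proof -
  have "(\<integral>\<^sup>+t. f (h t) \<partial>count_space I) = (\<integral>\<^sup>+y. f y \<partial>count_space (h ` I))"
    using assms by (intro nn_integral_bij_count_space inj_on_imp_bij_betw)
  also have "\<dots> = (\<integral>\<^sup>+y. f y * indicator (h ` I) y \<partial>count_space UNIV)"
    by (rule nn_integral_count_space_indicator) simp
  also have "\<dots> \<le> (\<integral>\<^sup>+y. f y \<partial>count_space UNIV)"
    by (intro nn_integral_mono) (auto split: split_indicator)
  finally show ?thesis .
qed

lemma nn_integral_count_space_times:
  fixes f :: "'a \<Rightarrow> ennreal" and g :: "'b \<Rightarrow> ennreal"
  shows "(\<integral>\<^sup>+x. f (fst x) * g (snd x) \<partial>count_space UNIV) = (\<integral>\<^sup>+x. f x \<partial>count_space UNIV) * (\<integral>\<^sup>+y. g y \<partial>count_space UNIV)"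
proof -
  have "(\<integral>\<^sup>+x. f (fst x) * g (snd x) \<partial>count_space UNIV) = (\<integral>\<^sup>+x. \<integral>\<^sup>+y. f x * g y \<partial>count_space UNIV \<partial>count_space UNIV)"
    using nn_integral_fst_count_space[of "\<lambda>x. f (fst x) * g (snd x)"] by simp
  also have "\<dots> = (\<integral>\<^sup>+x. f x * (\<integral>\<^sup>+y. g y \<partial>count_space UNIV) \<partial>count_space UNIV)"
    by (intro nn_integral_cong nn_integral_cmult) simp
  also have "\<dots> = (\<integral>\<^sup>+x. f x \<partial>count_space UNIV) * (\<integral>\<^sup>+y. g y \<partial>count_space UNIV)"
    by (rule nn_integral_multc) simp
  finally show ?thesis .
qed

text \<open>Since \<open>\<rho>\<close> and the third index determine the first two, and conversely, on each fibre of \<open>\<rho>\<close> the sum is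
  an inner product along a partial matching, to which Cauchy--Schwarz applies.\<close>

lemma key_sum:
  fixes a :: "'i \<Rightarrow> ennreal" and b :: "'j \<Rightarrow> ennreal" and c :: "'k \<Rightarrow> ennreal" and g :: "'r \<Rightarrow> ennreal"
  assumes w: "\<And>t. t \<in> I \<Longrightarrow> w t \<le> g (\<rho> t)"
    and inj1: "inj_on (\<lambda>t. (\<rho> t, snd (snd t))) I"
    and inj2: "inj_on (\<lambda>t. (\<rho> t, fst t, fst (snd t))) I"
  shows "(\<integral>\<^sup>+t. w t * (a (fst t) * b (fst (snd t)) * c (snd (snd t))) \<partial>count_space I)\<^sup>2
    \<le> (\<integral>\<^sup>+r. g r \<partial>count_space UNIV)\<^sup>2 * (\<integral>\<^sup>+i. (a i)\<^sup>2 \<partial>count_space UNIV) * (\<integral>\<^sup>+i. (b i)\<^sup>2 \<partial>count_space UNIV) * (\<integral>\<^sup>+i. (c i)\<^sup>2 \<partial>count_space UNIV)"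
proof -
  define G where "G = (\<integral>\<^sup>+r. g r \<partial>count_space UNIV)"
  have gg: "g r = esqrt (g r) * esqrt (g r)" for r using esqrt_square[of "g r"] by (simp add: power2_eq_square)
  have "(\<integral>\<^sup>+t. w t * (a (fst t) * b (fst (snd t)) * c (snd (snd t))) \<partial>count_space I)
    \<le> (\<integral>\<^sup>+t. g (\<rho> t) * (a (fst t) * b (fst (snd t)) * c (snd (snd t))) \<partial>count_space I)"
    using w by (intro nn_integral_mono mult_right_mono) auto
  also have "\<dots> = (\<integral>\<^sup>+t. (esqrt (g (\<rho> t)) * (a (fst t) * b (fst (snd t)))) * (esqrt (g (\<rho> t)) * c (snd (snd t))) \<partial>count_space I)"
    by (intro nn_integral_cong, subst gg) (simp add: mult_ac)
  finally have "(\<integral>\<^sup>+t. w t * (a (fst t) * b (fst (snd t)) * c (snd (snd t))) \<partial>count_space I)\<^sup>2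
    \<le> (\<integral>\<^sup>+t. (esqrt (g (\<rho> t)) * (a (fst t) * b (fst (snd t)))) * (esqrt (g (\<rho> t)) * c (snd (snd t))) \<partial>count_space I)\<^sup>2"
    by (rule power2_mono_ennreal)
  also have "\<dots> \<le> (\<integral>\<^sup>+t. (esqrt (g (\<rho> t)) * (a (fst t) * b (fst (snd t))))\<^sup>2 \<partial>count_space I) * (\<integral>\<^sup>+t. (esqrt (g (\<rho> t)) * c (snd (snd t)))\<^sup>2 \<partial>count_space I)"
    by (rule Cauchy_Schwarz_nn_integral) auto
  also have "\<dots> \<le> (G * ((\<integral>\<^sup>+i. (a i)\<^sup>2 \<partial>count_space UNIV) * (\<integral>\<^sup>+i. (b i)\<^sup>2 \<partial>count_space UNIV))) * (G * (\<integral>\<^sup>+i. (c i)\<^sup>2 \<partial>count_space UNIV))"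
  proof (intro mult_mono)
    have "(\<integral>\<^sup>+t. (esqrt (g (\<rho> t)) * (a (fst t) * b (fst (snd t))))\<^sup>2 \<partial>count_space I)
      = (\<integral>\<^sup>+t. (\<lambda>y. g (fst y) * ((a (fst (snd y)))\<^sup>2 * (b (snd (snd y)))\<^sup>2)) (\<rho> t, fst t, fst (snd t)) \<partial>count_space I)"
      by (simp add: power_mult_distrib)
    also have "\<dots> \<le> (\<integral>\<^sup>+y. g (fst y) * (\<lambda>z. (a (fst z))\<^sup>2 * (b (snd z))\<^sup>2) (snd y) \<partial>count_space UNIV)"
      by (rule nn_integral_count_space_inj_le[OF inj2])
    also have "\<dots> = G * (\<integral>\<^sup>+z. (a (fst z))\<^sup>2 * (b (snd z))\<^sup>2 \<partial>count_space UNIV)"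
      unfolding G_def by (rule nn_integral_count_space_times)
    also have "(\<integral>\<^sup>+z. (a (fst z))\<^sup>2 * (b (snd z))\<^sup>2 \<partial>count_space UNIV) = (\<integral>\<^sup>+i. (a i)\<^sup>2 \<partial>count_space UNIV) * (\<integral>\<^sup>+i. (b i)\<^sup>2 \<partial>count_space UNIV)"
      by (rule nn_integral_count_space_times)
    finally show "(\<integral>\<^sup>+t. (esqrt (g (\<rho> t)) * (a (fst t) * b (fst (snd t))))\<^sup>2 \<partial>count_space I)
      \<le> G * ((\<integral>\<^sup>+i. (a i)\<^sup>2 \<partial>count_space UNIV) * (\<integral>\<^sup>+i. (b i)\<^sup>2 \<partial>count_space UNIV))" .
    have "(\<integral>\<^sup>+t. (esqrt (g (\<rho> t)) * c (snd (snd t)))\<^sup>2 \<partial>count_space I)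
      = (\<integral>\<^sup>+t. (\<lambda>y. g (fst y) * (c (snd y))\<^sup>2) (\<rho> t, snd (snd t)) \<partial>count_space I)"
      by (simp add: power_mult_distrib)
    also have "\<dots> \<le> (\<integral>\<^sup>+y. g (fst y) * (c (snd y))\<^sup>2 \<partial>count_space UNIV)"
      by (rule nn_integral_count_space_inj_le[OF inj1])
    also have "\<dots> = G * (\<integral>\<^sup>+i. (c i)\<^sup>2 \<partial>count_space UNIV)"
      unfolding G_def by (rule nn_integral_count_space_times)
    finally show "(\<integral>\<^sup>+t. (esqrt (g (\<rho> t)) * c (snd (snd t)))\<^sup>2 \<partial>count_space I) \<le> G * (\<integral>\<^sup>+i. (c i)\<^sup>2 \<partial>count_space UNIV)" .
  qed auto
  finally show ?thesis by (simp add: G_def power2_eq_square mult_ac)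
qed

section \<open>From block estimates to bounded kernels\<close>

definition kb :: "(st \<times> st \<times> st \<Rightarrow> ennreal) \<Rightarrow> bool" where
  "kb \<Phi> \<longleftrightarrow> (\<exists>C::real. \<forall>F G H. F \<in> borel_measurable borel \<longrightarrow> G \<in> borel_measurable borel \<longrightarrow> H \<in> borel_measurable borel \<longrightarrow>
     (tri (\<lambda>x. \<Phi> x * (F (fst x) * G (fst (snd x)) * H (snd (snd x)))))\<^sup>2 \<le> ennreal C * sqn F * sqn G * sqn H)"

lemma indicator_index_measurable [measurable (raw)]:
  "\<iota> \<in> measurable M (count_space UNIV) \<Longrightarrow> (\<lambda>x. indicator A (\<iota> x) :: ennreal) \<in> borel_measurable M"
  by (erule measurable_compose) simp

lemma sqn_decompose:
  fixes \<iota> :: "st \<Rightarrow> nat \<times> nat"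
  assumes [measurable]: "F \<in> borel_measurable borel" and \<iota> [measurable]: "\<iota> \<in> measurable borel (count_space UNIV)"
  shows "(\<integral>\<^sup>+i. sqn (\<lambda>p. F p * indicator {i} (\<iota> p)) \<partial>count_space UNIV) = sqn F"
proof -
  have "(\<integral>\<^sup>+i. sqn (\<lambda>p. F p * indicator {i} (\<iota> p)) \<partial>count_space UNIV)
     = (\<integral>\<^sup>+p. (\<integral>\<^sup>+i. (F p * indicator {i} (\<iota> p))\<^sup>2 \<partial>count_space UNIV) \<partial>lborel)"
    unfolding sqn_def by (rule nn_integral_count_space_nn_integral[symmetric]) (simp, measurable)
  also have "\<dots> = (\<integral>\<^sup>+p. (\<integral>\<^sup>+i. (F p)\<^sup>2 * indicator {\<iota> p} i \<partial>count_space UNIV) \<partial>lborel)"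
    by (intro nn_integral_cong) (auto split: split_indicator)
  also have "\<dots> = sqn F" by (simp add: sqn_def nn_integral_cmult_indicator)
  finally show ?thesis .
qed

text \<open>On each index triple the weight is replaced by its bound \<open>\<omega>\<close> and the
  form by the root of its squared bound B. This leaves a weighted sum of products of block norms, to
  which \<open>key_sum\<close> applies; the blocks of one function are disjoint, so their squared
  norms add up to its squared norm.\<close>

lemma dyadic_sum:
  fixes \<iota>0 \<iota>1 \<iota>2 :: "st \<Rightarrow> nat \<times> nat" and g :: "'r \<Rightarrow> real"
  assumes X [measurable]: "X \<in> sets st3"
    and \<iota> [measurable]: "\<iota>0 \<in> measurable borel (count_space UNIV)" "\<iota>1 \<in> measurable borel (count_space UNIV)" "\<iota>2 \<in> measurable borel (count_space UNIV)"
    and W [measurable]: "W \<in> borel_measurable st3"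
    and I: "\<And>p q r. (p, q, r) \<in> X \<Longrightarrow> (\<iota>0 p, \<iota>1 q, \<iota>2 r) \<in> I"
    and WI: "\<And>p q r. (p, q, r) \<in> X \<Longrightarrow> W (p, q, r) \<le> ennreal (\<omega> (\<iota>0 p, \<iota>1 q, \<iota>2 r))"
    and tb: "\<And>i j k. (i, j, k) \<in> I \<Longrightarrow> tb {(p, q, r) \<in> X. \<iota>0 p = i \<and> \<iota>1 q = j \<and> \<iota>2 r = k} (ennreal (B (i, j, k)))"
    and pos: "\<And>t. \<omega> t \<ge> 0" "\<And>t. B t \<ge> 0"
    and le: "\<And>t. t \<in> I \<Longrightarrow> \<omega> t * sqrt (B t) \<le> g (\<rho> t)"
    and g: "(\<integral>\<^sup>+r. ennreal (g r) \<partial>count_space UNIV) < \<infinity>"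
    and inj1: "inj_on (\<lambda>t. (\<rho> t, snd (snd t))) I"
    and inj2: "inj_on (\<lambda>t. (\<rho> t, fst t, fst (snd t))) I"
  shows "kb (\<lambda>x. indicator X x * W x)"
proof -
  define G where "G = enn2real (\<integral>\<^sup>+r. ennreal (g r) \<partial>count_space UNIV)"
  have G: "ennreal G = (\<integral>\<^sup>+r. ennreal (g r) \<partial>count_space UNIV)" "G \<ge> 0" using g by (auto simp: G_def)
  define Xt where "Xt t = {(p, q, r) \<in> X. \<iota>0 p = fst t \<and> \<iota>1 q = fst (snd t) \<and> \<iota>2 r = snd (snd t)}" for t
  have Xti: "indicator (Xt t) x = (indicator X x * (indicator {fst t} (\<iota>0 (fst x)) * indicator {fst (snd t)} (\<iota>1 (fst (snd x))) * indicator {snd (snd t)} (\<iota>2 (snd (snd x)))) :: ennreal)" for t x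
    by (cases x) (auto simp: Xt_def split: split_indicator)
  show ?thesis unfolding kb_def
  proof (intro exI[of _ "G\<^sup>2"] allI impI)
    fix F0 F1 F2 :: "st \<Rightarrow> ennreal"
    assume [measurable]: "F0 \<in> borel_measurable borel" "F1 \<in> borel_measurable borel" "F2 \<in> borel_measurable borel"
    define f0 where "f0 i = (\<lambda>p. F0 p * indicator {i} (\<iota>0 p))" for i
    define f1 where "f1 i = (\<lambda>p. F1 p * indicator {i} (\<iota>1 p))" for i
    define f2 where "f2 i = (\<lambda>p. F2 p * indicator {i} (\<iota>2 p))" for i
    have [measurable]: "f0 i \<in> borel_measurable borel" "f1 i \<in> borel_measurable borel" "f2 i \<in> borel_measurable borel" for i
      unfolding f0_def f1_def f2_def by measurable
    have "tri (\<lambda>x. indicator X x * W x * (F0 (fst x) * F1 (fst (snd x)) * F2 (snd (snd x))))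
       \<le> tri (\<lambda>x. \<integral>\<^sup>+t. ennreal (\<omega> t) * (indicator (Xt t) x * (F0 (fst x) * F1 (fst (snd x)) * F2 (snd (snd x)))) \<partial>count_space I)"
    proof (rule tri_mono)
      fix x :: "st \<times> st \<times> st"
      obtain p q r where x: "x = (p, q, r)" by (cases x)
      show "indicator X x * W x * (F0 (fst x) * F1 (fst (snd x)) * F2 (snd (snd x)))
        \<le> (\<integral>\<^sup>+t. ennreal (\<omega> t) * (indicator (Xt t) x * (F0 (fst x) * F1 (fst (snd x)) * F2 (snd (snd x)))) \<partial>count_space I)"
      proof (cases "x \<in> X")
        case True
        define t where "t = (\<iota>0 p, \<iota>1 q, \<iota>2 r)"
        have t: "t \<in> I" using I True x by (simp add: t_def)
        have "indicator X x * W x * (F0 (fst x) * F1 (fst (snd x)) * F2 (snd (snd x)))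
          \<le> ennreal (\<omega> t) * (indicator (Xt t) x * (F0 (fst x) * F1 (fst (snd x)) * F2 (snd (snd x))))"
          using WI[of p q r] True x by (auto simp: t_def Xt_def intro!: mult_right_mono)
        also have "\<dots> = (\<integral>\<^sup>+t'. (ennreal (\<omega> t) * (indicator (Xt t) x * (F0 (fst x) * F1 (fst (snd x)) * F2 (snd (snd x))))) * indicator {t} t' \<partial>count_space I)"
          using t by (subst nn_integral_cmult_indicator) auto
        also have "\<dots> \<le> (\<integral>\<^sup>+t. ennreal (\<omega> t) * (indicator (Xt t) x * (F0 (fst x) * F1 (fst (snd x)) * F2 (snd (snd x)))) \<partial>count_space I)"
          by (intro nn_integral_mono) (auto split: split_indicator)
        finally show ?thesis .
      qed simp
    qed
    also have "\<dots> = (\<integral>\<^sup>+t. ennreal (\<omega> t) * trX (Xt t) F0 F1 F2 \<partial>count_space I)"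
    proof -
      define k :: "(nat \<times> nat) \<times> (nat \<times> nat) \<times> nat \<times> nat \<Rightarrow> st \<Rightarrow> st \<Rightarrow> ennreal" where "k t p q = indicator (Xt t) (p, q, - p - q) * (F0 p * F1 q * F2 (- p - q))" for t p q
      have km: "(\<lambda>(p, q). k t p q) \<in> borel_measurable (borel \<Otimes>\<^sub>M borel)" for t
        unfolding k_def Xti case_prod_unfold by measurable
      have kr [measurable (raw)]: "(\<lambda>x. k t (u x) (v x)) \<in> borel_measurable M"
        if "u \<in> measurable M borel" "v \<in> measurable M borel" for t u v and M :: "'z measure"
        using measurable_compose[OF measurable_Pair[OF that] km[of t]] by simp
      have "tri (\<lambda>x. \<integral>\<^sup>+t. ennreal (\<omega> t) * (indicator (Xt t) x * (F0 (fst x) * F1 (fst (snd x)) * F2 (snd (snd x)))) \<partial>count_space I)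
        = (\<integral>\<^sup>+p. \<integral>\<^sup>+q. \<integral>\<^sup>+t. ennreal (\<omega> t) * k t p q \<partial>count_space I \<partial>lborel \<partial>lborel)"
        unfolding tri_def k_def by simp
      also have "\<dots> = (\<integral>\<^sup>+p. \<integral>\<^sup>+t. \<integral>\<^sup>+q. ennreal (\<omega> t) * k t p q \<partial>lborel \<partial>count_space I \<partial>lborel)"
        by (intro nn_integral_cong nn_integral_count_space_nn_integral) (simp, measurable)
      also have "\<dots> = (\<integral>\<^sup>+t. \<integral>\<^sup>+p. \<integral>\<^sup>+q. ennreal (\<omega> t) * k t p q \<partial>lborel \<partial>lborel \<partial>count_space I)"
        by (intro nn_integral_count_space_nn_integral) (simp, measurable)
      also have "\<dots> = (\<integral>\<^sup>+t. ennreal (\<omega> t) * trX (Xt t) F0 F1 F2 \<partial>count_space I)"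
      proof (rule nn_integral_cong)
        fix t
        have "trX (Xt t) F0 F1 F2 = (\<integral>\<^sup>+p. \<integral>\<^sup>+q. k t p q \<partial>lborel \<partial>lborel)" by (simp add: trX_def tri_def k_def)
        moreover have "(\<integral>\<^sup>+q. ennreal (\<omega> t) * k t p q \<partial>lborel) = ennreal (\<omega> t) * (\<integral>\<^sup>+q. k t p q \<partial>lborel)" for p
          by (rule nn_integral_cmult) measurable
        moreover have "(\<integral>\<^sup>+p. ennreal (\<omega> t) * (\<integral>\<^sup>+q. k t p q \<partial>lborel) \<partial>lborel) = ennreal (\<omega> t) * (\<integral>\<^sup>+p. \<integral>\<^sup>+q. k t p q \<partial>lborel \<partial>lborel)"
          by (rule nn_integral_cmult) measurable
        ultimately show "(\<integral>\<^sup>+p. \<integral>\<^sup>+q. ennreal (\<omega> t) * k t p q \<partial>lborel \<partial>lborel) = ennreal (\<omega> t) * trX (Xt t) F0 F1 F2"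
          by simp
      qed
      finally show ?thesis .
    qed
    also have "\<dots> \<le> (\<integral>\<^sup>+t. ennreal (\<omega> t * sqrt (B t)) * (esqrt (sqn (f0 (fst t))) * esqrt (sqn (f1 (fst (snd t)))) * esqrt (sqn (f2 (snd (snd t))))) \<partial>count_space I)"
    proof (rule nn_integral_mono)
      fix t assume "t \<in> space (count_space I)"
      then have t: "t \<in> I" by simp
      have "trX (Xt t) F0 F1 F2 = trX (Xt t) (f0 (fst t)) (f1 (fst (snd t))) (f2 (snd (snd t)))"
        unfolding trX_def Xti f0_def f1_def f2_def by (auto intro!: arg_cong[where f=tri] simp: fun_eq_iff split: split_indicator)
      also have "\<dots>\<^sup>2 \<le> ennreal (B t) * sqn (f0 (fst t)) * sqn (f1 (fst (snd t))) * sqn (f2 (snd (snd t)))"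
        using tb[of "fst t" "fst (snd t)" "snd (snd t)"] t unfolding tb_def Xt_def by simp
      also have "\<dots> = (ennreal (sqrt (B t)) * (esqrt (sqn (f0 (fst t))) * esqrt (sqn (f1 (fst (snd t)))) * esqrt (sqn (f2 (snd (snd t))))))\<^sup>2"
        using pos(2)[of t] by (simp add: power_mult_distrib ennreal_power mult.assoc)
      finally have "trX (Xt t) F0 F1 F2 \<le> ennreal (sqrt (B t)) * (esqrt (sqn (f0 (fst t))) * esqrt (sqn (f1 (fst (snd t)))) * esqrt (sqn (f2 (snd (snd t)))))"
        by (rule power2_le_ennreal)
      then have "ennreal (\<omega> t) * trX (Xt t) F0 F1 F2 \<le> ennreal (\<omega> t) * (ennreal (sqrt (B t)) * (esqrt (sqn (f0 (fst t))) * esqrt (sqn (f1 (fst (snd t)))) * esqrt (sqn (f2 (snd (snd t))))))"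
        by (rule mult_left_mono) simp
      then show "ennreal (\<omega> t) * trX (Xt t) F0 F1 F2 \<le> ennreal (\<omega> t * sqrt (B t)) * (esqrt (sqn (f0 (fst t))) * esqrt (sqn (f1 (fst (snd t)))) * esqrt (sqn (f2 (snd (snd t)))))"
        using pos(1)[of t] pos(2)[of t] by (simp add: ennreal_mult mult.assoc)
    qed
    finally have "(tri (\<lambda>x. indicator X x * W x * (F0 (fst x) * F1 (fst (snd x)) * F2 (snd (snd x)))))\<^sup>2 \<le>
      (\<integral>\<^sup>+t. ennreal (\<omega> t * sqrt (B t)) * (esqrt (sqn (f0 (fst t))) * esqrt (sqn (f1 (fst (snd t)))) * esqrt (sqn (f2 (snd (snd t))))) \<partial>count_space I)\<^sup>2"
      by (rule power2_mono_ennreal)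
    also have "\<dots> \<le> (\<integral>\<^sup>+r. ennreal (g r) \<partial>count_space UNIV)\<^sup>2 * (\<integral>\<^sup>+i. (esqrt (sqn (f0 i)))\<^sup>2 \<partial>count_space UNIV) * (\<integral>\<^sup>+i. (esqrt (sqn (f1 i)))\<^sup>2 \<partial>count_space UNIV) * (\<integral>\<^sup>+i. (esqrt (sqn (f2 i)))\<^sup>2 \<partial>count_space UNIV)"
      using le by (intro key_sum[where \<rho>=\<rho>] inj1 inj2 ennreal_leI) auto
    also have "\<dots> = ennreal (G\<^sup>2) * sqn F0 * sqn F1 * sqn F2"
      unfolding G(1)[symmetric] f0_def f1_def f2_def using G(2) by (simp add: sqn_decompose ennreal_power)
    finally show "(tri (\<lambda>x. indicator X x * W x * (F0 (fst x) * F1 (fst (snd x)) * F2 (snd (snd x)))))\<^sup>2 \<le> ennreal (G\<^sup>2) * sqn F0 * sqn F1 * sqn F2" .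
  qed
qed

section \<open>Measurability of the dyadic indices and size of the weights\<close>

lemma fN_measurable [measurable]: "fN \<in> measurable borel (count_space UNIV)"
proof -
  have [measurable]: "(\<lambda>p::st. log 2 (jbr (norm (snd p)))) \<in> borel_measurable borel"
    unfolding jbr_def log_def by (intro borel_measurable_divide borel_measurable_ln borel_measurable_continuous_onI continuous_intros) auto
  show ?thesis unfolding fN_def[abs_def] dy_def by measurable
qed

lemma fL_measurable [measurable]: "fL \<in> measurable borel (count_space UNIV)"
proof -
  have [measurable]: "(\<lambda>p::st. log 2 (jbr (\<bar>fst p\<bar> - norm (snd p)))) \<in> borel_measurable borel"
    unfolding jbr_def log_def by (intro borel_measurable_divide borel_measurable_ln borel_measurable_continuous_onI continuous_intros) auto
  show ?thesis unfolding fL_def[abs_def] dy_def by measurable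
qed

text \<open>The reciprocal of the multiplier in the norm with exponents s and b: a transform divided
  by it is a function whose plain squared norm is \<open>hsb_sq s b\<close>.\<close>

definition wt :: "real \<Rightarrow> real \<Rightarrow> st \<Rightarrow> real" where
  "wt s b p = jbr (norm (snd p)) powr (- s) * jbr (\<bar>fst p\<bar> - norm (snd p)) powr (- b)"

lemma wt_measurable [measurable]: "wt s b \<in> borel_measurable borel"
proof -
  have [measurable]: "(\<lambda>p::st. jbr (norm (snd p))) \<in> borel_measurable borel" "(\<lambda>p::st. jbr (\<bar>fst p\<bar> - norm (snd p))) \<in> borel_measurable borel"
    unfolding jbr_def by (intro borel_measurable_continuous_onI continuous_intros)+
  show ?thesis unfolding wt_def[abs_def] by measurable
qed

lemma wt_pos: "wt s b p > 0"
  using jbr_ge(1)[of "norm (snd p)"] jbr_ge(1)[of "\<bar>fst p\<bar> - norm (snd p)"] by (simp add: wt_def)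

definition WW :: "real \<Rightarrow> real \<Rightarrow> real \<Rightarrow> real \<Rightarrow> real \<Rightarrow> real \<Rightarrow> st \<times> st \<times> st \<Rightarrow> ennreal" where
  "WW s0 s1 s2 b0 b1 b2 x = ennreal (wt s0 b0 (fst x) * wt s1 b1 (fst (snd x)) * wt s2 b2 (snd (snd x)))"

lemma WW_measurable [measurable]: "WW s0 s1 s2 b0 b1 b2 \<in> borel_measurable st3"
  unfolding WW_def[abs_def] by measurable

text \<open>Within a dyadic block the bracket varies by at most a factor 2, so its power changes by
  at most 2^|s|, whatever the sign of s.\<close>

lemma jbr_powr_le: "jbr x powr (- s) \<le> 2 powr (\<bar>s\<bar> - s * real (dy (jbr x)))"
proof -
  define n where "n = dy (jbr x)"
  define u where "u = jbr x / 2 ^ n"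
  have j: "2 ^ n \<le> jbr x" "jbr x < 2 * 2 ^ n" using dy_bounds[OF jbr_ge(1)] by (auto simp: n_def)
  have u: "1 \<le> u" "u \<le> 2" using j by (auto simp: u_def pos_le_divide_eq pos_divide_le_eq)
  have "jbr x powr (- s) = (2 ^ n * u) powr (- s)" by (simp add: u_def)
  also have "\<dots> = (2 ^ n) powr (- s) * u powr (- s)" using u by (subst powr_mult) auto
  also have "(2::real) ^ n = 2 powr (real n)" by (simp add: powr_realpow)
  also have "(2 powr real n) powr (- s) = 2 powr (- s * real n)" by (simp add: powr_powr mult.commute)
  also have "u powr (- s) \<le> u powr \<bar>s\<bar>" using u by (intro powr_mono) auto
  also have "u powr \<bar>s\<bar> \<le> 2 powr \<bar>s\<bar>" using u by (intro powr_mono2) auto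
  finally have "jbr x powr (- s) \<le> 2 powr (- s * real n) * 2 powr \<bar>s\<bar>" by (simp add: mult_left_mono)
  then show ?thesis by (simp add: n_def powr_add[symmetric])
qed

text \<open>If \<open>b = 0\<close>, then the modulation need not be decomposed; setting its index to \<open>0\<close> (the case \<open>c\<close>) keeps
  the number of summation indices small.\<close>

definition fLc :: "bool \<Rightarrow> st \<Rightarrow> nat" where "fLc c p = (if c then 0 else fL p)"

lemma fLc_measurable [measurable]: "fLc c \<in> measurable borel (count_space UNIV)"
  unfolding fLc_def[abs_def] by (cases c) simp_all

lemma wt_le:
  assumes "c \<Longrightarrow> b = 0"
  shows "wt s b p \<le> 2 powr (\<bar>s\<bar> + \<bar>b\<bar> - s * real (fN p) - b * real (fLc c p))"
proof -
  have 1: "jbr (\<bar>fst p\<bar> - norm (snd p)) powr (- b) \<le> 2 powr (\<bar>b\<bar> - b * real (fLc c p))"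
    using jbr_powr_le[of "\<bar>fst p\<bar> - norm (snd p)" b] assms by (cases c) (simp_all add: fLc_def fL_def powr_zero_eq_one)
  have "wt s b p \<le> 2 powr (\<bar>s\<bar> - s * real (fN p)) * 2 powr (\<bar>b\<bar> - b * real (fLc c p))"
    unfolding wt_def fN_def by (intro mult_mono 1 jbr_powr_le) auto
  then show ?thesis by (simp add: powr_add[symmetric] algebra_simps)
qed

type_synonym int6 = "int \<times> int \<times> int \<times> int \<times> int \<times> int"

fun nrm6 :: "int6 \<Rightarrow> real" where
  "nrm6 (a, b, c, d, e, f) = \<bar>a\<bar> + \<bar>b\<bar> + \<bar>c\<bar> + \<bar>d\<bar> + \<bar>e\<bar> + \<bar>f\<bar>"

lemma geometric_int_finite:
  assumes "\<delta> > 0"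
  shows "(\<integral>\<^sup>+k. ennreal (2 powr (- \<delta> * \<bar>real_of_int k\<bar>)) \<partial>count_space (UNIV :: int set)) < \<infinity>"
proof -
  define q where "q = 2 powr (- \<delta>)"
  have q: "0 < q" "q < 1" using assms by (auto simp: q_def powr_less_one)
  have pw: "2 powr (- \<delta> * real n) = q ^ n" for n by (simp add: q_def powr_powr powr_realpow[symmetric])
  have fin: "(\<integral>\<^sup>+n. ennreal (q ^ n) \<partial>count_space (UNIV :: nat set)) < \<infinity>"
    using q by (simp add: nn_integral_count_space_nat suminf_ennreal2[OF _ summable_geometric])
  have "(\<integral>\<^sup>+k. ennreal (2 powr (- \<delta> * \<bar>real_of_int k\<bar>)) \<partial>count_space (UNIV :: int set))
     = (\<integral>\<^sup>+k. ennreal (2 powr (- \<delta> * \<bar>real_of_int k\<bar>)) * indicator {0..} k + ennreal (2 powr (- \<delta> * \<bar>real_of_int k\<bar>)) * indicator {..<0} k \<partial>count_space UNIV)"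
    by (intro nn_integral_cong) (auto split: split_indicator)
  also have "\<dots> = (\<integral>\<^sup>+k. ennreal (2 powr (- \<delta> * \<bar>real_of_int k\<bar>)) * indicator {0..} k \<partial>count_space UNIV) + (\<integral>\<^sup>+k. ennreal (2 powr (- \<delta> * \<bar>real_of_int k\<bar>)) * indicator {..<0} k \<partial>count_space UNIV)"
    by (rule nn_integral_add) auto
  also have "\<dots> = (\<integral>\<^sup>+k. ennreal (2 powr (- \<delta> * \<bar>real_of_int k\<bar>)) \<partial>count_space {0..}) + (\<integral>\<^sup>+k. ennreal (2 powr (- \<delta> * \<bar>real_of_int k\<bar>)) \<partial>count_space {..<0})"
    by (simp add: nn_integral_count_space_indicator)
  also have "\<dots> \<le> (\<integral>\<^sup>+n. ennreal (q ^ n) \<partial>count_space (UNIV :: nat set)) + (\<integral>\<^sup>+n. ennreal (q ^ n) \<partial>count_space (UNIV :: nat set))"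
  proof (intro add_mono)
    have "(\<integral>\<^sup>+k. ennreal (2 powr (- \<delta> * \<bar>real_of_int k\<bar>)) \<partial>count_space {0..}) = (\<integral>\<^sup>+k. ennreal (q ^ nat k) \<partial>count_space {0..})"
      by (intro nn_integral_cong) (simp add: pw[symmetric])
    also have "\<dots> \<le> (\<integral>\<^sup>+n. ennreal (q ^ n) \<partial>count_space (UNIV :: nat set))"
      by (rule nn_integral_count_space_inj_le[where h=nat]) (auto simp: inj_on_def)
    finally show "(\<integral>\<^sup>+k. ennreal (2 powr (- \<delta> * \<bar>real_of_int k\<bar>)) \<partial>count_space {0..}) \<le> (\<integral>\<^sup>+n. ennreal (q ^ n) \<partial>count_space (UNIV :: nat set))" .
    have "(\<integral>\<^sup>+k. ennreal (2 powr (- \<delta> * \<bar>real_of_int k\<bar>)) \<partial>count_space {..<0}) = (\<integral>\<^sup>+k. ennreal (q ^ nat (- k)) \<partial>count_space {..<0})"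
      by (intro nn_integral_cong) (simp add: pw[symmetric])
    also have "\<dots> \<le> (\<integral>\<^sup>+n. ennreal (q ^ n) \<partial>count_space (UNIV :: nat set))"
      by (rule nn_integral_count_space_inj_le[where h="\<lambda>k. nat (- k)"]) (auto simp: inj_on_def)
    finally show "(\<integral>\<^sup>+k. ennreal (2 powr (- \<delta> * \<bar>real_of_int k\<bar>)) \<partial>count_space {..<0}) \<le> (\<integral>\<^sup>+n. ennreal (q ^ n) \<partial>count_space (UNIV :: nat set))" .
  qed
  also have "\<dots> < \<infinity>" using fin by simp
  finally show ?thesis .
qed

lemma geometric_int6_finite:
  assumes "\<delta> > 0" and K: "K \<ge> 0"
  shows "(\<integral>\<^sup>+r. ennreal (K * 2 powr (- \<delta> * nrm6 r)) \<partial>count_space UNIV) < \<infinity>"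
proof -
  define h where "h k = ennreal (2 powr (- \<delta> * \<bar>real_of_int k\<bar>))" for k
  define H where "H = (\<integral>\<^sup>+k. h k \<partial>count_space UNIV)"
  have H: "H < \<top>" using geometric_int_finite[OF assms(1)] by (simp add: H_def h_def)
  define h2 where "h2 r = h (fst r) * h (snd r)" for r
  define h3 where "h3 r = h (fst r) * h2 (snd r)" for r
  define h4 where "h4 r = h (fst r) * h3 (snd r)" for r
  define h5 where "h5 r = h (fst r) * h4 (snd r)" for r
  define h6 where "h6 r = h (fst r) * h5 (snd r)" for r
  note defs = h2_def[abs_def] h3_def[abs_def] h4_def[abs_def] h5_def[abs_def] h6_def[abs_def]
  have h6: "ennreal (K * 2 powr (- \<delta> * nrm6 r)) = ennreal K * h6 r" for r
    using K by (cases r) (simp add: defs h_def ennreal_mult[symmetric] powr_add[symmetric] algebra_simps)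
  have "(\<integral>\<^sup>+r. h6 r \<partial>count_space UNIV) = H * (\<integral>\<^sup>+r. h5 r \<partial>count_space UNIV)"
    unfolding h6_def H_def by (rule nn_integral_count_space_times)
  also have "(\<integral>\<^sup>+r. h5 r \<partial>count_space UNIV) = H * (\<integral>\<^sup>+r. h4 r \<partial>count_space UNIV)"
    unfolding h5_def H_def by (rule nn_integral_count_space_times)
  also have "(\<integral>\<^sup>+r. h4 r \<partial>count_space UNIV) = H * (\<integral>\<^sup>+r. h3 r \<partial>count_space UNIV)"
    unfolding h4_def H_def by (rule nn_integral_count_space_times)
  also have "(\<integral>\<^sup>+r. h3 r \<partial>count_space UNIV) = H * (\<integral>\<^sup>+r. h2 r \<partial>count_space UNIV)"
    unfolding h3_def H_def by (rule nn_integral_count_space_times)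
  also have "(\<integral>\<^sup>+r. h2 r \<partial>count_space UNIV) = H * H"
    unfolding h2_def H_def by (rule nn_integral_count_space_times)
  finally have "(\<integral>\<^sup>+r. ennreal (K * 2 powr (- \<delta> * nrm6 r)) \<partial>count_space UNIV) = ennreal K * (H * (H * (H * (H * (H * H)))))"
    unfolding h6 by (subst nn_integral_cmult) auto
  also have "\<dots> < \<top>" using H by (simp add: ennreal_mult_less_top)
  finally show ?thesis by simp
qed

type_synonym idx6 = "(nat \<times> nat) \<times> (nat \<times> nat) \<times> (nat \<times> nat)"

text \<open>The summand is the weight times the root of the volume bound, hence the term e / 2 in
  the exponent. Decay is required in the image \<open>\<rho>\<close> and not in the indices
  themselves, where it fails as soon as a slack vanishes; the two injectivity conditions make up for
  the directions that \<open>\<rho>\<close> does not see. The relation R is stated for the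
  modulation indices after the undecomposed ones have been set to 0.\<close>

lemma cone_kb:
  fixes \<rho> :: "nat \<Rightarrow> nat \<Rightarrow> nat \<Rightarrow> nat \<Rightarrow> nat \<Rightarrow> nat \<Rightarrow> int6" and e :: "nat \<Rightarrow> nat \<Rightarrow> nat \<Rightarrow> nat \<Rightarrow> nat \<Rightarrow> nat \<Rightarrow> nat"
  assumes X [measurable]: "X \<in> sets st3" and X0: "\<And>p q r. (p, q, r) \<in> X \<Longrightarrow> p + q + r = 0"
    and c: "c0 \<Longrightarrow> b0 = 0" "c1 \<Longrightarrow> b1 = 0" "c2 \<Longrightarrow> b2 = 0"
    and R: "\<And>p q r. (p, q, r) \<in> X \<Longrightarrow> R (fN p) (fLc c0 p) (fN q) (fLc c1 q) (fN r) (fLc c2 r)"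
    and tb: "\<And>Y n0 l0 n1 l1 n2 l2. Y \<in> sets st3 \<Longrightarrow> Y \<subseteq> X \<Longrightarrow> Y \<subseteq> blk n0 n1 n2 \<Longrightarrow>
       (\<And>p q r. (p, q, r) \<in> Y \<Longrightarrow> fLc c0 p = l0 \<and> fLc c1 q = l1 \<and> fLc c2 r = l2) \<Longrightarrow> R n0 l0 n1 l1 n2 l2 \<Longrightarrow>
       tb Y (ennreal (KK * 2 ^ e n0 l0 n1 l1 n2 l2))"
    and est: "\<And>n0 l0 n1 l1 n2 l2. R n0 l0 n1 l1 n2 l2 \<Longrightarrow>
       - s0 * n0 - s1 * n1 - s2 * n2 - b0 * l0 - b1 * l1 - b2 * l2 + e n0 l0 n1 l1 n2 l2 / 2 \<le> A - \<delta> * nrm6 (\<rho> n0 l0 n1 l1 n2 l2)"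
    and \<delta>: "\<delta> > 0"
    and inj2: "\<And>n0 l0 n1 l1 n2 l2 n0' l0' n1' l1'. R n0 l0 n1 l1 n2 l2 \<Longrightarrow> R n0' l0' n1' l1' n2 l2 \<Longrightarrow>
       \<rho> n0 l0 n1 l1 n2 l2 = \<rho> n0' l0' n1' l1' n2 l2 \<Longrightarrow> n0 = n0' \<and> l0 = l0' \<and> n1 = n1' \<and> l1 = l1'"
    and inj1: "\<And>n0 l0 n1 l1 n2 l2 n2' l2'. R n0 l0 n1 l1 n2 l2 \<Longrightarrow> R n0 l0 n1 l1 n2' l2' \<Longrightarrow>
       \<rho> n0 l0 n1 l1 n2 l2 = \<rho> n0 l0 n1 l1 n2' l2' \<Longrightarrow> n2 = n2' \<and> l2 = l2'"
  shows "kb (\<lambda>x. indicator X x * WW s0 s1 s2 b0 b1 b2 x)"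
proof -
  define cw where "cw = \<bar>s0\<bar> + \<bar>b0\<bar> + (\<bar>s1\<bar> + \<bar>b1\<bar>) + (\<bar>s2\<bar> + \<bar>b2\<bar>)"
  define E where "E = (\<lambda>((n0, l0), (n1, l1), (n2, l2)). - s0 * real n0 - s1 * real n1 - s2 * real n2 - b0 * real l0 - b1 * real l1 - b2 * real l2)"
  define I :: "idx6 set" where "I = {((n0, l0), (n1, l1), (n2, l2)) | n0 l0 n1 l1 n2 l2. R n0 l0 n1 l1 n2 l2}"
  define B where "B = (\<lambda>((n0, l0), (n1, l1), (n2, l2)). KK * 2 ^ e n0 l0 n1 l1 n2 l2)"
  define \<rho>' where "\<rho>' = (\<lambda>((n0, l0), (n1, l1), (n2, l2)). \<rho> n0 l0 n1 l1 n2 l2)"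
  define \<iota> where "\<iota> c p = (fN p, fLc c p)" for c p
  have \<iota>m [measurable]: "\<iota> c \<in> measurable borel (count_space UNIV)" for c
  proof -
    have "(\<lambda>p. (i, fLc c p)) \<in> measurable borel (count_space UNIV)" for i :: nat
      by (rule measurable_compose[OF fLc_measurable, of "\<lambda>l. (i, l)"]) simp
    from measurable_compose_countable[where f="\<lambda>i p. (i, fLc c p)", OF this fN_measurable]
    show ?thesis by (simp add: \<iota>_def[abs_def])
  qed
  show ?thesis
  proof (rule dyadic_sum[where \<omega>="\<lambda>t. 2 powr (cw + E t)" and B=B and I=I and \<rho>=\<rho>' and g="\<lambda>r. (2 ^ 15 * 2 powr (cw + A)) * 2 powr (- \<delta> * nrm6 r)"
        and ?\<iota>0.0="\<iota> c0" and ?\<iota>1.0="\<iota> c1" and ?\<iota>2.0="\<iota> c2"])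
    show "(\<iota> c0 p, \<iota> c1 q, \<iota> c2 r) \<in> I" if "(p, q, r) \<in> X" for p q r
      using R[OF that] by (auto simp: I_def \<iota>_def)
    show "WW s0 s1 s2 b0 b1 b2 (p, q, r) \<le> ennreal (2 powr (cw + E (\<iota> c0 p, \<iota> c1 q, \<iota> c2 r)))" for p q r
    proof -
      have "wt s0 b0 p * wt s1 b1 q * wt s2 b2 r \<le> 2 powr (\<bar>s0\<bar> + \<bar>b0\<bar> - s0 * real (fN p) - b0 * real (fLc c0 p)) * 2 powr (\<bar>s1\<bar> + \<bar>b1\<bar> - s1 * real (fN q) - b1 * real (fLc c1 q)) * 2 powr (\<bar>s2\<bar> + \<bar>b2\<bar> - s2 * real (fN r) - b2 * real (fLc c2 r))"
        by (intro mult_mono wt_le c) (auto intro: less_imp_le[OF wt_pos] mult_nonneg_nonneg)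
      also have "\<dots> = 2 powr (cw + E (\<iota> c0 p, \<iota> c1 q, \<iota> c2 r))"
        by (simp add: powr_add[symmetric] cw_def E_def \<iota>_def algebra_simps)
      finally show ?thesis unfolding WW_def by (simp add: ennreal_leI)
    qed
    show "tb {(p, q, r) \<in> X. \<iota> c0 p = i \<and> \<iota> c1 q = j \<and> \<iota> c2 r = k} (ennreal (B (i, j, k)))" if "(i, j, k) \<in> I" for i j k
    proof -
      obtain n0 l0 n1 l1 n2 l2 where ijk: "i = (n0, l0)" "j = (n1, l1)" "k = (n2, l2)" and r: "R n0 l0 n1 l1 n2 l2" using \<open>(i, j, k) \<in> I\<close> by (auto simp: I_def)
      have "{x \<in> space st3. x \<in> X \<and> fN (fst x) = n0 \<and> fLc c0 (fst x) = l0 \<and> fN (fst (snd x)) = n1 \<and> fLc c1 (fst (snd x)) = l1 \<and> fN (snd (snd x)) = n2 \<and> fLc c2 (snd (snd x)) = l2} \<in> sets st3"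
        by measurable
      moreover have "{x \<in> space st3. x \<in> X \<and> fN (fst x) = n0 \<and> fLc c0 (fst x) = l0 \<and> fN (fst (snd x)) = n1 \<and> fLc c1 (fst (snd x)) = l1 \<and> fN (snd (snd x)) = n2 \<and> fLc c2 (snd (snd x)) = l2}
         = {(p, q, r) \<in> X. \<iota> c0 p = i \<and> \<iota> c1 q = j \<and> \<iota> c2 r = k}"
        by (auto simp: space_pair_measure ijk \<iota>_def)
      ultimately have m: "{(p, q, r) \<in> X. \<iota> c0 p = i \<and> \<iota> c1 q = j \<and> \<iota> c2 r = k} \<in> sets st3" by simp
      have "tb {(p, q, r) \<in> X. \<iota> c0 p = i \<and> \<iota> c1 q = j \<and> \<iota> c2 r = k} (ennreal (KK * 2 ^ e n0 l0 n1 l1 n2 l2))"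
        by (rule tb[OF m _ _ _ r]) (use X0 in \<open>auto simp: blk_def ijk \<iota>_def\<close>)
      then show ?thesis by (simp add: B_def ijk)
    qed
    show "2 powr (cw + E t) * sqrt (B t) \<le> (2 ^ 15 * 2 powr (cw + A)) * 2 powr (- \<delta> * nrm6 (\<rho>' t))" if "t \<in> I" for t
    proof -
      obtain n0 l0 n1 l1 n2 l2 where t: "t = ((n0, l0), (n1, l1), (n2, l2))" and r: "R n0 l0 n1 l1 n2 l2" using \<open>t \<in> I\<close> by (auto simp: I_def)
      define ee where "ee = e n0 l0 n1 l1 n2 l2"
      have "sqrt (KK * 2 ^ ee) = 2 ^ 15 * 2 powr (real ee / 2)"
      proof (rule real_sqrt_unique)
        have "(2 powr (real ee / 2))\<^sup>2 = 2 ^ ee" by (simp add: power2_eq_square powr_add[symmetric] powr_realpow)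
        then show "(2 ^ 15 * 2 powr (real ee / 2))\<^sup>2 = KK * 2 ^ ee" by (simp add: power_mult_distrib KK_def)
      qed simp
      then have "2 powr (cw + E t) * sqrt (B t) = 2 ^ 15 * 2 powr (cw + (E t + real ee / 2))"
        by (simp add: B_def t ee_def powr_add)
      also have "\<dots> \<le> 2 ^ 15 * 2 powr (cw + (A - \<delta> * nrm6 (\<rho>' t)))"
        using est[OF r] by (intro mult_left_mono powr_mono) (auto simp: E_def t \<rho>'_def ee_def)
      also have "\<dots> = (2 ^ 15 * 2 powr (cw + A)) * 2 powr (- \<delta> * nrm6 (\<rho>' t))"
        by (simp add: powr_add[symmetric] algebra_simps)
      finally show ?thesis .
    qed
    show "(\<integral>\<^sup>+r. ennreal ((2 ^ 15 * 2 powr (cw + A)) * 2 powr (- \<delta> * nrm6 r)) \<partial>count_space UNIV) < \<infinity>"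
      by (rule geometric_int6_finite[OF \<delta>]) simp
    show "inj_on (\<lambda>t. (\<rho>' t, snd (snd t))) I"
    proof (rule inj_onI)
      fix x y assume "x \<in> I" "y \<in> I" and eq: "(\<rho>' x, snd (snd x)) = (\<rho>' y, snd (snd y))"
      then obtain n0 l0 n1 l1 n2 l2 n0' l0' n1' l1' n2' l2' where x: "x = ((n0, l0), (n1, l1), (n2, l2))" "R n0 l0 n1 l1 n2 l2"
        and y: "y = ((n0', l0'), (n1', l1'), (n2', l2'))" "R n0' l0' n1' l1' n2' l2'" by (auto simp: I_def)
      with eq show "x = y" using inj2[of n0 l0 n1 l1 n2 l2 n0' l0' n1' l1'] by (auto simp: \<rho>'_def)
    qed
    show "inj_on (\<lambda>t. (\<rho>' t, fst t, fst (snd t))) I"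
    proof (rule inj_onI)
      fix x y assume "x \<in> I" "y \<in> I" and eq: "(\<rho>' x, fst x, fst (snd x)) = (\<rho>' y, fst y, fst (snd y))"
      then obtain n0 l0 n1 l1 n2 l2 n0' l0' n1' l1' n2' l2' where x: "x = ((n0, l0), (n1, l1), (n2, l2))" "R n0 l0 n1 l1 n2 l2"
        and y: "y = ((n0', l0'), (n1', l1'), (n2', l2'))" "R n0' l0' n1' l1' n2' l2'" by (auto simp: I_def)
      with eq show "x = y" using inj1[of n0 l0 n1 l1 n2 l2 n2' l2'] by (auto simp: \<rho>'_def)
    qed
  qed (auto simp: B_def KK_def)
qed

text \<open>The flag \<open>P\<close> singles out the sign pattern in which \<open>q\<close> and \<open>r\<close> lie on the same time side.\<close>

definition Om :: "(nat \<Rightarrow> nat \<Rightarrow> nat \<Rightarrow> nat \<Rightarrow> nat \<Rightarrow> nat \<Rightarrow> bool) \<Rightarrow> bool \<Rightarrow> (st \<times> st \<times> st) set" where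
  "Om Q P = {(p, q, r). p + q + r = 0 \<and> (P \<longrightarrow> \<bar>fst p\<bar> = \<bar>fst q\<bar> + \<bar>fst r\<bar>) \<and> Q (fN p) (fL p) (fN q) (fL q) (fN r) (fL r)}"

text \<open>Any predicate on the six indices is allowed because there are only countably many index
  vectors; this settles the measurability of all regions at once.\<close>

lemma index_Collect_sets:
  assumes [measurable]: "f1 \<in> measurable M (count_space UNIV)" "f2 \<in> measurable M (count_space UNIV)" "f3 \<in> measurable M (count_space UNIV)"
    "f4 \<in> measurable M (count_space UNIV)" "f5 \<in> measurable M (count_space UNIV)" "f6 \<in> measurable M (count_space UNIV)"
  shows "{x \<in> space M. Q (f1 x :: nat) (f2 x :: nat) (f3 x :: nat) (f4 x :: nat) (f5 x :: nat) (f6 x :: nat)} \<in> sets M"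
proof -
  define T where "T = {(a, b, c, d, e, f) | a b c d e f. Q a b c d e f}"
  have "(\<Union>t\<in>T. {x \<in> space M. f1 x = fst t \<and> f2 x = fst (snd t) \<and> f3 x = fst (snd (snd t)) \<and> f4 x = fst (snd (snd (snd t))) \<and> f5 x = fst (snd (snd (snd (snd t)))) \<and> f6 x = snd (snd (snd (snd (snd t))))}) \<in> sets M"
  proof (rule sets.countable_UN')
    have "{x \<in> space M. f1 x = fst t \<and> f2 x = fst (snd t) \<and> f3 x = fst (snd (snd t)) \<and> f4 x = fst (snd (snd (snd t))) \<and> f5 x = fst (snd (snd (snd (snd t)))) \<and> f6 x = snd (snd (snd (snd (snd t))))} \<in> sets M" for t
      by measurable
    then show "(\<lambda>t. {x \<in> space M. f1 x = fst t \<and> f2 x = fst (snd t) \<and> f3 x = fst (snd (snd t)) \<and> f4 x = fst (snd (snd (snd t))) \<and> f5 x = fst (snd (snd (snd (snd t)))) \<and> f6 x = snd (snd (snd (snd (snd t))))}) ` T \<subseteq> sets M"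
      by blast
  qed simp
  also have "(\<Union>t\<in>T. {x \<in> space M. f1 x = fst t \<and> f2 x = fst (snd t) \<and> f3 x = fst (snd (snd t)) \<and> f4 x = fst (snd (snd (snd t))) \<and> f5 x = fst (snd (snd (snd (snd t)))) \<and> f6 x = snd (snd (snd (snd (snd t))))})
     = {x \<in> space M. Q (f1 x) (f2 x) (f3 x) (f4 x) (f5 x) (f6 x)}"
    by (auto simp: T_def)
  finally show ?thesis .
qed

lemma Om_sets [measurable]: "Om Q P \<in> sets st3"
proof -
  have A: "{x \<in> space st3. Q (fN (fst x)) (fL (fst x)) (fN (fst (snd x))) (fL (fst (snd x))) (fN (snd (snd x))) (fL (snd (snd x)))} \<in> sets st3"
    by (rule index_Collect_sets) measurable
  have "closed {x::st \<times> st \<times> st. fst x + fst (snd x) + snd (snd x) = 0}"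
    by (intro closed_Collect_eq continuous_intros)
  then have B: "{x::st \<times> st \<times> st. fst x + fst (snd x) + snd (snd x) = 0} \<in> sets st3" unfolding borel_prod by simp
  have "closed {x::st \<times> st \<times> st. \<bar>fst (fst x)\<bar> = \<bar>fst (fst (snd x))\<bar> + \<bar>fst (snd (snd x))\<bar>}"
    by (intro closed_Collect_eq continuous_intros)
  then have C: "{x::st \<times> st \<times> st. \<bar>fst (fst x)\<bar> = \<bar>fst (fst (snd x))\<bar> + \<bar>fst (snd (snd x))\<bar>} \<in> sets st3" unfolding borel_prod by simp
  have "Om Q P = {x \<in> space st3. Q (fN (fst x)) (fL (fst x)) (fN (fst (snd x))) (fL (fst (snd x))) (fN (snd (snd x))) (fL (snd (snd x)))}
      \<inter> {x. fst x + fst (snd x) + snd (snd x) = 0} \<inter> (if P then {x. \<bar>fst (fst x)\<bar> = \<bar>fst (fst (snd x))\<bar> + \<bar>fst (snd (snd x))\<bar>} else UNIV)"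
    by (auto simp: Om_def space_pair_measure)
  also have "\<dots> \<in> sets st3"
  proof (intro sets.Int A B)
    have "UNIV \<in> sets st3" using sets.top[of st3] by (simp add: space_pair_measure)
    then show "(if P then {x. \<bar>fst (fst x)\<bar> = \<bar>fst (fst (snd x))\<bar> + \<bar>fst (snd (snd x))\<bar>} else UNIV) \<in> sets st3" using C by simp
  qed
  finally show ?thesis .
qed

text \<open>Coordinates with zero slack are dropped from the index vector over which the geometric series is summed.\<close>

definition zc :: "real \<Rightarrow> int \<Rightarrow> int" where "zc k t = (if k = 0 then 0 else t)"

text \<open>The lower bound - 20 leaves room for the bounded offsets in the definitions of the
  regions; |t| \<le> t + 40 moves the loss into the constant.\<close>

lemma zc_bound:
  assumes "0 \<le> k" "k = 0 \<or> \<delta> \<le> k" "real_of_int t \<ge> - 20" "\<delta> > 0"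
  shows "- (k * real_of_int t) \<le> 40 * k - \<delta> * \<bar>real_of_int (zc k t)\<bar>"
proof (cases "k = 0")
  case False
  then have "\<delta> \<le> k" "k > 0" using assms by auto
  then have "\<delta> * \<bar>real_of_int t\<bar> \<le> k * \<bar>real_of_int t\<bar>" by (intro mult_right_mono) auto
  moreover have "k * \<bar>real_of_int t\<bar> \<le> k * (real_of_int t + 40)" using assms \<open>k > 0\<close> by (intro mult_left_mono) auto
  ultimately show ?thesis using False by (simp add: zc_def algebra_simps)
qed (simp add: zc_def)

text \<open>This supplies the rate of the geometric series: among finitely many slacks the positive
  ones are bounded away from 0.\<close>

lemma common_lower_bound:
  assumes "\<forall>k\<in>set ks. (0::real) \<le> k"
  shows "\<exists>\<delta>>0. \<forall>k\<in>set ks. k = 0 \<or> \<delta> \<le> k"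
  using assms
proof (induction ks)
  case Nil show ?case by (intro exI[of _ 1]) simp
next
  case (Cons a ks)
  then obtain d where d: "d > 0" "\<forall>k\<in>set ks. k = 0 \<or> d \<le> k" by auto
  show ?case
  proof (cases "a = 0")
    case True with d show ?thesis by auto
  next
    case False
    with Cons.prems d show ?thesis by (intro exI[of _ "min a d"]) (auto simp: min_def)
  qed
qed

text \<open>Here \<open>t0\<close> is a bounded offset without any slack, while \<open>t1, \<dots>, t5\<close> are the coordinates of the cone. A lower dimensional
  cone is covered by taking the remaining coordinates and slacks to be \<open>0\<close>.\<close>

lemma cone5:
  fixes Q :: "nat \<Rightarrow> nat \<Rightarrow> nat \<Rightarrow> nat \<Rightarrow> nat \<Rightarrow> nat \<Rightarrow> bool" and e :: "nat \<Rightarrow> nat \<Rightarrow> nat \<Rightarrow> nat \<Rightarrow> nat \<Rightarrow> nat \<Rightarrow> nat"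
    and t0 t1 t2 t3 t4 t5 :: "nat \<Rightarrow> nat \<Rightarrow> nat \<Rightarrow> nat \<Rightarrow> nat \<Rightarrow> nat \<Rightarrow> int"
    and k1 k2 k3 k4 k5 A s0 s1 s2 b0 b1 b2 :: real
  assumes X: "X \<in> sets st3" and X0: "\<And>p q r. (p, q, r) \<in> X \<Longrightarrow> p + q + r = 0"
    and c: "c0 \<Longrightarrow> b0 = 0" "c1 \<Longrightarrow> b1 = 0" "c2 \<Longrightarrow> b2 = 0"
    and XQ: "\<And>p q r. (p, q, r) \<in> X \<Longrightarrow> Q (fN p) (fLc c0 p) (fN q) (fLc c1 q) (fN r) (fLc c2 r)"
    and k: "k1 \<ge> 0" "k2 \<ge> 0" "k3 \<ge> 0" "k4 \<ge> 0" "k5 \<ge> 0"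
    and t: "\<And>n0 l0 n1 l1 n2 l2. Q n0 l0 n1 l1 n2 l2 \<Longrightarrow> \<bar>t0 n0 l0 n1 l1 n2 l2\<bar> \<le> 20 \<and>
      - 20 \<le> t1 n0 l0 n1 l1 n2 l2 \<and> - 20 \<le> t2 n0 l0 n1 l1 n2 l2 \<and> - 20 \<le> t3 n0 l0 n1 l1 n2 l2 \<and> - 20 \<le> t4 n0 l0 n1 l1 n2 l2 \<and> - 20 \<le> t5 n0 l0 n1 l1 n2 l2"
    and tb: "\<And>Y n0 l0 n1 l1 n2 l2. Y \<in> sets st3 \<Longrightarrow> Y \<subseteq> X \<Longrightarrow> Y \<subseteq> blk n0 n1 n2 \<Longrightarrow>
       (\<And>p q r. (p, q, r) \<in> Y \<Longrightarrow> fLc c0 p = l0 \<and> fLc c1 q = l1 \<and> fLc c2 r = l2) \<Longrightarrow> Q n0 l0 n1 l1 n2 l2 \<Longrightarrow>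
       tb Y (ennreal (KK * 2 ^ e n0 l0 n1 l1 n2 l2))"
    and est: "\<And>n0 l0 n1 l1 n2 l2. Q n0 l0 n1 l1 n2 l2 \<Longrightarrow>
       - s0 * n0 - s1 * n1 - s2 * n2 - b0 * l0 - b1 * l1 - b2 * l2 + e n0 l0 n1 l1 n2 l2 / 2 \<le> A - k1 * t1 n0 l0 n1 l1 n2 l2
         - k2 * t2 n0 l0 n1 l1 n2 l2 - k3 * t3 n0 l0 n1 l1 n2 l2 - k4 * t4 n0 l0 n1 l1 n2 l2 - k5 * t5 n0 l0 n1 l1 n2 l2"
    and inj2: "\<And>n0 l0 n1 l1 n2 l2 n0' l0' n1' l1'. Q n0 l0 n1 l1 n2 l2 \<Longrightarrow> Q n0' l0' n1' l1' n2 l2 \<Longrightarrow>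
       t0 n0 l0 n1 l1 n2 l2 = t0 n0' l0' n1' l1' n2 l2 \<Longrightarrow> k1 = 0 \<or> t1 n0 l0 n1 l1 n2 l2 = t1 n0' l0' n1' l1' n2 l2 \<Longrightarrow>
       k2 = 0 \<or> t2 n0 l0 n1 l1 n2 l2 = t2 n0' l0' n1' l1' n2 l2 \<Longrightarrow> k3 = 0 \<or> t3 n0 l0 n1 l1 n2 l2 = t3 n0' l0' n1' l1' n2 l2 \<Longrightarrow>
       k4 = 0 \<or> t4 n0 l0 n1 l1 n2 l2 = t4 n0' l0' n1' l1' n2 l2 \<Longrightarrow> k5 = 0 \<or> t5 n0 l0 n1 l1 n2 l2 = t5 n0' l0' n1' l1' n2 l2 \<Longrightarrow>
       n0 = n0' \<and> l0 = l0' \<and> n1 = n1' \<and> l1 = l1'"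
    and inj1: "\<And>n0 l0 n1 l1 n2 l2 n2' l2'. Q n0 l0 n1 l1 n2 l2 \<Longrightarrow> Q n0 l0 n1 l1 n2' l2' \<Longrightarrow>
       t0 n0 l0 n1 l1 n2 l2 = t0 n0 l0 n1 l1 n2' l2' \<Longrightarrow> k1 = 0 \<or> t1 n0 l0 n1 l1 n2 l2 = t1 n0 l0 n1 l1 n2' l2' \<Longrightarrow>
       k2 = 0 \<or> t2 n0 l0 n1 l1 n2 l2 = t2 n0 l0 n1 l1 n2' l2' \<Longrightarrow> k3 = 0 \<or> t3 n0 l0 n1 l1 n2 l2 = t3 n0 l0 n1 l1 n2' l2' \<Longrightarrow>
       k4 = 0 \<or> t4 n0 l0 n1 l1 n2 l2 = t4 n0 l0 n1 l1 n2' l2' \<Longrightarrow> k5 = 0 \<or> t5 n0 l0 n1 l1 n2 l2 = t5 n0 l0 n1 l1 n2' l2' \<Longrightarrow>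
       n2 = n2' \<and> l2 = l2'"
  shows "kb (\<lambda>x. indicator X x * WW s0 s1 s2 b0 b1 b2 x)"
proof -
  have "\<forall>k\<in>set [k1, k2, k3, k4, k5]. 0 \<le> k" using k by simp
  from common_lower_bound[OF this] obtain \<delta> where \<delta>: "\<delta> > 0" "\<forall>k\<in>set [k1, k2, k3, k4, k5]. k = 0 \<or> \<delta> \<le> k" by blast
  define \<rho> where "\<rho> n0 l0 n1 l1 n2 l2 = (t0 n0 l0 n1 l1 n2 l2, zc k1 (t1 n0 l0 n1 l1 n2 l2), zc k2 (t2 n0 l0 n1 l1 n2 l2),
     zc k3 (t3 n0 l0 n1 l1 n2 l2), zc k4 (t4 n0 l0 n1 l1 n2 l2), zc k5 (t5 n0 l0 n1 l1 n2 l2))" for n0 l0 n1 l1 n2 l2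
  have zc: "zc k t = zc k t' \<Longrightarrow> k = 0 \<or> t = t'" for k t t' by (auto simp: zc_def split: if_splits)
  show ?thesis
  proof (rule cone_kb[where R=Q and \<rho>=\<rho> and e=e and \<delta>=\<delta> and A="A + 40 * (k1 + k2 + k3 + k4 + k5) + 20 * \<delta>", OF X X0 c XQ tb])
    fix n0 l0 n1 l1 n2 l2 assume q: "Q n0 l0 n1 l1 n2 l2"
    note tt = t[OF q]
    have t0: "\<delta> * \<bar>real_of_int (t0 n0 l0 n1 l1 n2 l2)\<bar> \<le> \<delta> * 20" using tt \<delta>(1) by (intro mult_left_mono) linarith+
    have z: "- (k1 * real_of_int (t1 n0 l0 n1 l1 n2 l2)) \<le> 40 * k1 - \<delta> * \<bar>real_of_int (zc k1 (t1 n0 l0 n1 l1 n2 l2))\<bar>"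
      "- (k2 * real_of_int (t2 n0 l0 n1 l1 n2 l2)) \<le> 40 * k2 - \<delta> * \<bar>real_of_int (zc k2 (t2 n0 l0 n1 l1 n2 l2))\<bar>"
      "- (k3 * real_of_int (t3 n0 l0 n1 l1 n2 l2)) \<le> 40 * k3 - \<delta> * \<bar>real_of_int (zc k3 (t3 n0 l0 n1 l1 n2 l2))\<bar>"
      "- (k4 * real_of_int (t4 n0 l0 n1 l1 n2 l2)) \<le> 40 * k4 - \<delta> * \<bar>real_of_int (zc k4 (t4 n0 l0 n1 l1 n2 l2))\<bar>"
      "- (k5 * real_of_int (t5 n0 l0 n1 l1 n2 l2)) \<le> 40 * k5 - \<delta> * \<bar>real_of_int (zc k5 (t5 n0 l0 n1 l1 n2 l2))\<bar>"
      using tt \<delta> k by (auto intro!: zc_bound)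
    show "- s0 * n0 - s1 * n1 - s2 * n2 - b0 * l0 - b1 * l1 - b2 * l2 + e n0 l0 n1 l1 n2 l2 / 2 \<le> A + 40 * (k1 + k2 + k3 + k4 + k5) + 20 * \<delta> - \<delta> * nrm6 (\<rho> n0 l0 n1 l1 n2 l2)"
      using est[OF q] t0 z unfolding \<rho>_def nrm6.simps of_int_add of_int_abs distrib_left by linarith
  next
    show "n0 = n0' \<and> l0 = l0' \<and> n1 = n1' \<and> l1 = l1'" if "Q n0 l0 n1 l1 n2 l2" "Q n0' l0' n1' l1' n2 l2" "\<rho> n0 l0 n1 l1 n2 l2 = \<rho> n0' l0' n1' l1' n2 l2"
      for n0 l0 n1 l1 n2 l2 n0' l0' n1' l1'
      using that(3) unfolding \<rho>_def by (intro inj2[OF that(1,2)] zc) auto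
    show "n2 = n2' \<and> l2 = l2'" if "Q n0 l0 n1 l1 n2 l2" "Q n0 l0 n1 l1 n2' l2'" "\<rho> n0 l0 n1 l1 n2 l2 = \<rho> n0 l0 n1 l1 n2' l2'"
      for n0 l0 n1 l1 n2 l2 n2' l2'
      using that(3) unfolding \<rho>_def by (intro inj1[OF that(1,2)] zc) auto
  qed (use \<delta> in auto)
qed

lemma Om_D: "(p, q, r) \<in> Om Q P \<Longrightarrow> p + q + r = 0 \<and> (P \<longrightarrow> \<bar>fst p\<bar> = \<bar>fst q\<bar> + \<bar>fst r\<bar>) \<and> Q (fN p) (fL p) (fN q) (fL q) (fN r) (fL r)"
  by (simp add: Om_def)

lemma fLc_False [simp]: "fLc False p = fL p" by (simp add: fLc_def)

text \<open>The normal form after permuting the variables: the first frequency is the lowest, and of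
  the other two factors the third has the larger modulation. The offset 1 is that of
  \<open>fN_triangle\<close>.\<close>

definition base :: "nat \<Rightarrow> nat \<Rightarrow> nat \<Rightarrow> nat \<Rightarrow> nat \<Rightarrow> bool" where
  "base n0 n1 n2 l1 l2 \<longleftrightarrow> n0 \<le> n1 \<and> n0 \<le> n2 \<and> n1 \<le> n2 + 1 \<and> n2 \<le> n1 + 1 \<and> l1 \<le> l2"

text \<open>Read \<open>zi\<close> as: the i-th slack is zero, and \<open>ai\<close> as: the i-th
  coordinates of two index vectors agree. A coordinate is only recorded if its slack is positive; so
  if no two slacks vanish, all coordinates but one agree.\<close>

lemma at_most_one5:
  assumes "z1 \<or> a1" "z2 \<or> a2" "z3 \<or> a3" "z4 \<or> a4" "z5 \<or> a5"
    and "\<not> z1 \<or> \<not> z2" "\<not> z1 \<or> \<not> z3" "\<not> z1 \<or> \<not> z4" "\<not> z1 \<or> \<not> z5" "\<not> z2 \<or> \<not> z3"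
      "\<not> z2 \<or> \<not> z4" "\<not> z2 \<or> \<not> z5" "\<not> z3 \<or> \<not> z4" "\<not> z3 \<or> \<not> z5" "\<not> z4 \<or> \<not> z5"
  shows "a2 \<and> a3 \<and> a4 \<and> a5 \<or> a1 \<and> a3 \<and> a4 \<and> a5 \<or> a1 \<and> a2 \<and> a4 \<and> a5 \<or> a1 \<and> a2 \<and> a3 \<and> a5 \<or> a1 \<and> a2 \<and> a3 \<and> a4"
  using assms by argo

lemma at_most_one4:
  assumes "z1 \<or> a1" "z2 \<or> a2" "z3 \<or> a3" "z4 \<or> a4"
    and "\<not> z1 \<or> \<not> z2" "\<not> z1 \<or> \<not> z3" "\<not> z1 \<or> \<not> z4" "\<not> z2 \<or> \<not> z3" "\<not> z2 \<or> \<not> z4" "\<not> z3 \<or> \<not> z4"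
  shows "a2 \<and> a3 \<and> a4 \<or> a1 \<and> a3 \<and> a4 \<or> a1 \<and> a2 \<and> a4 \<or> a1 \<and> a2 \<and> a3"
  using assms by argo

text \<open>The slacks 1 and 2, or 2 and 3, may vanish together; two coordinates are then still
  known to agree.\<close>

lemma two_zero_a:
  assumes "z1 \<or> a1" "z2 \<or> a2" "z3 \<or> a3" "z4 \<or> a4"
    and "\<not> z1 \<or> \<not> z3" "\<not> z1 \<or> \<not> z4" "\<not> z3 \<or> \<not> z4" "\<not> z2 \<or> \<not> z4"
  shows "a3 \<and> a4 \<or> a1 \<and> a4 \<or> a1 \<and> a2 \<and> a3"
  using assms by argo

text \<open>The pairs that may vanish together are 1 and 3, 2 and 3, 2 and 4.\<close>

lemma two_zero_b:
  assumes "z1 \<or> a1" "z2 \<or> a2" "z3 \<or> a3" "z4 \<or> a4"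
    and "\<not> z1 \<or> \<not> z2" "\<not> z3 \<or> \<not> z4" "\<not> z1 \<or> \<not> z4"
  shows "a2 \<and> a4 \<or> a1 \<and> a4 \<or> a1 \<and> a3"
  using assms by argo

text \<open>The only pair that may vanish together is 2 and 4.\<close>

lemma two_zero_c:
  assumes "z1 \<or> a1" "z2 \<or> a2" "z3 \<or> a3" "z4 \<or> a4"
    and "\<not> z1 \<or> \<not> z2" "\<not> z1 \<or> \<not> z3" "\<not> z1 \<or> \<not> z4" "\<not> z2 \<or> \<not> z3" "\<not> z3 \<or> \<not> z4"
  shows "a2 \<and> a3 \<and> a4 \<or> a1 \<and> a3 \<or> a1 \<and> a2 \<and> a4"
  using assms by argo

lemma offset_mult_le: "\<bar>x - y\<bar> \<le> c \<Longrightarrow> - (b * x) \<le> c * \<bar>b\<bar> - b * y" for x y b c :: real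
proof -
  assume "\<bar>x - y\<bar> \<le> c"
  then have "\<bar>b\<bar> * \<bar>x - y\<bar> \<le> \<bar>b\<bar> * c" by (intro mult_left_mono) auto
  then have "\<bar>b * (x - y)\<bar> \<le> \<bar>b\<bar> * c" by (simp add: abs_mult)
  then show ?thesis by (simp add: algebra_simps)
qed

lemma offset_bound2: "n1 \<le> n2 + 1 \<Longrightarrow> n2 \<le> n1 + 1 \<Longrightarrow> - (s2 * real n2) \<le> \<bar>s2\<bar> - s2 * real n1" for n1 n2 :: nat
  using offset_mult_le[of "real n2" "real n1" 1 s2] by simp

lemma off_bound: "base n0 n1 n2 l1 l2 \<Longrightarrow> - (s2 * real n2) \<le> \<bar>s2\<bar> - s2 * real n1"
  by (rule offset_bound2) (auto simp: base_def)

subsection \<open>The cones of dyadic indices\<close>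

text \<open>The volume bound in l1 and l2 is at most the one in l0 and l1 exactly when n1 + l2 \<le>
  n0 + l0, which is the condition cutting out this cone. The ray on which only the third coordinate
  is nonzero is n0 = l0 = t, n1 = n2 = 2 t, with the slack of \<open>C13\<close>.\<close>

lemma cone_alpha:
  fixes s0 s1 s2 b0 b1 b2 :: real
  defines "k5 \<equiv> s0 + s1 + s2 + b0 + b1 + b2 - 2" and "k7 \<equiv> s0 + s1 + s2 + b0 + b2 - 3/2" and "k13 \<equiv> s0 + b0 + 2 * s1 + 2 * s2 - 3/2" and "k9 \<equiv> s0 + s1 + s2 + b0 - 1" and "k12 \<equiv> s0 + s1 + s2 - 1"
  assumes k: "k5 \<ge> 0" "k7 \<ge> 0" "k13 \<ge> 0" "k9 \<ge> 0" "k12 \<ge> 0"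
    and ex: "k5 \<noteq> 0 \<or> k7 \<noteq> 0" "k5 \<noteq> 0 \<or> k13 \<noteq> 0" "k5 \<noteq> 0 \<or> k9 \<noteq> 0" "k5 \<noteq> 0 \<or> k12 \<noteq> 0" "k7 \<noteq> 0 \<or> k13 \<noteq> 0" "k7 \<noteq> 0 \<or> k9 \<noteq> 0" "k7 \<noteq> 0 \<or> k12 \<noteq> 0" "k13 \<noteq> 0 \<or> k9 \<noteq> 0" "k13 \<noteq> 0 \<or> k12 \<noteq> 0" "k9 \<noteq> 0 \<or> k12 \<noteq> 0"
  shows "kb (\<lambda>x. indicator (Om (\<lambda>n0 l0 n1 l1 n2 l2. base n0 n1 n2 l1 l2 \<and> n1 + l2 \<le> n0 + l0 \<and> l0 \<le> n0 + 10) False) x * WW s0 s1 s2 b0 b1 b2 x)"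
proof (rule cone5[where ?c0.0=False and ?c1.0=False and ?c2.0=False and ?k1.0="k5" and ?k2.0="k7" and ?k3.0="k13" and ?k4.0="k9" and ?k5.0="k12"
    and Q="\<lambda>n0 l0 n1 l1 n2 l2. base n0 n1 n2 l1 l2 \<and> n1 + l2 \<le> n0 + l0 \<and> l0 \<le> n0 + 10" and e="\<lambda>n0 l0 n1 l1 n2 l2. n0 + n1 + l1 + l2"
    and ?t0.0="\<lambda>n0 l0 n1 l1 n2 l2. int n2 - int n1" and ?t1.0="\<lambda>n0 l0 n1 l1 n2 l2. int l1" and ?t2.0="\<lambda>n0 l0 n1 l1 n2 l2. int l2 - int l1" and ?t3.0="\<lambda>n0 l0 n1 l1 n2 l2. int n1 - int n0" and ?t4.0="\<lambda>n0 l0 n1 l1 n2 l2. int n0 + int l0 - int n1 - int l2" and ?t5.0="\<lambda>n0 l0 n1 l1 n2 l2. int n0 - int l0"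
    and A="\<bar>s2\<bar>"], goal_cases)
  case (13 Y n0 l0 n1 l1 n2 l2)
  then show ?case by (intro blk_A12) (auto simp: base_def blk_def dest: Om_D)
next
  case (14 n0 l0 n1 l1 n2 l2)
  then have "- (s2 * real n2) \<le> \<bar>s2\<bar> - s2 * real n1" by (auto intro: off_bound offset_bound2)
  then show ?case using 14 unfolding k5_def k7_def k13_def k9_def k12_def by (simp add: field_simps base_def)
next
  case (15 n0 l0 n1 l1 n2 l2 n0' l0' n1' l1')
  show ?case using at_most_one5[OF 15(4-8) ex] 15(3) by (elim disjE) simp_all
next
  case (16 n0 l0 n1 l1 n2 l2 n2' l2')
  show ?case using at_most_one5[OF 16(4-8) ex] 16(3) by (elim disjE) simp_all
qed (use k in \<open>auto dest: Om_D simp: base_def fLc_def\<close>)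

text \<open>On the other side of the wall n1 + l2 = n0 + l0 the bound in l0 and l1 takes over. The
  last coordinate is the distance from the wall; along its ray only n1 and n2 move, with slack s1 +
  s2.\<close>

lemma cone_beta1:
  fixes s0 s1 s2 b0 b1 b2 :: real
  defines "k5 \<equiv> s0 + s1 + s2 + b0 + b1 + b2 - 2" and "k7 \<equiv> s0 + s1 + s2 + b0 + b2 - 3/2" and "k13 \<equiv> s0 + b0 + 2 * s1 + 2 * s2 - 3/2" and "k12 \<equiv> s0 + s1 + s2 - 1" and "k19 \<equiv> s1 + s2"
  assumes k: "k5 \<ge> 0" "k7 \<ge> 0" "k13 \<ge> 0" "k12 \<ge> 0" "k19 \<ge> 0"
    and ex: "k5 \<noteq> 0 \<or> k7 \<noteq> 0" "k5 \<noteq> 0 \<or> k13 \<noteq> 0" "k5 \<noteq> 0 \<or> k12 \<noteq> 0" "k5 \<noteq> 0 \<or> k19 \<noteq> 0" "k7 \<noteq> 0 \<or> k13 \<noteq> 0" "k7 \<noteq> 0 \<or> k12 \<noteq> 0" "k7 \<noteq> 0 \<or> k19 \<noteq> 0" "k13 \<noteq> 0 \<or> k12 \<noteq> 0" "k13 \<noteq> 0 \<or> k19 \<noteq> 0" "k12 \<noteq> 0 \<or> k19 \<noteq> 0"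
  shows "kb (\<lambda>x. indicator (Om (\<lambda>n0 l0 n1 l1 n2 l2. base n0 n1 n2 l1 l2 \<and> l2 \<le> l0 \<and> n0 + l0 \<le> n1 + l2 \<and> l0 \<le> n0 + 10) False) x * WW s0 s1 s2 b0 b1 b2 x)"
proof (rule cone5[where ?c0.0=False and ?c1.0=False and ?c2.0=False and ?k1.0="k5" and ?k2.0="k7" and ?k3.0="k13" and ?k4.0="k12" and ?k5.0="k19"
    and Q="\<lambda>n0 l0 n1 l1 n2 l2. base n0 n1 n2 l1 l2 \<and> l2 \<le> l0 \<and> n0 + l0 \<le> n1 + l2 \<and> l0 \<le> n0 + 10" and e="\<lambda>n0 l0 n1 l1 n2 l2. 2 * n0 + l0 + l1"
    and ?t0.0="\<lambda>n0 l0 n1 l1 n2 l2. int n2 - int n1" and ?t1.0="\<lambda>n0 l0 n1 l1 n2 l2. int l1" and ?t2.0="\<lambda>n0 l0 n1 l1 n2 l2. int l2 - int l1" and ?t3.0="\<lambda>n0 l0 n1 l1 n2 l2. int l0 - int l2" and ?t4.0="\<lambda>n0 l0 n1 l1 n2 l2. int n0 - int l0" and ?t5.0="\<lambda>n0 l0 n1 l1 n2 l2. int n1 - int n0 - int l0 + int l2"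
    and A="\<bar>s2\<bar>"], goal_cases)
  case (13 Y n0 l0 n1 l1 n2 l2)
  then show ?case by (intro blk_A01) (auto simp: base_def blk_def dest: Om_D)
next
  case (14 n0 l0 n1 l1 n2 l2)
  then have "- (s2 * real n2) \<le> \<bar>s2\<bar> - s2 * real n1" by (auto intro: off_bound offset_bound2)
  then show ?case using 14 unfolding k5_def k7_def k13_def k12_def k19_def by (simp add: field_simps base_def)
next
  case (15 n0 l0 n1 l1 n2 l2 n0' l0' n1' l1')
  show ?case using at_most_one5[OF 15(4-8) ex] 15(3) by (elim disjE) simp_all
next
  case (16 n0 l0 n1 l1 n2 l2 n2' l2')
  show ?case using at_most_one5[OF 16(4-8) ex] 16(3) by (elim disjE) simp_all
qed (use k in \<open>auto dest: Om_D simp: base_def fLc_def\<close>)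

text \<open>Now l2 is the largest modulation, so the bound in the two smaller ones l0 and l1 is
  used. Their order decides between this cone and the next.\<close>

lemma cone_beta2:
  fixes s0 s1 s2 b0 b1 b2 :: real
  defines "k5 \<equiv> s0 + s1 + s2 + b0 + b1 + b2 - 2" and "k7 \<equiv> s0 + s1 + s2 + b0 + b2 - 3/2" and "k11 \<equiv> s0 + s1 + s2 + b2 - 1" and "k12 \<equiv> s0 + s1 + s2 - 1" and "k19 \<equiv> s1 + s2"
  assumes k: "k5 \<ge> 0" "k7 \<ge> 0" "k11 \<ge> 0" "k12 \<ge> 0" "k19 \<ge> 0"
    and ex: "k5 \<noteq> 0 \<or> k7 \<noteq> 0" "k5 \<noteq> 0 \<or> k11 \<noteq> 0" "k5 \<noteq> 0 \<or> k12 \<noteq> 0" "k5 \<noteq> 0 \<or> k19 \<noteq> 0" "k7 \<noteq> 0 \<or> k11 \<noteq> 0" "k7 \<noteq> 0 \<or> k12 \<noteq> 0" "k7 \<noteq> 0 \<or> k19 \<noteq> 0" "k11 \<noteq> 0 \<or> k12 \<noteq> 0" "k11 \<noteq> 0 \<or> k19 \<noteq> 0" "k12 \<noteq> 0 \<or> k19 \<noteq> 0"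
  shows "kb (\<lambda>x. indicator (Om (\<lambda>n0 l0 n1 l1 n2 l2. base n0 n1 n2 l1 l2 \<and> l1 \<le> l0 \<and> l0 \<le> l2 \<and> l2 \<le> n0 + 10) False) x * WW s0 s1 s2 b0 b1 b2 x)"
proof (rule cone5[where ?c0.0=False and ?c1.0=False and ?c2.0=False and ?k1.0="k5" and ?k2.0="k7" and ?k3.0="k11" and ?k4.0="k12" and ?k5.0="k19"
    and Q="\<lambda>n0 l0 n1 l1 n2 l2. base n0 n1 n2 l1 l2 \<and> l1 \<le> l0 \<and> l0 \<le> l2 \<and> l2 \<le> n0 + 10" and e="\<lambda>n0 l0 n1 l1 n2 l2. 2 * n0 + l0 + l1"
    and ?t0.0="\<lambda>n0 l0 n1 l1 n2 l2. int n2 - int n1" and ?t1.0="\<lambda>n0 l0 n1 l1 n2 l2. int l1" and ?t2.0="\<lambda>n0 l0 n1 l1 n2 l2. int l0 - int l1" and ?t3.0="\<lambda>n0 l0 n1 l1 n2 l2. int l2 - int l0" and ?t4.0="\<lambda>n0 l0 n1 l1 n2 l2. int n0 - int l2" and ?t5.0="\<lambda>n0 l0 n1 l1 n2 l2. int n1 - int n0"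
    and A="\<bar>s2\<bar>"], goal_cases)
  case (13 Y n0 l0 n1 l1 n2 l2)
  then show ?case by (intro blk_A01) (auto simp: base_def blk_def dest: Om_D)
next
  case (14 n0 l0 n1 l1 n2 l2)
  then have "- (s2 * real n2) \<le> \<bar>s2\<bar> - s2 * real n1" by (auto intro: off_bound offset_bound2)
  then show ?case using 14 unfolding k5_def k7_def k11_def k12_def k19_def by (simp add: field_simps base_def)
next
  case (15 n0 l0 n1 l1 n2 l2 n0' l0' n1' l1')
  show ?case using at_most_one5[OF 15(4-8) ex] 15(3) by (elim disjE) simp_all
next
  case (16 n0 l0 n1 l1 n2 l2 n2' l2')
  show ?case using at_most_one5[OF 16(4-8) ex] 16(3) by (elim disjE) simp_all
qed (use k in \<open>auto dest: Om_D simp: base_def fLc_def\<close>)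

lemma cone_beta3:
  fixes s0 s1 s2 b0 b1 b2 :: real
  defines "k5 \<equiv> s0 + s1 + s2 + b0 + b1 + b2 - 2" and "k8 \<equiv> s0 + s1 + s2 + b1 + b2 - 3/2" and "k11 \<equiv> s0 + s1 + s2 + b2 - 1" and "k12 \<equiv> s0 + s1 + s2 - 1" and "k19 \<equiv> s1 + s2"
  assumes k: "k5 \<ge> 0" "k8 \<ge> 0" "k11 \<ge> 0" "k12 \<ge> 0" "k19 \<ge> 0"
    and ex: "k5 \<noteq> 0 \<or> k8 \<noteq> 0" "k5 \<noteq> 0 \<or> k11 \<noteq> 0" "k5 \<noteq> 0 \<or> k12 \<noteq> 0" "k5 \<noteq> 0 \<or> k19 \<noteq> 0" "k8 \<noteq> 0 \<or> k11 \<noteq> 0" "k8 \<noteq> 0 \<or> k12 \<noteq> 0" "k8 \<noteq> 0 \<or> k19 \<noteq> 0" "k11 \<noteq> 0 \<or> k12 \<noteq> 0" "k11 \<noteq> 0 \<or> k19 \<noteq> 0" "k12 \<noteq> 0 \<or> k19 \<noteq> 0"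
  shows "kb (\<lambda>x. indicator (Om (\<lambda>n0 l0 n1 l1 n2 l2. base n0 n1 n2 l1 l2 \<and> l0 \<le> l1 \<and> l2 \<le> n0 + 10) False) x * WW s0 s1 s2 b0 b1 b2 x)"
proof (rule cone5[where ?c0.0=False and ?c1.0=False and ?c2.0=False and ?k1.0="k5" and ?k2.0="k8" and ?k3.0="k11" and ?k4.0="k12" and ?k5.0="k19"
    and Q="\<lambda>n0 l0 n1 l1 n2 l2. base n0 n1 n2 l1 l2 \<and> l0 \<le> l1 \<and> l2 \<le> n0 + 10" and e="\<lambda>n0 l0 n1 l1 n2 l2. 2 * n0 + l0 + l1"
    and ?t0.0="\<lambda>n0 l0 n1 l1 n2 l2. int n2 - int n1" and ?t1.0="\<lambda>n0 l0 n1 l1 n2 l2. int l0" and ?t2.0="\<lambda>n0 l0 n1 l1 n2 l2. int l1 - int l0" and ?t3.0="\<lambda>n0 l0 n1 l1 n2 l2. int l2 - int l1" and ?t4.0="\<lambda>n0 l0 n1 l1 n2 l2. int n0 - int l2" and ?t5.0="\<lambda>n0 l0 n1 l1 n2 l2. int n1 - int n0"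
    and A="\<bar>s2\<bar>"], goal_cases)
  case (13 Y n0 l0 n1 l1 n2 l2)
  then show ?case by (intro blk_A01) (auto simp: base_def blk_def dest: Om_D)
next
  case (14 n0 l0 n1 l1 n2 l2)
  then have "- (s2 * real n2) \<le> \<bar>s2\<bar> - s2 * real n1" by (auto intro: off_bound offset_bound2)
  then show ?case using 14 unfolding k5_def k8_def k11_def k12_def k19_def by (simp add: field_simps base_def)
next
  case (15 n0 l0 n1 l1 n2 l2 n0' l0' n1' l1')
  show ?case using at_most_one5[OF 15(4-8) ex] 15(3) by (elim disjE) simp_all
next
  case (16 n0 l0 n1 l1 n2 l2 n2' l2')
  show ?case using at_most_one5[OF 16(4-8) ex] 16(3) by (elim disjE) simp_all
qed (use k in \<open>auto dest: Om_D simp: base_def fLc_def\<close>)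

text \<open>The modulations l1 and l2 are large, equal up to a bounded offset, so only l0 enters the
  volume bound. The difference l1 - l2 is bounded; the artificial slack 1 keeps it in the index
  vector at the price of a constant. Along l2 - n0 both modulations move, so this ray stays summable
  even if b1 + b2 = 0.\<close>

lemma cone_b12a:
  fixes s0 s1 s2 b0 b1 b2 :: real
  defines "k19 \<equiv> s1 + s2" and "kb12 \<equiv> b1 + b2" and "k8 \<equiv> s0 + s1 + s2 + b1 + b2 - 3/2" and "k5 \<equiv> s0 + s1 + s2 + b0 + b1 + b2 - 2"
  assumes k: "k19 \<ge> 0" "kb12 \<ge> 0" "k8 \<ge> 0" "k5 \<ge> 0"
    and ex: "k19 \<noteq> 0 \<or> k8 \<noteq> 0" "k19 \<noteq> 0 \<or> k5 \<noteq> 0" "k8 \<noteq> 0 \<or> k5 \<noteq> 0" "kb12 \<noteq> 0 \<or> k5 \<noteq> 0"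
  shows "kb (\<lambda>x. indicator (Om (\<lambda>n0 l0 n1 l1 n2 l2. base n0 n1 n2 l1 l2 \<and> l2 \<le> l1 + 10 \<and> l0 \<le> n0 \<and> n0 \<le> l2) False) x * WW s0 s1 s2 b0 b1 b2 x)"
proof (rule cone5[where ?c0.0=False and ?c1.0=False and ?c2.0=False and ?k1.0="k19" and ?k2.0="kb12" and ?k3.0="k8" and ?k4.0="k5" and ?k5.0="1"
    and Q="\<lambda>n0 l0 n1 l1 n2 l2. base n0 n1 n2 l1 l2 \<and> l2 \<le> l1 + 10 \<and> l0 \<le> n0 \<and> n0 \<le> l2" and e="\<lambda>n0 l0 n1 l1 n2 l2. 3 * n0 + l0"
    and ?t0.0="\<lambda>n0 l0 n1 l1 n2 l2. int n2 - int n1" and ?t1.0="\<lambda>n0 l0 n1 l1 n2 l2. int n1 - int n0" and ?t2.0="\<lambda>n0 l0 n1 l1 n2 l2. int l2 - int n0" and ?t3.0="\<lambda>n0 l0 n1 l1 n2 l2. int n0 - int l0" and ?t4.0="\<lambda>n0 l0 n1 l1 n2 l2. int l0" and ?t5.0="\<lambda>n0 l0 n1 l1 n2 l2. int l1 - int l2"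
    and A="\<bar>s2\<bar> + 10 * \<bar>b1\<bar>"], goal_cases)
  case (13 Y n0 l0 n1 l1 n2 l2)
  then show ?case by (intro blk_V(1)) (auto simp: base_def blk_def dest: Om_D)
next
  case (14 n0 l0 n1 l1 n2 l2)
  then have "- (s2 * real n2) \<le> \<bar>s2\<bar> - s2 * real n1" by (auto intro: off_bound offset_bound2)
  moreover from 14 have "- (b1 * real l1) \<le> 10 * \<bar>b1\<bar> - b1 * real l2" by (intro offset_mult_le) (auto simp: base_def)
  ultimately show ?case using 14 unfolding k19_def kb12_def k8_def k5_def by (simp add: field_simps base_def)
next
  case (15 n0 l0 n1 l1 n2 l2 n0' l0' n1' l1')
  show ?case using two_zero_a[OF 15(4-7) ex] 15(3,8) by (elim disjE) simp_all
next
  case (16 n0 l0 n1 l1 n2 l2 n2' l2')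
  show ?case using two_zero_a[OF 16(4-7) ex] 16(3,8) by (elim disjE) simp_all
qed (use k in \<open>auto dest: Om_D simp: base_def fLc_def\<close>)

text \<open>When l0 exceeds n0, the ray along l0 - n0 moves all three modulations and has the slack
  of \<open>C1\<close>. That this slack and b1 + b2 do not both vanish is the content of
  \<open>R1\<close> here.\<close>

lemma cone_b12b:
  fixes s0 s1 s2 b0 b1 b2 :: real
  defines "k5 \<equiv> s0 + s1 + s2 + b0 + b1 + b2 - 2" and "k19 \<equiv> s1 + s2" and "k1 \<equiv> b0 + b1 + b2 - 1/2" and "kb12 \<equiv> b1 + b2"
  assumes k: "k5 \<ge> 0" "k19 \<ge> 0" "k1 \<ge> 0" "kb12 \<ge> 0"
    and ex: "k5 \<noteq> 0 \<or> k19 \<noteq> 0" "k1 \<noteq> 0 \<or> kb12 \<noteq> 0" "k5 \<noteq> 0 \<or> kb12 \<noteq> 0"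
  shows "kb (\<lambda>x. indicator (Om (\<lambda>n0 l0 n1 l1 n2 l2. base n0 n1 n2 l1 l2 \<and> l2 \<le> l1 + 10 \<and> n0 \<le> l0 \<and> l0 \<le> l2) False) x * WW s0 s1 s2 b0 b1 b2 x)"
proof (rule cone5[where ?c0.0=False and ?c1.0=False and ?c2.0=False and ?k1.0="k5" and ?k2.0="k19" and ?k3.0="k1" and ?k4.0="kb12" and ?k5.0="1"
    and Q="\<lambda>n0 l0 n1 l1 n2 l2. base n0 n1 n2 l1 l2 \<and> l2 \<le> l1 + 10 \<and> n0 \<le> l0 \<and> l0 \<le> l2" and e="\<lambda>n0 l0 n1 l1 n2 l2. 3 * n0 + l0"
    and ?t0.0="\<lambda>n0 l0 n1 l1 n2 l2. int n2 - int n1" and ?t1.0="\<lambda>n0 l0 n1 l1 n2 l2. int n0" and ?t2.0="\<lambda>n0 l0 n1 l1 n2 l2. int n1 - int n0" and ?t3.0="\<lambda>n0 l0 n1 l1 n2 l2. int l0 - int n0" and ?t4.0="\<lambda>n0 l0 n1 l1 n2 l2. int l2 - int l0" and ?t5.0="\<lambda>n0 l0 n1 l1 n2 l2. int l1 - int l2"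
    and A="\<bar>s2\<bar> + 10 * \<bar>b1\<bar>"], goal_cases)
  case (13 Y n0 l0 n1 l1 n2 l2)
  then show ?case by (intro blk_V(1)) (auto simp: base_def blk_def dest: Om_D)
next
  case (14 n0 l0 n1 l1 n2 l2)
  then have "- (s2 * real n2) \<le> \<bar>s2\<bar> - s2 * real n1" by (auto intro: off_bound offset_bound2)
  moreover from 14 have "- (b1 * real l1) \<le> 10 * \<bar>b1\<bar> - b1 * real l2" by (intro offset_mult_le) (auto simp: base_def)
  ultimately show ?case using 14 unfolding k5_def k19_def k1_def kb12_def by (simp add: field_simps base_def)
next
  case (15 n0 l0 n1 l1 n2 l2 n0' l0' n1' l1')
  show ?case using two_zero_b[OF 15(4-7) ex] 15(3,8) by (elim disjE) simp_all
next
  case (16 n0 l0 n1 l1 n2 l2 n2' l2')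
  show ?case using two_zero_b[OF 16(4-7) ex] 16(3,8) by (elim disjE) simp_all
qed (use k in \<open>auto dest: Om_D simp: base_def fLc_def\<close>)

text \<open>The same picture with l0 and l2 as the large pair. Their difference can now have either
  sign, which accounts for the additional 10 in the constant.\<close>

lemma cone_b02a:
  fixes s0 s1 s2 b0 b1 b2 :: real
  defines "k19 \<equiv> s1 + s2" and "kb02 \<equiv> b0 + b2" and "k7 \<equiv> s0 + s1 + s2 + b0 + b2 - 3/2" and "k5 \<equiv> s0 + s1 + s2 + b0 + b1 + b2 - 2"
  assumes k: "k19 \<ge> 0" "kb02 \<ge> 0" "k7 \<ge> 0" "k5 \<ge> 0"
    and ex: "k19 \<noteq> 0 \<or> k7 \<noteq> 0" "k19 \<noteq> 0 \<or> k5 \<noteq> 0" "k7 \<noteq> 0 \<or> k5 \<noteq> 0" "kb02 \<noteq> 0 \<or> k5 \<noteq> 0"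
  shows "kb (\<lambda>x. indicator (Om (\<lambda>n0 l0 n1 l1 n2 l2. base n0 n1 n2 l1 l2 \<and> l0 \<le> l2 + 10 \<and> l2 \<le> l0 + 10 \<and> l1 \<le> n0 \<and> n0 \<le> l2 + 10) False) x * WW s0 s1 s2 b0 b1 b2 x)"
proof (rule cone5[where ?c0.0=False and ?c1.0=False and ?c2.0=False and ?k1.0="k19" and ?k2.0="kb02" and ?k3.0="k7" and ?k4.0="k5" and ?k5.0="1"
    and Q="\<lambda>n0 l0 n1 l1 n2 l2. base n0 n1 n2 l1 l2 \<and> l0 \<le> l2 + 10 \<and> l2 \<le> l0 + 10 \<and> l1 \<le> n0 \<and> n0 \<le> l2 + 10" and e="\<lambda>n0 l0 n1 l1 n2 l2. 3 * n0 + l1"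
    and ?t0.0="\<lambda>n0 l0 n1 l1 n2 l2. int n2 - int n1" and ?t1.0="\<lambda>n0 l0 n1 l1 n2 l2. int n1 - int n0" and ?t2.0="\<lambda>n0 l0 n1 l1 n2 l2. int l2 - int n0" and ?t3.0="\<lambda>n0 l0 n1 l1 n2 l2. int n0 - int l1" and ?t4.0="\<lambda>n0 l0 n1 l1 n2 l2. int l1" and ?t5.0="\<lambda>n0 l0 n1 l1 n2 l2. int l0 - int l2"
    and A="\<bar>s2\<bar> + 10 * \<bar>b0\<bar> + 10"], goal_cases)
  case (13 Y n0 l0 n1 l1 n2 l2)
  then show ?case by (intro blk_V(2)) (auto simp: base_def blk_def dest: Om_D)
next
  case (14 n0 l0 n1 l1 n2 l2)
  then have "- (s2 * real n2) \<le> \<bar>s2\<bar> - s2 * real n1" by (auto intro: off_bound offset_bound2)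
  moreover from 14 have "- (b0 * real l0) \<le> 10 * \<bar>b0\<bar> - b0 * real l2" by (intro offset_mult_le) (auto simp: base_def)
  ultimately show ?case using 14 unfolding k19_def kb02_def k7_def k5_def by (simp add: field_simps base_def)
next
  case (15 n0 l0 n1 l1 n2 l2 n0' l0' n1' l1')
  show ?case using two_zero_a[OF 15(4-7) ex] 15(3,8) by (elim disjE) simp_all
next
  case (16 n0 l0 n1 l1 n2 l2 n2' l2')
  show ?case using two_zero_a[OF 16(4-7) ex] 16(3,8) by (elim disjE) simp_all
qed (use k in \<open>auto dest: Om_D simp: base_def fLc_def\<close>)

lemma cone_b02b:
  fixes s0 s1 s2 b0 b1 b2 :: real
  defines "k5 \<equiv> s0 + s1 + s2 + b0 + b1 + b2 - 2" and "k19 \<equiv> s1 + s2" and "k1 \<equiv> b0 + b1 + b2 - 1/2" and "kb02 \<equiv> b0 + b2"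
  assumes k: "k5 \<ge> 0" "k19 \<ge> 0" "k1 \<ge> 0" "kb02 \<ge> 0"
    and ex: "k5 \<noteq> 0 \<or> k19 \<noteq> 0" "k1 \<noteq> 0 \<or> kb02 \<noteq> 0" "k5 \<noteq> 0 \<or> kb02 \<noteq> 0"
  shows "kb (\<lambda>x. indicator (Om (\<lambda>n0 l0 n1 l1 n2 l2. base n0 n1 n2 l1 l2 \<and> l0 \<le> l2 + 10 \<and> l2 \<le> l0 + 10 \<and> n0 \<le> l1) False) x * WW s0 s1 s2 b0 b1 b2 x)"
proof (rule cone5[where ?c0.0=False and ?c1.0=False and ?c2.0=False and ?k1.0="k5" and ?k2.0="k19" and ?k3.0="k1" and ?k4.0="kb02" and ?k5.0="1"
    and Q="\<lambda>n0 l0 n1 l1 n2 l2. base n0 n1 n2 l1 l2 \<and> l0 \<le> l2 + 10 \<and> l2 \<le> l0 + 10 \<and> n0 \<le> l1" and e="\<lambda>n0 l0 n1 l1 n2 l2. 3 * n0 + l1"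
    and ?t0.0="\<lambda>n0 l0 n1 l1 n2 l2. int n2 - int n1" and ?t1.0="\<lambda>n0 l0 n1 l1 n2 l2. int n0" and ?t2.0="\<lambda>n0 l0 n1 l1 n2 l2. int n1 - int n0" and ?t3.0="\<lambda>n0 l0 n1 l1 n2 l2. int l1 - int n0" and ?t4.0="\<lambda>n0 l0 n1 l1 n2 l2. int l2 - int l1" and ?t5.0="\<lambda>n0 l0 n1 l1 n2 l2. int l0 - int l2"
    and A="\<bar>s2\<bar> + 10 * \<bar>b0\<bar> + 10"], goal_cases)
  case (13 Y n0 l0 n1 l1 n2 l2)
  then show ?case by (intro blk_V(2)) (auto simp: base_def blk_def dest: Om_D)
next
  case (14 n0 l0 n1 l1 n2 l2)
  then have "- (s2 * real n2) \<le> \<bar>s2\<bar> - s2 * real n1" by (auto intro: off_bound offset_bound2)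
  moreover from 14 have "- (b0 * real l0) \<le> 10 * \<bar>b0\<bar> - b0 * real l2" by (intro offset_mult_le) (auto simp: base_def)
  ultimately show ?case using 14 unfolding k5_def k19_def k1_def kb02_def by (simp add: field_simps base_def)
next
  case (15 n0 l0 n1 l1 n2 l2 n0' l0' n1' l1')
  show ?case using two_zero_b[OF 15(4-7) ex] 15(3,8) by (elim disjE) simp_all
next
  case (16 n0 l0 n1 l1 n2 l2 n2' l2')
  show ?case using two_zero_b[OF 16(4-7) ex] 16(3,8) by (elim disjE) simp_all
qed (use k in \<open>auto dest: Om_D simp: base_def fLc_def\<close>)

text \<open>The output modulation is tied to n1, so along n1 - n0 the indices n1, n2 and l0 move
  together; this is where \<open>C16\<close> comes from. Since l2 \<le> n0, the same-side exponent 2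
  n0 + l1 + l2 is at most the volume exponent 3 n0 + l1.\<close>

lemma cone_c1:
  fixes s0 s1 s2 b0 b1 b2 :: real
  defines "k5 \<equiv> s0 + s1 + s2 + b0 + b1 + b2 - 2" and "k7 \<equiv> s0 + s1 + s2 + b0 + b2 - 3/2" and "k9 \<equiv> s0 + s1 + s2 + b0 - 1" and "k16 \<equiv> s1 + s2 + b0"
  assumes k: "k5 \<ge> 0" "k7 \<ge> 0" "k9 \<ge> 0" "k16 \<ge> 0"
    and ex: "k5 \<noteq> 0 \<or> k7 \<noteq> 0" "k5 \<noteq> 0 \<or> k9 \<noteq> 0" "k5 \<noteq> 0 \<or> k16 \<noteq> 0" "k7 \<noteq> 0 \<or> k9 \<noteq> 0" "k7 \<noteq> 0 \<or> k16 \<noteq> 0" "k9 \<noteq> 0 \<or> k16 \<noteq> 0"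
  shows "kb (\<lambda>x. indicator (Om (\<lambda>n0 l0 n1 l1 n2 l2. base n0 n1 n2 l1 l2 \<and> n0 + 5 < n1 \<and> n1 \<le> l0 + 6 \<and> l0 \<le> n1 + 3 \<and> l2 \<le> l0 \<and> l2 \<le> n0) True) x * WW s0 s1 s2 b0 b1 b2 x)"
proof (rule cone5[where ?c0.0=False and ?c1.0=False and ?c2.0=False and ?k1.0="k5" and ?k2.0="k7" and ?k3.0="k9" and ?k4.0="k16" and ?k5.0="1"
    and Q="\<lambda>n0 l0 n1 l1 n2 l2. base n0 n1 n2 l1 l2 \<and> n0 + 5 < n1 \<and> n1 \<le> l0 + 6 \<and> l0 \<le> n1 + 3 \<and> l2 \<le> l0 \<and> l2 \<le> n0" and e="\<lambda>n0 l0 n1 l1 n2 l2. 2 * n0 + l1 + l2"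
    and ?t0.0="\<lambda>n0 l0 n1 l1 n2 l2. int n2 - int n1" and ?t1.0="\<lambda>n0 l0 n1 l1 n2 l2. int l1" and ?t2.0="\<lambda>n0 l0 n1 l1 n2 l2. int l2 - int l1" and ?t3.0="\<lambda>n0 l0 n1 l1 n2 l2. int n0 - int l2" and ?t4.0="\<lambda>n0 l0 n1 l1 n2 l2. int n1 - int n0" and ?t5.0="\<lambda>n0 l0 n1 l1 n2 l2. int l0 - int n1"
    and A="\<bar>s2\<bar> + 6 * \<bar>b0\<bar> + 6"], goal_cases)
  case (13 Y n0 l0 n1 l1 n2 l2)
  then show ?case by (intro blk_T12) (auto simp: base_def blk_def dest: Om_D)
next
  case (14 n0 l0 n1 l1 n2 l2)
  then have "- (s2 * real n2) \<le> \<bar>s2\<bar> - s2 * real n1" by (auto intro: off_bound offset_bound2)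
  moreover from 14 have "- (b0 * real l0) \<le> 6 * \<bar>b0\<bar> - b0 * real n1" by (intro offset_mult_le) (auto simp: base_def)
  ultimately show ?case using 14 unfolding k5_def k7_def k9_def k16_def by (simp add: field_simps base_def)
next
  case (15 n0 l0 n1 l1 n2 l2 n0' l0' n1' l1')
  show ?case using at_most_one4[OF 15(4-7) ex] 15(3,8) by (elim disjE) simp_all
next
  case (16 n0 l0 n1 l1 n2 l2 n2' l2')
  show ?case using at_most_one4[OF 16(4-7) ex] 16(3,8) by (elim disjE) simp_all
qed (use k in \<open>auto dest: Om_D simp: base_def fLc_def\<close>)

text \<open>For l2 \<ge> n0 the volume bound with l1 is the better one. In the application
  \<open>ka\<close> is the sum of the slacks of \<open>C19\<close> and \<open>C3\<close>, so it
  vanishes only if s1 + s2 = 0 and b0 + b2 = 0.\<close>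

lemma cone_c2a:
  fixes s0 s1 s2 b0 b1 b2 :: real
  defines "k5 \<equiv> s0 + s1 + s2 + b0 + b1 + b2 - 2" and "k7 \<equiv> s0 + s1 + s2 + b0 + b2 - 3/2" and "ka \<equiv> s1 + s2 + b0 + b2" and "k16 \<equiv> s1 + s2 + b0"
  assumes k: "k5 \<ge> 0" "k7 \<ge> 0" "ka \<ge> 0" "k16 \<ge> 0"
    and ex: "k5 \<noteq> 0 \<or> k7 \<noteq> 0" "k5 \<noteq> 0 \<or> ka \<noteq> 0" "k5 \<noteq> 0 \<or> k16 \<noteq> 0" "k7 \<noteq> 0 \<or> ka \<noteq> 0" "k7 \<noteq> 0 \<or> k16 \<noteq> 0" "ka \<noteq> 0 \<or> k16 \<noteq> 0"
  shows "kb (\<lambda>x. indicator (Om (\<lambda>n0 l0 n1 l1 n2 l2. base n0 n1 n2 l1 l2 \<and> n0 + 5 < n1 \<and> n1 \<le> l0 + 6 \<and> l0 \<le> n1 + 3 \<and> l2 \<le> l0 \<and> l1 \<le> n0 \<and> n0 \<le> l2) True) x * WW s0 s1 s2 b0 b1 b2 x)"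
proof (rule cone5[where ?c0.0=False and ?c1.0=False and ?c2.0=False and ?k1.0="k5" and ?k2.0="k7" and ?k3.0="ka" and ?k4.0="k16" and ?k5.0="1"
    and Q="\<lambda>n0 l0 n1 l1 n2 l2. base n0 n1 n2 l1 l2 \<and> n0 + 5 < n1 \<and> n1 \<le> l0 + 6 \<and> l0 \<le> n1 + 3 \<and> l2 \<le> l0 \<and> l1 \<le> n0 \<and> n0 \<le> l2" and e="\<lambda>n0 l0 n1 l1 n2 l2. 3 * n0 + l1"
    and ?t0.0="\<lambda>n0 l0 n1 l1 n2 l2. int n2 - int n1" and ?t1.0="\<lambda>n0 l0 n1 l1 n2 l2. int l1" and ?t2.0="\<lambda>n0 l0 n1 l1 n2 l2. int n0 - int l1" and ?t3.0="\<lambda>n0 l0 n1 l1 n2 l2. int l2 - int n0" and ?t4.0="\<lambda>n0 l0 n1 l1 n2 l2. int n1 - int l2" and ?t5.0="\<lambda>n0 l0 n1 l1 n2 l2. int l0 - int n1"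
    and A="\<bar>s2\<bar> + 6 * \<bar>b0\<bar> + 6"], goal_cases)
  case (13 Y n0 l0 n1 l1 n2 l2)
  then show ?case by (intro blk_V(2)) (auto simp: base_def blk_def dest: Om_D)
next
  case (14 n0 l0 n1 l1 n2 l2)
  then have "- (s2 * real n2) \<le> \<bar>s2\<bar> - s2 * real n1" by (auto intro: off_bound offset_bound2)
  moreover from 14 have "- (b0 * real l0) \<le> 6 * \<bar>b0\<bar> - b0 * real n1" by (intro offset_mult_le) (auto simp: base_def)
  ultimately show ?case using 14 unfolding k5_def k7_def ka_def k16_def by (simp add: field_simps base_def)
next
  case (15 n0 l0 n1 l1 n2 l2 n0' l0' n1' l1')
  show ?case using at_most_one4[OF 15(4-7) ex] 15(3,8) by (elim disjE) simp_all
next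
  case (16 n0 l0 n1 l1 n2 l2 n2' l2')
  show ?case using at_most_one4[OF 16(4-7) ex] 16(3,8) by (elim disjE) simp_all
qed (use k in \<open>auto dest: Om_D simp: base_def fLc_def\<close>)

text \<open>In the application \<open>kc\<close> is the sum of the slacks of \<open>C19\<close> and
  \<open>C1\<close>, and \<open>ka\<close> that of \<open>C19\<close> and \<open>C3\<close>. The
  compatible pair is \<open>kc\<close> and \<open>k16\<close>; both vanish exactly when s1 + s2 = 0,
  b0 = 0 and b1 + b2 = 1/2.\<close>

lemma cone_c2b:
  fixes s0 s1 s2 b0 b1 b2 :: real
  defines "k5 \<equiv> s0 + s1 + s2 + b0 + b1 + b2 - 2" and "kc \<equiv> s1 + s2 + b0 + b1 + b2 - 1/2" and "ka \<equiv> s1 + s2 + b0 + b2" and "k16 \<equiv> s1 + s2 + b0"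
  assumes k: "k5 \<ge> 0" "kc \<ge> 0" "ka \<ge> 0" "k16 \<ge> 0"
    and ex: "k5 \<noteq> 0 \<or> kc \<noteq> 0" "k5 \<noteq> 0 \<or> ka \<noteq> 0" "k5 \<noteq> 0 \<or> k16 \<noteq> 0" "kc \<noteq> 0 \<or> ka \<noteq> 0" "ka \<noteq> 0 \<or> k16 \<noteq> 0"
  shows "kb (\<lambda>x. indicator (Om (\<lambda>n0 l0 n1 l1 n2 l2. base n0 n1 n2 l1 l2 \<and> n0 + 5 < n1 \<and> n1 \<le> l0 + 6 \<and> l0 \<le> n1 + 3 \<and> l2 \<le> l0 \<and> n0 \<le> l1) True) x * WW s0 s1 s2 b0 b1 b2 x)"
proof (rule cone5[where ?c0.0=False and ?c1.0=False and ?c2.0=False and ?k1.0="k5" and ?k2.0="kc" and ?k3.0="ka" and ?k4.0="k16" and ?k5.0="1"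
    and Q="\<lambda>n0 l0 n1 l1 n2 l2. base n0 n1 n2 l1 l2 \<and> n0 + 5 < n1 \<and> n1 \<le> l0 + 6 \<and> l0 \<le> n1 + 3 \<and> l2 \<le> l0 \<and> n0 \<le> l1" and e="\<lambda>n0 l0 n1 l1 n2 l2. 3 * n0 + l1"
    and ?t0.0="\<lambda>n0 l0 n1 l1 n2 l2. int n2 - int n1" and ?t1.0="\<lambda>n0 l0 n1 l1 n2 l2. int n0" and ?t2.0="\<lambda>n0 l0 n1 l1 n2 l2. int l1 - int n0" and ?t3.0="\<lambda>n0 l0 n1 l1 n2 l2. int l2 - int l1" and ?t4.0="\<lambda>n0 l0 n1 l1 n2 l2. int n1 - int l2" and ?t5.0="\<lambda>n0 l0 n1 l1 n2 l2. int l0 - int n1"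
    and A="\<bar>s2\<bar> + 6 * \<bar>b0\<bar> + 6"], goal_cases)
  case (13 Y n0 l0 n1 l1 n2 l2)
  then show ?case by (intro blk_V(2)) (auto simp: base_def blk_def dest: Om_D)
next
  case (14 n0 l0 n1 l1 n2 l2)
  then have "- (s2 * real n2) \<le> \<bar>s2\<bar> - s2 * real n1" by (auto intro: off_bound offset_bound2)
  moreover from 14 have "- (b0 * real l0) \<le> 6 * \<bar>b0\<bar> - b0 * real n1" by (intro offset_mult_le) (auto simp: base_def)
  ultimately show ?case using 14 unfolding k5_def kc_def ka_def k16_def by (simp add: field_simps base_def)
next
  case (15 n0 l0 n1 l1 n2 l2 n0' l0' n1' l1')
  show ?case using two_zero_c[OF 15(4-7) ex] 15(3,8) by (elim disjE) simp_all
next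
  case (16 n0 l0 n1 l1 n2 l2 n2' l2')
  show ?case using two_zero_c[OF 16(4-7) ex] 16(3,8) by (elim disjE) simp_all
qed (use k in \<open>auto dest: Om_D simp: base_def fLc_def\<close>)

text \<open>With b0 = 0 and S = 1 the slacks of \<open>C9\<close> and \<open>C12\<close> vanish
  together. The rules then make \<open>C6\<close>, \<open>C7\<close> and \<open>C13\<close> strict,
  which yields b1, b2 > 1/2 and s1 + s2 > 1/2. Once l0 is no longer an index, the only ray without
  decay is the common growth of n0, n1 and n2.\<close>

lemma collapsed0:
  fixes s0 s1 s2 b0 b1 b2 :: real
  defines "g1 \<equiv> b1 - 1/2" and "g2 \<equiv> b2 - 1/2" and "kx \<equiv> s1 + s2 - 1/2"
  assumes k: "g1 > 0" "g2 > 0" "kx > 0"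
    and z: "b0 = 0" "s0 = 1 - s1 - s2"
  shows "kb (\<lambda>x. indicator (Om (\<lambda>n0 l0 n1 l1 n2 l2. base n0 n1 n2 l1 l2) False) x * WW s0 s1 s2 b0 b1 b2 x)"
proof (rule cone5[where ?c0.0=True and ?c1.0=False and ?c2.0=False and ?k1.0="g1" and ?k2.0="g2" and ?k3.0="kx" and ?k4.0="0" and ?k5.0="0"
    and Q="\<lambda>n0 l0 n1 l1 n2 l2. n0 \<le> n1 \<and> n0 \<le> n2 \<and> n1 \<le> n2 + 1 \<and> n2 \<le> n1 + 1 \<and> l0 = 0" and e="\<lambda>n0 l0 n1 l1 n2 l2. n0 + n1 + l1 + l2"
    and ?t0.0="\<lambda>n0 l0 n1 l1 n2 l2. int n2 - int n1" and ?t1.0="\<lambda>n0 l0 n1 l1 n2 l2. int l1" and ?t2.0="\<lambda>n0 l0 n1 l1 n2 l2. int l2" and ?t3.0="\<lambda>n0 l0 n1 l1 n2 l2. int n1 - int n0" and ?t4.0="\<lambda>n0 l0 n1 l1 n2 l2. 0" and ?t5.0="\<lambda>n0 l0 n1 l1 n2 l2. 0"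
    and A="\<bar>s2\<bar>"], goal_cases)
  case (13 Y n0 l0 n1 l1 n2 l2)
  then show ?case by (intro blk_A12) (auto simp: base_def blk_def dest: Om_D)
next
  case (14 n0 l0 n1 l1 n2 l2)
  then have "- (s2 * real n2) \<le> \<bar>s2\<bar> - s2 * real n1" by (auto intro: off_bound offset_bound2)
  then show ?case using 14 unfolding g1_def g2_def kx_def z by (simp add: field_simps base_def)
next
  case (15 n0 l0 n1 l1 n2 l2 n0' l0' n1' l1')
  then show ?case using k by auto
next
  case (16 n0 l0 n1 l1 n2 l2 n2' l2')
  then show ?case using k by auto
qed (use k z in \<open>auto dest: Om_D simp: base_def fLc_def\<close>)

text \<open>Here a high-frequency factor is left undecomposed and the volume bound in l0 and l2 is
  used. Its contribution n0 to the exponent balances S = 1 on the common growth of the frequencies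
  and leaves decay of rate s1 + s2 in n1 - n0.\<close>

lemma collapsed1:
  fixes s0 s1 s2 b0 b1 b2 :: real
  defines "g0 \<equiv> b0 - 1/2" and "g2 \<equiv> b2 - 1/2" and "k19 \<equiv> s1 + s2"
  assumes k: "g0 > 0" "g2 > 0" "k19 > 0"
    and z: "b1 = 0" "s0 = 1 - s1 - s2"
  shows "kb (\<lambda>x. indicator (Om (\<lambda>n0 l0 n1 l1 n2 l2. base n0 n1 n2 l1 l2) False) x * WW s0 s1 s2 b0 b1 b2 x)"
proof (rule cone5[where ?c0.0=False and ?c1.0=True and ?c2.0=False and ?k1.0="g0" and ?k2.0="g2" and ?k3.0="k19" and ?k4.0="0" and ?k5.0="0"
    and Q="\<lambda>n0 l0 n1 l1 n2 l2. n0 \<le> n1 \<and> n0 \<le> n2 \<and> n1 \<le> n2 + 1 \<and> n2 \<le> n1 + 1 \<and> l1 = 0" and e="\<lambda>n0 l0 n1 l1 n2 l2. 2 * n0 + l0 + l2"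
    and ?t0.0="\<lambda>n0 l0 n1 l1 n2 l2. int n2 - int n1" and ?t1.0="\<lambda>n0 l0 n1 l1 n2 l2. int l0" and ?t2.0="\<lambda>n0 l0 n1 l1 n2 l2. int l2" and ?t3.0="\<lambda>n0 l0 n1 l1 n2 l2. int n1 - int n0" and ?t4.0="\<lambda>n0 l0 n1 l1 n2 l2. 0" and ?t5.0="\<lambda>n0 l0 n1 l1 n2 l2. 0"
    and A="\<bar>s2\<bar>"], goal_cases)
  case (13 Y n0 l0 n1 l1 n2 l2)
  then show ?case by (intro blk_A02) (auto simp: base_def blk_def dest: Om_D)
next
  case (14 n0 l0 n1 l1 n2 l2)
  then have "- (s2 * real n2) \<le> \<bar>s2\<bar> - s2 * real n1" by (auto intro: off_bound offset_bound2)
  then show ?case using 14 unfolding g0_def g2_def k19_def z by (simp add: field_simps base_def)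
next
  case (15 n0 l0 n1 l1 n2 l2 n0' l0' n1' l1')
  then show ?case using k by auto
next
  case (16 n0 l0 n1 l1 n2 l2 n2' l2')
  then show ?case using k by auto
qed (use k z in \<open>auto dest: Om_D simp: base_def fLc_def\<close>)

lemma collapsed2:
  fixes s0 s1 s2 b0 b1 b2 :: real
  defines "g0 \<equiv> b0 - 1/2" and "g1 \<equiv> b1 - 1/2" and "k19 \<equiv> s1 + s2"
  assumes k: "g0 > 0" "g1 > 0" "k19 > 0"
    and z: "b2 = 0" "s0 = 1 - s1 - s2"
  shows "kb (\<lambda>x. indicator (Om (\<lambda>n0 l0 n1 l1 n2 l2. base n0 n1 n2 l1 l2) False) x * WW s0 s1 s2 b0 b1 b2 x)"
proof (rule cone5[where ?c0.0=False and ?c1.0=False and ?c2.0=True and ?k1.0="g0" and ?k2.0="g1" and ?k3.0="k19" and ?k4.0="0" and ?k5.0="0"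
    and Q="\<lambda>n0 l0 n1 l1 n2 l2. n0 \<le> n1 \<and> n0 \<le> n2 \<and> n1 \<le> n2 + 1 \<and> n2 \<le> n1 + 1 \<and> l2 = 0" and e="\<lambda>n0 l0 n1 l1 n2 l2. 2 * n0 + l0 + l1"
    and ?t0.0="\<lambda>n0 l0 n1 l1 n2 l2. int n2 - int n1" and ?t1.0="\<lambda>n0 l0 n1 l1 n2 l2. int l0" and ?t2.0="\<lambda>n0 l0 n1 l1 n2 l2. int l1" and ?t3.0="\<lambda>n0 l0 n1 l1 n2 l2. int n1 - int n0" and ?t4.0="\<lambda>n0 l0 n1 l1 n2 l2. 0" and ?t5.0="\<lambda>n0 l0 n1 l1 n2 l2. 0"
    and A="\<bar>s2\<bar>"], goal_cases)
  case (13 Y n0 l0 n1 l1 n2 l2)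
  then show ?case by (intro blk_A01) (auto simp: base_def blk_def dest: Om_D)
next
  case (14 n0 l0 n1 l1 n2 l2)
  then have "- (s2 * real n2) \<le> \<bar>s2\<bar> - s2 * real n1" by (auto intro: off_bound offset_bound2)
  then show ?case using 14 unfolding g0_def g1_def k19_def z by (simp add: field_simps base_def)
next
  case (15 n0 l0 n1 l1 n2 l2 n0' l0' n1' l1')
  then show ?case using k by auto
next
  case (16 n0 l0 n1 l1 n2 l2 n2' l2')
  then show ?case using k by auto
qed (use k z in \<open>auto dest: Om_D simp: base_def fLc_def\<close>)

text \<open>With two modulations undecomposed, the crude bound in the remaining one is used. S > 3/2
  gives decay in n0, and b0 > 1/2 follows from \<open>C1\<close> and \<open>R1\<close>; the only
  possible ray without decay is n1 - n0, when s1 + s2 = 0.\<close>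

lemma collapsed12:
  fixes s0 s1 s2 b0 b1 b2 :: real
  defines "kS \<equiv> s0 + s1 + s2 - 3/2" and "g0 \<equiv> b0 - 1/2" and "k19 \<equiv> s1 + s2"
  assumes k: "kS > 0" "g0 > 0" "k19 \<ge> 0"
    and z: "b1 = 0" "b2 = 0"
  shows "kb (\<lambda>x. indicator (Om (\<lambda>n0 l0 n1 l1 n2 l2. base n0 n1 n2 l1 l2) False) x * WW s0 s1 s2 b0 b1 b2 x)"
proof (rule cone5[where ?c0.0=False and ?c1.0=True and ?c2.0=True and ?k1.0="kS" and ?k2.0="g0" and ?k3.0="k19" and ?k4.0="0" and ?k5.0="0"
    and Q="\<lambda>n0 l0 n1 l1 n2 l2. n0 \<le> n1 \<and> n0 \<le> n2 \<and> n1 \<le> n2 + 1 \<and> n2 \<le> n1 + 1 \<and> l1 = 0 \<and> l2 = 0" and e="\<lambda>n0 l0 n1 l1 n2 l2. 3 * n0 + l0"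
    and ?t0.0="\<lambda>n0 l0 n1 l1 n2 l2. int n2 - int n1" and ?t1.0="\<lambda>n0 l0 n1 l1 n2 l2. int n0" and ?t2.0="\<lambda>n0 l0 n1 l1 n2 l2. int l0" and ?t3.0="\<lambda>n0 l0 n1 l1 n2 l2. int n1 - int n0" and ?t4.0="\<lambda>n0 l0 n1 l1 n2 l2. 0" and ?t5.0="\<lambda>n0 l0 n1 l1 n2 l2. 0"
    and A="\<bar>s2\<bar>"], goal_cases)
  case (13 Y n0 l0 n1 l1 n2 l2)
  then show ?case by (intro blk_V(1)) (auto simp: base_def blk_def dest: Om_D)
next
  case (14 n0 l0 n1 l1 n2 l2)
  then have "- (s2 * real n2) \<le> \<bar>s2\<bar> - s2 * real n1" by (auto intro: off_bound offset_bound2)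
  then show ?case using 14 unfolding kS_def g0_def k19_def z by (simp add: field_simps base_def)
next
  case (15 n0 l0 n1 l1 n2 l2 n0' l0' n1' l1')
  then show ?case using k by auto
next
  case (16 n0 l0 n1 l1 n2 l2 n2' l2')
  then show ?case using k by auto
qed (use k z in \<open>auto dest: Om_D simp: base_def fLc_def\<close>)

lemma collapsed02:
  fixes s0 s1 s2 b0 b1 b2 :: real
  defines "kS \<equiv> s0 + s1 + s2 - 3/2" and "g1 \<equiv> b1 - 1/2" and "k19 \<equiv> s1 + s2"
  assumes k: "kS > 0" "g1 > 0" "k19 \<ge> 0"
    and z: "b0 = 0" "b2 = 0"
  shows "kb (\<lambda>x. indicator (Om (\<lambda>n0 l0 n1 l1 n2 l2. base n0 n1 n2 l1 l2) False) x * WW s0 s1 s2 b0 b1 b2 x)"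
proof (rule cone5[where ?c0.0=True and ?c1.0=False and ?c2.0=True and ?k1.0="kS" and ?k2.0="g1" and ?k3.0="k19" and ?k4.0="0" and ?k5.0="0"
    and Q="\<lambda>n0 l0 n1 l1 n2 l2. n0 \<le> n1 \<and> n0 \<le> n2 \<and> n1 \<le> n2 + 1 \<and> n2 \<le> n1 + 1 \<and> l0 = 0 \<and> l2 = 0" and e="\<lambda>n0 l0 n1 l1 n2 l2. 3 * n0 + l1"
    and ?t0.0="\<lambda>n0 l0 n1 l1 n2 l2. int n2 - int n1" and ?t1.0="\<lambda>n0 l0 n1 l1 n2 l2. int n0" and ?t2.0="\<lambda>n0 l0 n1 l1 n2 l2. int l1" and ?t3.0="\<lambda>n0 l0 n1 l1 n2 l2. int n1 - int n0" and ?t4.0="\<lambda>n0 l0 n1 l1 n2 l2. 0" and ?t5.0="\<lambda>n0 l0 n1 l1 n2 l2. 0"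
    and A="\<bar>s2\<bar>"], goal_cases)
  case (13 Y n0 l0 n1 l1 n2 l2)
  then show ?case by (intro blk_V(2)) (auto simp: base_def blk_def dest: Om_D)
next
  case (14 n0 l0 n1 l1 n2 l2)
  then have "- (s2 * real n2) \<le> \<bar>s2\<bar> - s2 * real n1" by (auto intro: off_bound offset_bound2)
  then show ?case using 14 unfolding kS_def g1_def k19_def z by (simp add: field_simps base_def)
next
  case (15 n0 l0 n1 l1 n2 l2 n0' l0' n1' l1')
  then show ?case using k by auto
next
  case (16 n0 l0 n1 l1 n2 l2 n2' l2')
  then show ?case using k by auto
qed (use k z in \<open>auto dest: Om_D simp: base_def fLc_def\<close>)

lemma collapsed01:
  fixes s0 s1 s2 b0 b1 b2 :: real
  defines "kS \<equiv> s0 + s1 + s2 - 3/2" and "g2 \<equiv> b2 - 1/2" and "k19 \<equiv> s1 + s2"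
  assumes k: "kS > 0" "g2 > 0" "k19 \<ge> 0"
    and z: "b0 = 0" "b1 = 0"
  shows "kb (\<lambda>x. indicator (Om (\<lambda>n0 l0 n1 l1 n2 l2. base n0 n1 n2 l1 l2) False) x * WW s0 s1 s2 b0 b1 b2 x)"
proof (rule cone5[where ?c0.0=True and ?c1.0=True and ?c2.0=False and ?k1.0="kS" and ?k2.0="g2" and ?k3.0="k19" and ?k4.0="0" and ?k5.0="0"
    and Q="\<lambda>n0 l0 n1 l1 n2 l2. n0 \<le> n1 \<and> n0 \<le> n2 \<and> n1 \<le> n2 + 1 \<and> n2 \<le> n1 + 1 \<and> l0 = 0 \<and> l1 = 0" and e="\<lambda>n0 l0 n1 l1 n2 l2. 3 * n0 + l2"
    and ?t0.0="\<lambda>n0 l0 n1 l1 n2 l2. int n2 - int n1" and ?t1.0="\<lambda>n0 l0 n1 l1 n2 l2. int n0" and ?t2.0="\<lambda>n0 l0 n1 l1 n2 l2. int l2" and ?t3.0="\<lambda>n0 l0 n1 l1 n2 l2. int n1 - int n0" and ?t4.0="\<lambda>n0 l0 n1 l1 n2 l2. 0" and ?t5.0="\<lambda>n0 l0 n1 l1 n2 l2. 0"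
    and A="\<bar>s2\<bar>"], goal_cases)
  case (13 Y n0 l0 n1 l1 n2 l2)
  then show ?case by (intro blk_V(3)) (auto simp: base_def blk_def dest: Om_D)
next
  case (14 n0 l0 n1 l1 n2 l2)
  then have "- (s2 * real n2) \<le> \<bar>s2\<bar> - s2 * real n1" by (auto intro: off_bound offset_bound2)
  then show ?case using 14 unfolding kS_def g2_def k19_def z by (simp add: field_simps base_def)
next
  case (15 n0 l0 n1 l1 n2 l2 n0' l0' n1' l1')
  then show ?case using k by auto
next
  case (16 n0 l0 n1 l1 n2 l2 n2' l2')
  then show ?case using k by auto
qed (use k z in \<open>auto dest: Om_D simp: base_def fLc_def\<close>)

subsection \<open>Assembling the cones\<close>

lemma kb_mono:
  assumes "kb (\<lambda>x. indicator Y x * W x)" "X \<subseteq> Y"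
  shows "kb (\<lambda>x. indicator X x * W x)"
proof -
  obtain C :: real where C: "\<And>F G H. F \<in> borel_measurable borel \<Longrightarrow> G \<in> borel_measurable borel \<Longrightarrow> H \<in> borel_measurable borel \<Longrightarrow>
     (tri (\<lambda>x. indicator Y x * W x * (F (fst x) * G (fst (snd x)) * H (snd (snd x)))))\<^sup>2 \<le> ennreal C * sqn F * sqn G * sqn H"
    using assms(1) by (auto simp: kb_def)
  show ?thesis unfolding kb_def
  proof (intro exI[of _ C] allI impI)
    fix F G H :: "st \<Rightarrow> ennreal" assume "F \<in> borel_measurable borel" "G \<in> borel_measurable borel" "H \<in> borel_measurable borel"
    from C[OF this] show "(tri (\<lambda>x. indicator X x * W x * (F (fst x) * G (fst (snd x)) * H (snd (snd x)))))\<^sup>2 \<le> ennreal C * sqn F * sqn G * sqn H"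
      by (rule order_trans[rotated]) (use assms(2) in \<open>auto intro!: power2_mono_ennreal tri_mono split: split_indicator\<close>)
  qed
qed

lemma power2_add_ennreal_le: "(a + b)\<^sup>2 \<le> 4 * (a\<^sup>2 + b\<^sup>2)" for a b :: ennreal
proof -
  have m: "(a + b)\<^sup>2 \<le> 4 * (a\<^sup>2 + b\<^sup>2)" if "a \<le> b" for a b :: ennreal
  proof -
    have "(a + b)\<^sup>2 \<le> (2 * b)\<^sup>2" using that by (intro power2_mono_ennreal) (simp add: mult_2 add_right_mono)
    also have "\<dots> = 4 * b\<^sup>2" by (simp add: power_mult_distrib)
    also have "\<dots> \<le> 4 * (a\<^sup>2 + b\<^sup>2)" by (intro mult_left_mono) auto
    finally show ?thesis .
  qed
  show ?thesis using m[of a b] m[of b a] by (cases "a \<le> b") (auto simp: add.commute)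
qed

lemma kb_Un:
  assumes X [measurable]: "X \<in> sets st3" "Y \<in> sets st3" and W [measurable]: "W \<in> borel_measurable st3"
    and kX: "kb (\<lambda>x. indicator X x * W x)" and kY: "kb (\<lambda>x. indicator Y x * W x)"
  shows "kb (\<lambda>x. indicator (X \<union> Y) x * W x)"
proof -
  obtain C :: real where C: "\<And>F G H. F \<in> borel_measurable borel \<Longrightarrow> G \<in> borel_measurable borel \<Longrightarrow> H \<in> borel_measurable borel \<Longrightarrow>
     (tri (\<lambda>x. indicator X x * W x * (F (fst x) * G (fst (snd x)) * H (snd (snd x)))))\<^sup>2 \<le> ennreal C * sqn F * sqn G * sqn H"
    using kX by (auto simp: kb_def)
  obtain D :: real where D: "\<And>F G H. F \<in> borel_measurable borel \<Longrightarrow> G \<in> borel_measurable borel \<Longrightarrow> H \<in> borel_measurable borel \<Longrightarrow>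
     (tri (\<lambda>x. indicator Y x * W x * (F (fst x) * G (fst (snd x)) * H (snd (snd x)))))\<^sup>2 \<le> ennreal D * sqn F * sqn G * sqn H"
    using kY by (auto simp: kb_def)
  show ?thesis unfolding kb_def
  proof (intro exI[of _ "4 * (max 0 C + max 0 D)"] allI impI)
    fix F G H :: "st \<Rightarrow> ennreal" assume m [measurable]: "F \<in> borel_measurable borel" "G \<in> borel_measurable borel" "H \<in> borel_measurable borel"
    define f where "f A x = indicator A x * W x * (F (fst x) * G (fst (snd x)) * H (snd (snd x)))" for A x
    have fr [measurable (raw)]: "(\<lambda>x. f A (u x, v x, w x)) \<in> borel_measurable M"
      if "A \<in> sets st3" "u \<in> measurable M borel" "v \<in> measurable M borel" "w \<in> measurable M borel" for A u v w and M :: "'z measure"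
    proof -
      have [measurable]: "A \<in> sets st3" by fact
      have "f A \<in> borel_measurable st3" unfolding f_def[abs_def] by measurable
      from measurable_compose[OF measurable_Pair[OF that(2) measurable_Pair[OF that(3,4)]] this] show ?thesis .
    qed
    have "tri (f (X \<union> Y)) \<le> tri (\<lambda>x. f X x + f Y x)"
      by (rule tri_mono) (auto simp: f_def split: split_indicator)
    also have "\<dots> = tri (f X) + tri (f Y)"
      unfolding tri_def by (subst nn_integral_add[symmetric], measurable, subst nn_integral_add[symmetric], measurable)
    finally have "(tri (f (X \<union> Y)))\<^sup>2 \<le> 4 * ((tri (f X))\<^sup>2 + (tri (f Y))\<^sup>2)"
      by (rule order_trans[OF power2_mono_ennreal power2_add_ennreal_le])
    also have "\<dots> \<le> 4 * (ennreal C * sqn F * sqn G * sqn H + ennreal D * sqn F * sqn G * sqn H)"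
      unfolding f_def by (intro mult_left_mono add_mono C D m) simp
    also have "\<dots> = ennreal (4 * (max 0 C + max 0 D)) * sqn F * sqn G * sqn H"
    proof -
      have "ennreal (4 * (max 0 C + max 0 D)) = 4 * (ennreal C + ennreal D)"
        by (simp add: ennreal_mult ennreal_plus max_def ennreal_neg)
      then show ?thesis by (simp add: distrib_right distrib_left mult_ac)
    qed
    finally show "(tri (\<lambda>x. indicator (X \<union> Y) x * W x * (F (fst x) * G (fst (snd x)) * H (snd (snd x)))))\<^sup>2 \<le> ennreal (4 * (max 0 C + max 0 D)) * sqn F * sqn G * sqn H"
      by (simp only: f_def[abs_def])
  qed
qed

lemma kb_swap01:
  assumes [measurable]: "X \<in> sets st3" and k: "kb (\<lambda>x. indicator {(p, q, r). (q, p, r) \<in> X} x * WW s1 s0 s2 b1 b0 b2 x)"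
  shows "kb (\<lambda>x. indicator X x * WW s0 s1 s2 b0 b1 b2 x)"
proof -
  have eq: "tri (\<lambda>x. indicator X x * WW s0 s1 s2 b0 b1 b2 x * (F (fst x) * G (fst (snd x)) * H (snd (snd x))))
    = tri (\<lambda>x. indicator {(p, q, r). (q, p, r) \<in> X} x * WW s1 s0 s2 b1 b0 b2 x * (G (fst x) * F (fst (snd x)) * H (snd (snd x))))"
    if [measurable]: "F \<in> borel_measurable borel" "G \<in> borel_measurable borel" "H \<in> borel_measurable borel" for F G H :: "st \<Rightarrow> ennreal"
    by (subst tri_swap01[symmetric]) (auto intro!: arg_cong[where f=tri] simp: fun_eq_iff WW_def mult_ac split: split_indicator)
  from k obtain C :: real where C: "\<And>F G H. F \<in> borel_measurable borel \<Longrightarrow> G \<in> borel_measurable borel \<Longrightarrow> H \<in> borel_measurable borel \<Longrightarrow>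
     (tri (\<lambda>x. indicator {(p, q, r). (q, p, r) \<in> X} x * WW s1 s0 s2 b1 b0 b2 x * (F (fst x) * G (fst (snd x)) * H (snd (snd x)))))\<^sup>2 \<le> ennreal C * sqn F * sqn G * sqn H"
    by (auto simp: kb_def)
  show ?thesis unfolding kb_def
  proof (intro exI[of _ C] allI impI)
    fix F G H :: "st \<Rightarrow> ennreal" assume m: "F \<in> borel_measurable borel" "G \<in> borel_measurable borel" "H \<in> borel_measurable borel"
    show "(tri (\<lambda>x. indicator X x * WW s0 s1 s2 b0 b1 b2 x * (F (fst x) * G (fst (snd x)) * H (snd (snd x)))))\<^sup>2 \<le> ennreal C * sqn F * sqn G * sqn H"
      unfolding eq[OF m] using C[OF m(2,1,3)] by (simp only: mult_ac)
  qed
qed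

lemma kb_swap12:
  assumes [measurable]: "X \<in> sets st3" and k: "kb (\<lambda>x. indicator {(p, q, r). (p, r, q) \<in> X} x * WW s0 s2 s1 b0 b2 b1 x)"
  shows "kb (\<lambda>x. indicator X x * WW s0 s1 s2 b0 b1 b2 x)"
proof -
  have eq: "tri (\<lambda>x. indicator X x * WW s0 s1 s2 b0 b1 b2 x * (F (fst x) * G (fst (snd x)) * H (snd (snd x))))
    = tri (\<lambda>x. indicator {(p, q, r). (p, r, q) \<in> X} x * WW s0 s2 s1 b0 b2 b1 x * (F (fst x) * H (fst (snd x)) * G (snd (snd x))))"
    if [measurable]: "F \<in> borel_measurable borel" "G \<in> borel_measurable borel" "H \<in> borel_measurable borel" for F G H :: "st \<Rightarrow> ennreal"
    by (subst tri_swap12[symmetric]) (auto intro!: arg_cong[where f=tri] simp: fun_eq_iff WW_def mult_ac split: split_indicator)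
  from k obtain C :: real where C: "\<And>F G H. F \<in> borel_measurable borel \<Longrightarrow> G \<in> borel_measurable borel \<Longrightarrow> H \<in> borel_measurable borel \<Longrightarrow>
     (tri (\<lambda>x. indicator {(p, q, r). (p, r, q) \<in> X} x * WW s0 s2 s1 b0 b2 b1 x * (F (fst x) * G (fst (snd x)) * H (snd (snd x)))))\<^sup>2 \<le> ennreal C * sqn F * sqn G * sqn H"
    by (auto simp: kb_def)
  show ?thesis unfolding kb_def
  proof (intro exI[of _ C] allI impI)
    fix F G H :: "st \<Rightarrow> ennreal" assume m: "F \<in> borel_measurable borel" "G \<in> borel_measurable borel" "H \<in> borel_measurable borel"
    show "(tri (\<lambda>x. indicator X x * WW s0 s1 s2 b0 b1 b2 x * (F (fst x) * G (fst (snd x)) * H (snd (snd x)))))\<^sup>2 \<le> ennreal C * sqn F * sqn G * sqn H"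
      unfolding eq[OF m] using C[OF m(1,3,2)] by (simp only: mult_ac)
  qed
qed

subsection \<open>Relations between the dyadic indices\<close>

text \<open>The signed version of \<open>tube\<close>; the sign matters because the relation between
  the three modulations is additive.\<close>

definition hyp :: "st \<Rightarrow> real" where "hyp p = \<bar>fst p\<bar> - norm (snd p)"

lemma hyp_bounds: "\<bar>hyp p\<bar> \<le> 2 * 2 ^ fL p" "2 ^ fL p \<le> 1 + \<bar>hyp p\<bar>"
proof -
  show "\<bar>hyp p\<bar> \<le> 2 * 2 ^ fL p" using fL_tube_le[of p] by (simp add: hyp_def tube_def)
  have "2 ^ fL p \<le> jbr (hyp p)" unfolding fL_def hyp_def by (rule dy_bounds(1)[OF jbr_ge(1)])
  then show "2 ^ fL p \<le> 1 + \<bar>hyp p\<bar>" using jbr_le[of "hyp p"] by linarith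
qed

text \<open>By the sign pattern the time parts cancel. What is left is the sum of the spatial norms
  of q and r minus that of p, which by the triangle inequality lies between 0 and twice the smaller
  of the two.\<close>

lemma hyp_sum:
  assumes "p + q + r = 0" "\<bar>fst p\<bar> = \<bar>fst q\<bar> + \<bar>fst r\<bar>"
  obtains d where "hyp p = hyp q + hyp r + d" "0 \<le> d" "d \<le> 2 * norm (snd q)" "d \<le> 2 * norm (snd r)"
proof
  have "snd q + snd r + snd p = 0" using arg_cong[OF assms(1), of snd] by (simp add: add_ac)
  then have p: "snd p = - (snd q + snd r)" using minus_unique by metis
  have n: "norm (snd p) = norm (snd q + snd r)" unfolding p by (rule norm_minus_cancel)
  let ?d = "norm (snd q) + norm (snd r) - norm (snd p)"
  show "hyp p = hyp q + hyp r + ?d" using assms(2) by (simp add: hyp_def)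
  show "0 \<le> ?d" using norm_triangle_ineq[of "snd q" "snd r"] n by simp
  show "?d \<le> 2 * norm (snd q)" using norm_diff_ineq[of "snd r" "snd q"] n by (simp add: add.commute)
  show "?d \<le> 2 * norm (snd r)" using norm_diff_ineq[of "snd q" "snd r"] n by simp
qed

text \<open>With M the maximum of the three exponents, the right-hand side plus 1 is at most 9 times
  2^M, which is below 2^(M + 4).\<close>

lemma fL_le:
  assumes "\<bar>hyp p\<bar> \<le> \<bar>hyp q\<bar> + \<bar>hyp r\<bar> + 4 * 2 ^ n"
  shows "fL p \<le> max (max (fL q) (fL r)) n + 3"
proof -
  define M where "M = max (max (fL q) (fL r)) n"
  have M: "(2::real) ^ fL q \<le> 2 ^ M" "(2::real) ^ fL r \<le> 2 ^ M" "(2::real) ^ n \<le> 2 ^ M"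
    by (auto simp: M_def intro!: pow2_le)
  have "(1::real) \<le> 2 ^ M" by simp
  then have "(2::real) ^ fL p < 16 * 2 ^ M" using assms hyp_bounds[of p] hyp_bounds[of q] hyp_bounds[of r] M by linarith
  also have "\<dots> = 2 ^ (M + 4)" by (simp add: power_add)
  finally have "fL p < M + 4" by (subst (asm) power_strict_increasing_iff) auto
  then show ?thesis by (simp add: M_def)
qed

text \<open>The additive relation can be solved for any of the three modulations, with an error
  controlled by either of the two frequencies on the right. The choice of n matters when one of
  these is the low output frequency.\<close>

lemma fL_le3:
  assumes "p + q + r = 0" "\<bar>fst p\<bar> = \<bar>fst q\<bar> + \<bar>fst r\<bar>" "n = fN q \<or> n = fN r"
  shows "fL p \<le> max (max (fL q) (fL r)) n + 3" "fL q \<le> max (max (fL p) (fL r)) n + 3" "fL r \<le> max (max (fL p) (fL q)) n + 3"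
proof -
  obtain d where d: "hyp p = hyp q + hyp r + d" "0 \<le> d" "d \<le> 2 * norm (snd q)" "d \<le> 2 * norm (snd r)"
    using hyp_sum[OF assms(1,2)] by blast
  have "d \<le> 4 * 2 ^ n" using d(3,4) fN_norm_le[of q] fN_norm_le[of r] assms(3) by auto
  then show "fL p \<le> max (max (fL q) (fL r)) n + 3" "fL q \<le> max (max (fL p) (fL r)) n + 3" "fL r \<le> max (max (fL p) (fL q)) n + 3"
    using d(1,2) by (auto intro!: fL_le)
qed

lemma tau_cases:
  assumes "p + q + (r::st) = 0"
  shows "\<bar>fst p\<bar> = \<bar>fst q\<bar> + \<bar>fst r\<bar> \<or> \<bar>fst q\<bar> = \<bar>fst p\<bar> + \<bar>fst r\<bar> \<or> \<bar>fst r\<bar> = \<bar>fst p\<bar> + \<bar>fst q\<bar>"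
  using arg_cong[OF assms, of fst] by (simp add: abs_if)

text \<open>An output of low frequency and low modulation has a small time frequency, and the sign
  pattern then makes those of q and r small too. Their spatial frequencies have size about 2 to the
  power \<open>fN q\<close>, so both points are far from the cone.\<close>

lemma fL_high:
  assumes z: "p + q + r = 0" and P: "\<bar>fst p\<bar> = \<bar>fst q\<bar> + \<bar>fst r\<bar>" and n: "fN p + 5 < fN q" "fN q \<le> fN r + 1"
    and lo: "fL p + 6 < fN q"
  shows "fN q \<le> fL q + 6 \<and> fN q \<le> fL r + 6"
proof -
  define N :: real where "N = 2 ^ fN q"
  have N: "64 * 2 ^ fN p \<le> N" "128 * 2 ^ fL p \<le> N"
    using pow2_le[of "fN p + 6" "fN q"] pow2_le[of "fL p + 7" "fN q"] n lo by (auto simp: N_def power_add)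
  have q: "N / 2 \<le> norm (snd q)" using fN_norm_ge[of q] n by (simp add: N_def)
  have "N / 2 \<le> 2 ^ fN r" using pow2_le[OF n(2)] by (simp add: N_def)
  moreover have "2 ^ fN r / 2 \<le> norm (snd r)" using n by (intro fN_norm_ge) simp
  ultimately have r: "N / 4 \<le> norm (snd r)" by linarith
  have "\<bar>fst p\<bar> \<le> norm (snd p) + \<bar>hyp p\<bar>" by (simp add: hyp_def)
  then have t: "\<bar>fst q\<bar> + \<bar>fst r\<bar> \<le> N / 16" using P N fN_norm_le[of p] hyp_bounds(1)[of p] by linarith
  have "N / 8 \<le> \<bar>hyp q\<bar>" "N / 8 \<le> \<bar>hyp r\<bar>" using t q r unfolding hyp_def by linarith+
  then have *: "N \<le> 16 * 2 ^ fL q" "N \<le> 16 * 2 ^ fL r" using hyp_bounds(1)[of q] hyp_bounds(1)[of r] by linarith+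
  have "fN q \<le> m + 4" if "N \<le> 16 * 2 ^ m" for m
  proof -
    have "(2::real) ^ fN q \<le> 2 ^ (m + 4)" using that by (simp add: N_def power_add)
    then show ?thesis by (subst (asm) power_increasing_iff) auto
  qed
  then show ?thesis using * by fastforce
qed

text \<open>The offset 8 in A is 3 + 5: the first part comes from the relation between the
  modulations, the second from n1 \<le> n0 + 5. The disjuncts are the index regions of the cones;
  the last one is split further according to the position of n0 relative to l1 and l2.\<close>

lemma region_cover:
  fixes n0 l0 n1 l1 n2 l2 :: nat
  assumes b: "base n0 n1 n2 l1 l2"
    and A: "\<not> P \<or> n1 \<le> n0 + 5 \<Longrightarrow> l0 \<le> max (max l1 l2) n0 + 8 \<and> l1 \<le> max (max l0 l2) n0 + 8 \<and> l2 \<le> max (max l0 l1) n0 + 8"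
    and B: "P \<Longrightarrow> n0 + 5 < n1 \<Longrightarrow> l0 \<le> max (max l1 l2) n1 + 3 \<and> l1 \<le> max (max l0 l2) n1 + 3 \<and> l2 \<le> max (max l0 l1) n1 + 3"
    and C: "P \<Longrightarrow> n0 + 5 < n1 \<Longrightarrow> n1 \<le> l0 + 6 \<or> n1 \<le> l1 + 6 \<and> n1 \<le> l2 + 6"
  shows "(n1 + l2 \<le> n0 + l0 \<and> l0 \<le> n0 + 10) \<or> (l2 \<le> l0 \<and> n0 + l0 \<le> n1 + l2 \<and> l0 \<le> n0 + 10) \<or>
     (l1 \<le> l0 \<and> l0 \<le> l2 \<and> l2 \<le> n0 + 10) \<or> (l0 \<le> l1 \<and> l2 \<le> n0 + 10) \<or>
     (l2 \<le> l1 + 10 \<and> l0 \<le> n0 \<and> n0 \<le> l2) \<or> (l2 \<le> l1 + 10 \<and> n0 \<le> l0 \<and> l0 \<le> l2) \<or>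
     (l0 \<le> l2 + 10 \<and> l2 \<le> l0 + 10 \<and> l1 \<le> n0 \<and> n0 \<le> l2 + 10) \<or> (l0 \<le> l2 + 10 \<and> l2 \<le> l0 + 10 \<and> n0 \<le> l1) \<or>
     P \<and> n0 + 5 < n1 \<and> n1 \<le> l0 + 6 \<and> l0 \<le> n1 + 3 \<and> l2 \<le> l0"
proof (cases "\<not> P \<or> n1 \<le> n0 + 5")
  case True
  with A b show ?thesis unfolding base_def max_def by (cases "l0 \<le> n0 + 10 \<and> l2 \<le> n0 + 10") (simp split: if_splits; linarith)+
next
  case False
  then have BB: "l0 \<le> max (max l1 l2) n1 + 3 \<and> l1 \<le> max (max l0 l2) n1 + 3 \<and> l2 \<le> max (max l0 l1) n1 + 3" "n1 \<le> l0 + 6 \<or> n1 \<le> l1 + 6 \<and> n1 \<le> l2 + 6"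
    using B C by auto
  with False b show ?thesis unfolding base_def max_def by (simp split: if_splits; linarith)
qed

text \<open>The hypotheses as linear equalities and inequalities without maxima, so that linear
  arithmetic can decide each demand of a cone, and in a form stable under permuting the three
  columns. Given the inequalities, equality with a maximum is a disjunction of equalities.\<close>

definition Hyp :: "real \<Rightarrow> real \<Rightarrow> real \<Rightarrow> real \<Rightarrow> real \<Rightarrow> real \<Rightarrow> bool" where
  "Hyp s0 s1 s2 b0 b1 b2 \<longleftrightarrow>
    (b0 + b1 + b2 \<ge> 1/2 \<and> b0 + b1 \<ge> 0 \<and> b0 + b2 \<ge> 0 \<and> b1 + b2 \<ge> 0) \<and>
    (s0 + s1 + s2 \<ge> 2 - b0 - b1 - b2 \<and> s0 + s1 + s2 \<ge> 3/2 - b0 - b1 \<and> s0 + s1 + s2 \<ge> 3/2 - b0 - b2 \<and> s0 + s1 + s2 \<ge> 3/2 - b1 - b2) \<and>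
    (s0 + s1 + s2 \<ge> 1 - b0 \<and> s0 + s1 + s2 \<ge> 1 - b1 \<and> s0 + s1 + s2 \<ge> 1 - b2 \<and> s0 + s1 + s2 \<ge> 1) \<and>
    (s0 + b0 + 2 * s1 + 2 * s2 \<ge> 3/2 \<and> 2 * s0 + s1 + b1 + 2 * s2 \<ge> 3/2 \<and> 2 * s0 + 2 * s1 + s2 + b2 \<ge> 3/2) \<and>
    (s1 + s2 \<ge> - b0 \<and> s0 + s2 \<ge> - b1 \<and> s0 + s1 \<ge> - b2 \<and> s1 + s2 \<ge> 0 \<and> s0 + s2 \<ge> 0 \<and> s0 + s1 \<ge> 0) \<and>
    (b0 + b1 = 0 \<longrightarrow> b2 \<noteq> 1/2) \<and> (b0 + b2 = 0 \<longrightarrow> b1 \<noteq> 1/2) \<and> (b1 + b2 = 0 \<longrightarrow> b0 \<noteq> 1/2) \<and>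
    (let S = s0 + s1 + s2;
         e1 = (S = 2 - b0 - b1 - b2);
         e2 = (S = 3/2 - b0 - b1 \<or> S = 3/2 - b0 - b2 \<or> S = 3/2 - b1 - b2);
         e3 = (S = 1 - b0 \<or> S = 1 - b1 \<or> S = 1 - b2 \<or> S = 1)
     in \<not> (e1 \<and> e2) \<and> \<not> (e1 \<and> e3) \<and> \<not> (e2 \<and> e3) \<and>
        ((e1 \<or> e2 \<or> e3) \<longrightarrow> s1 + s2 \<noteq> 0 \<and> s0 + s2 \<noteq> 0 \<and> s0 + s1 \<noteq> 0 \<and> s1 + s2 \<noteq> - b0 \<and> s0 + s2 \<noteq> - b1 \<and> s0 + s1 \<noteq> - b2 \<and>
           s0 + b0 + 2 * s1 + 2 * s2 \<noteq> 3/2 \<and> 2 * s0 + s1 + b1 + 2 * s2 \<noteq> 3/2 \<and> 2 * s0 + 2 * s1 + s2 + b2 \<noteq> 3/2)) \<and>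
    \<not> (s1 + s2 = 0 \<and> s0 + b0 + 2 * s1 + 2 * s2 = 3/2) \<and> \<not> (s0 + s2 = 0 \<and> 2 * s0 + s1 + b1 + 2 * s2 = 3/2) \<and> \<not> (s0 + s1 = 0 \<and> 2 * s0 + 2 * s1 + s2 + b2 = 3/2)"

lemma Hyp_swap01: "Hyp s0 s1 s2 b0 b1 b2 \<Longrightarrow> Hyp s1 s0 s2 b1 b0 b2"
  unfolding Hyp_def Let_def by argo

lemma Hyp_swap12: "Hyp s0 s1 s2 b0 b1 b2 \<Longrightarrow> Hyp s0 s2 s1 b0 b2 b1"
  unfolding Hyp_def Let_def by argo

text \<open>Permutations of the variables carry this set onto the remaining configurations: there
  are three choices of the lowest frequency and two orders of the other two modulations.\<close>

definition Om0 where "Om0 = Om (\<lambda>n0 l0 n1 l1 n2 l2. base n0 n1 n2 l1 l2) False"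

lemma Om0_cover:
  "Om0 \<subseteq> Om (\<lambda>n0 l0 n1 l1 n2 l2. base n0 n1 n2 l1 l2 \<and> n1 + l2 \<le> n0 + l0 \<and> l0 \<le> n0 + 10) False \<union>
    (Om (\<lambda>n0 l0 n1 l1 n2 l2. base n0 n1 n2 l1 l2 \<and> l2 \<le> l0 \<and> n0 + l0 \<le> n1 + l2 \<and> l0 \<le> n0 + 10) False \<union>
    (Om (\<lambda>n0 l0 n1 l1 n2 l2. base n0 n1 n2 l1 l2 \<and> l1 \<le> l0 \<and> l0 \<le> l2 \<and> l2 \<le> n0 + 10) False \<union>
    (Om (\<lambda>n0 l0 n1 l1 n2 l2. base n0 n1 n2 l1 l2 \<and> l0 \<le> l1 \<and> l2 \<le> n0 + 10) False \<union>
    (Om (\<lambda>n0 l0 n1 l1 n2 l2. base n0 n1 n2 l1 l2 \<and> l2 \<le> l1 + 10 \<and> l0 \<le> n0 \<and> n0 \<le> l2) False \<union>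
    (Om (\<lambda>n0 l0 n1 l1 n2 l2. base n0 n1 n2 l1 l2 \<and> l2 \<le> l1 + 10 \<and> n0 \<le> l0 \<and> l0 \<le> l2) False \<union>
    (Om (\<lambda>n0 l0 n1 l1 n2 l2. base n0 n1 n2 l1 l2 \<and> l0 \<le> l2 + 10 \<and> l2 \<le> l0 + 10 \<and> l1 \<le> n0 \<and> n0 \<le> l2 + 10) False \<union>
    (Om (\<lambda>n0 l0 n1 l1 n2 l2. base n0 n1 n2 l1 l2 \<and> l0 \<le> l2 + 10 \<and> l2 \<le> l0 + 10 \<and> n0 \<le> l1) False \<union>
    (Om (\<lambda>n0 l0 n1 l1 n2 l2. base n0 n1 n2 l1 l2 \<and> n0 + 5 < n1 \<and> n1 \<le> l0 + 6 \<and> l0 \<le> n1 + 3 \<and> l2 \<le> l0 \<and> l2 \<le> n0) True \<union>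
    (Om (\<lambda>n0 l0 n1 l1 n2 l2. base n0 n1 n2 l1 l2 \<and> n0 + 5 < n1 \<and> n1 \<le> l0 + 6 \<and> l0 \<le> n1 + 3 \<and> l2 \<le> l0 \<and> l1 \<le> n0 \<and> n0 \<le> l2) True \<union>
    Om (\<lambda>n0 l0 n1 l1 n2 l2. base n0 n1 n2 l1 l2 \<and> n0 + 5 < n1 \<and> n1 \<le> l0 + 6 \<and> l0 \<le> n1 + 3 \<and> l2 \<le> l0 \<and> n0 \<le> l1) True)))))))))" (is "_ \<subseteq> ?R")
proof
  fix x assume "x \<in> Om0"
  then obtain p q r where xp: "x = (p, q, r)" and x: "(p, q, r) \<in> Om0" by (cases x) auto
  define P where "P \<longleftrightarrow> \<bar>fst p\<bar> = \<bar>fst q\<bar> + \<bar>fst r\<bar>"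
  have z: "p + q + r = 0" and b: "base (fN p) (fN q) (fN r) (fL q) (fL r)" using x by (auto simp: Om0_def Om_def)
  have P1: "fL p \<le> max (max (fL q) (fL r)) (fN q) + 3" "fL q \<le> max (max (fL p) (fL r)) (fN q) + 3" "fL r \<le> max (max (fL p) (fL q)) (fN q) + 3"
    if P using fL_le3[OF z, of "fN q"] that by (auto simp: P_def)
  \<comment> \<open>Without the flag, p is one of the two summands in the sign pattern, so the error
    is controlled by its low frequency.\<close>
  have P2: "fL p \<le> max (max (fL q) (fL r)) (fN p) + 3 \<and> fL q \<le> max (max (fL p) (fL r)) (fN p) + 3 \<and> fL r \<le> max (max (fL p) (fL q)) (fN p) + 3"
    if "\<not> P"
  proof -
    from tau_cases[OF z] that consider "\<bar>fst q\<bar> = \<bar>fst p\<bar> + \<bar>fst r\<bar>" | "\<bar>fst r\<bar> = \<bar>fst p\<bar> + \<bar>fst q\<bar>" by (auto simp: P_def)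
    then show ?thesis
    proof cases
      case 1
      have "q + p + r = 0" using z by (simp add: add_ac)
      from fL_le3[OF this 1, of "fN p"] show ?thesis by (simp add: max.commute)
    next
      case 2
      have "r + p + q = 0" using z by (simp add: add_ac)
      from fL_le3[OF this 2, of "fN p"] show ?thesis by (simp add: max.commute)
    qed
  qed
  have "\<not> P \<or> fN q \<le> fN p + 5 \<Longrightarrow> fL p \<le> max (max (fL q) (fL r)) (fN p) + 8 \<and> fL q \<le> max (max (fL p) (fL r)) (fN p) + 8 \<and> fL r \<le> max (max (fL p) (fL q)) (fN p) + 8"
    using P1 P2 by (cases P) (auto simp: max_def split: if_splits)
  moreover have "P \<Longrightarrow> fN p + 5 < fN q \<Longrightarrow> fN q \<le> fL p + 6 \<or> fN q \<le> fL q + 6 \<and> fN q \<le> fL r + 6"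
    using fL_high[OF z] b by (auto simp: P_def base_def)
  ultimately have "(fN q + fL r \<le> fN p + fL p \<and> fL p \<le> fN p + 10) \<or> (fL r \<le> fL p \<and> fN p + fL p \<le> fN q + fL r \<and> fL p \<le> fN p + 10) \<or>
     (fL q \<le> fL p \<and> fL p \<le> fL r \<and> fL r \<le> fN p + 10) \<or> (fL p \<le> fL q \<and> fL r \<le> fN p + 10) \<or>
     (fL r \<le> fL q + 10 \<and> fL p \<le> fN p \<and> fN p \<le> fL r) \<or> (fL r \<le> fL q + 10 \<and> fN p \<le> fL p \<and> fL p \<le> fL r) \<or>
     (fL p \<le> fL r + 10 \<and> fL r \<le> fL p + 10 \<and> fL q \<le> fN p \<and> fN p \<le> fL r + 10) \<or> (fL p \<le> fL r + 10 \<and> fL r \<le> fL p + 10 \<and> fN p \<le> fL q) \<or>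
     P \<and> fN p + 5 < fN q \<and> fN q \<le> fL p + 6 \<and> fL p \<le> fN q + 3 \<and> fL r \<le> fL p"
    using P1 by (intro region_cover[OF b]) auto
  moreover have "fL r \<le> fN p \<or> fL q \<le> fN p \<and> fN p \<le> fL r \<or> fN p \<le> fL q" by linarith
  ultimately show "x \<in> ?R"
    using b z unfolding xp Un_iff Om_def mem_Collect_eq prod.case P_def by argo
qed

text \<open>The conditions g exclude coincidences that the rules permit, such as S = 1 and b0 = 0,
  where \<open>k9\<close> and \<open>k12\<close> vanish together, or s1 + s2 = b0 = b2 = 0 with S >
  3/2, where \<open>ka\<close> and \<open>k16\<close> do.\<close>

lemma kb_Om0_generic:
  assumes H: "Hyp s0 s1 s2 b0 b1 b2"
    and g: "b0 = 0 \<longrightarrow> s0 + s1 + s2 \<noteq> 1" "b1 = 0 \<longrightarrow> s0 + s1 + s2 \<noteq> 1" "b2 = 0 \<longrightarrow> s0 + s1 + s2 \<noteq> 1"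
      "b0 = 0 \<and> b1 = 0 \<longrightarrow> s0 + s1 + s2 \<le> 3/2" "b0 = 0 \<and> b2 = 0 \<longrightarrow> s0 + s1 + s2 \<le> 3/2" "b1 = 0 \<and> b2 = 0 \<longrightarrow> s0 + s1 + s2 \<le> 3/2"
  shows "kb (\<lambda>x. indicator Om0 x * WW s0 s1 s2 b0 b1 b2 x)"
proof -
  note h = H[unfolded Hyp_def Let_def] g
  show ?thesis
    apply (rule kb_mono[OF _ Om0_cover])
    apply (intro kb_Un Om_sets sets.Un WW_measurable)
              apply (rule cone_alpha; (use h in argo))
             apply (rule cone_beta1; (use h in argo))
            apply (rule cone_beta2; (use h in argo))
           apply (rule cone_beta3; (use h in argo))
          apply (rule cone_b12a; (use h in argo))
         apply (rule cone_b12b; (use h in argo))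
        apply (rule cone_b02a; (use h in argo))
       apply (rule cone_b02b; (use h in argo))
      apply (rule cone_c1; (use h in argo))
     apply (rule cone_c2a; (use h in argo))
    apply (rule cone_c2b; (use h in argo))
    done
qed

lemma kb_Om0:
  assumes H: "Hyp s0 s1 s2 b0 b1 b2"
  shows "kb (\<lambda>x. indicator Om0 x * WW s0 s1 s2 b0 b1 b2 x)"
proof -
  note h = H[unfolded Hyp_def Let_def]
  consider "b0 = 0" "s0 = 1 - s1 - s2" | "b1 = 0" "s0 = 1 - s1 - s2" | "b2 = 0" "s0 = 1 - s1 - s2"
    | "b0 = 0" "b1 = 0" "s0 + s1 + s2 > 3/2" | "b0 = 0" "b2 = 0" "s0 + s1 + s2 > 3/2" | "b1 = 0" "b2 = 0" "s0 + s1 + s2 > 3/2"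
    | "(b0 = 0 \<longrightarrow> s0 + s1 + s2 \<noteq> 1) \<and> (b1 = 0 \<longrightarrow> s0 + s1 + s2 \<noteq> 1) \<and> (b2 = 0 \<longrightarrow> s0 + s1 + s2 \<noteq> 1) \<and>
      (b0 = 0 \<and> b1 = 0 \<longrightarrow> s0 + s1 + s2 \<le> 3/2) \<and> (b0 = 0 \<and> b2 = 0 \<longrightarrow> s0 + s1 + s2 \<le> 3/2) \<and> (b1 = 0 \<and> b2 = 0 \<longrightarrow> s0 + s1 + s2 \<le> 3/2)"
    by argo
  then show ?thesis
  proof cases
    case 1 show ?thesis unfolding Om0_def by (rule collapsed0; (use h 1 in argo))
  next
    case 2 show ?thesis unfolding Om0_def by (rule collapsed1; (use h 2 in argo))
  next
    case 3 show ?thesis unfolding Om0_def by (rule collapsed2; (use h 3 in argo))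
  next
    case 4 show ?thesis unfolding Om0_def by (rule collapsed01; (use h 4 in argo))
  next
    case 5 show ?thesis unfolding Om0_def by (rule collapsed02; (use h 5 in argo))
  next
    case 6 show ?thesis unfolding Om0_def by (rule collapsed12; (use h 6 in argo))
  next
    case 7 then show ?thesis by (intro kb_Om0_generic[OF H]) auto
  qed
qed

definition Z3 :: "(st \<times> st \<times> st) set" where "Z3 = {(p, q, r). p + q + r = 0}"

lemma kb_total:
  assumes H: "Hyp s0 s1 s2 b0 b1 b2"
  shows "kb (\<lambda>x. indicator Z3 x * WW s0 s1 s2 b0 b1 b2 x)"
proof -
  define A where "A = Om (\<lambda>n0 l0 n1 l1 n2 l2. n0 \<le> n1 \<and> n0 \<le> n2) False"
  define B where "B = Om (\<lambda>n0 l0 n1 l1 n2 l2. n1 \<le> n0 \<and> n1 \<le> n2) False"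
  define C where "C = Om (\<lambda>n0 l0 n1 l1 n2 l2. n2 \<le> n0 \<and> n2 \<le> n1) False"
  define Om1 where "Om1 = {(p, q, r). (p, r, q) \<in> Om0}"
  have Om0m: "Om0 \<in> sets st3" unfolding Om0_def by (rule Om_sets)
  have kA: "kb (\<lambda>x. indicator A x * WW s0 s1 s2 b0 b1 b2 x)" if H: "Hyp s0 s1 s2 b0 b1 b2" for s0 s1 s2 b0 b1 b2
  proof (rule kb_mono[of "Om0 \<union> Om1"])
    have "kb (\<lambda>x. indicator Om1 x * WW s0 s1 s2 b0 b1 b2 x)"
    proof (rule kb_swap12)
      show "Om1 \<in> sets st3" unfolding Om1_def by (rule perm_sets(2)[OF Om0m])
      have "{(p, q, r). (p, r, q) \<in> Om1} = Om0" by (auto simp: Om1_def)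
      then show "kb (\<lambda>x. indicator {(p, q, r). (p, r, q) \<in> Om1} x * WW s0 s2 s1 b0 b2 b1 x)"
        using kb_Om0[OF Hyp_swap12[OF H]] by simp
    qed
    then show "kb (\<lambda>x. indicator (Om0 \<union> Om1) x * WW s0 s1 s2 b0 b1 b2 x)"
      using kb_Om0[OF H] Om0m perm_sets(2)[OF Om0m] by (intro kb_Un WW_measurable) (simp_all add: Om1_def)
    show "A \<subseteq> Om0 \<union> Om1"
    proof clarify
      fix p q r assume x: "(p, q, r) \<in> A" "(p, q, r) \<notin> Om1"
      have z: "p + q + r = 0" "p + r + q = 0" and n: "fN p \<le> fN q" "fN p \<le> fN r" using x by (auto simp: A_def Om_def add_ac)
      have "fN r \<le> fN q + 1" "fN q \<le> fN r + 1" using fN_triangle[OF z(1)] fN_triangle[OF z(2)] n by auto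
      then show "(p, q, r) \<in> Om0" using x(2) z n by (auto simp: Om1_def Om0_def Om_def base_def)
    qed
  qed
  have kB: "kb (\<lambda>x. indicator B x * WW s0 s1 s2 b0 b1 b2 x)" if H: "Hyp s0 s1 s2 b0 b1 b2" for s0 s1 s2 b0 b1 b2
  proof (rule kb_swap01)
    show "B \<in> sets st3" unfolding B_def by (rule Om_sets)
    have "{(p, q, r). (q, p, r) \<in> B} = A" by (auto simp: A_def B_def Om_def add_ac)
    then show "kb (\<lambda>x. indicator {(p, q, r). (q, p, r) \<in> B} x * WW s1 s0 s2 b1 b0 b2 x)"
      using kA[OF Hyp_swap01[OF H]] by simp
  qed
  have kC: "kb (\<lambda>x. indicator C x * WW s0 s1 s2 b0 b1 b2 x)"
  proof (rule kb_swap12)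
    show "C \<in> sets st3" unfolding C_def by (rule Om_sets)
    have "{(p, q, r). (p, r, q) \<in> C} = B" by (auto simp: C_def B_def Om_def add_ac)
    then show "kb (\<lambda>x. indicator {(p, q, r). (p, r, q) \<in> C} x * WW s0 s2 s1 b0 b2 b1 x)"
      using kB[OF Hyp_swap12[OF H]] by simp
  qed
  show ?thesis
  proof (rule kb_mono[of "A \<union> (B \<union> C)"])
    show "kb (\<lambda>x. indicator (A \<union> (B \<union> C)) x * WW s0 s1 s2 b0 b1 b2 x)"
      using kA[OF H] kB[OF H] kC unfolding A_def B_def C_def by (intro kb_Un WW_measurable sets.Un Om_sets)
    show "Z3 \<subseteq> A \<union> (B \<union> C)" by (auto simp: Z3_def A_def B_def C_def Om_def)
  qed
qed

subsection \<open>Duality\<close>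

text \<open>Testing with F = H0 would give the claim at once if the norm of H0 were known to be
  finite. So H0 is truncated in size and in space, the finite norm of the truncation is divided out,
  and Fatou's lemma removes the truncation.\<close>

lemma kb_duality:
  assumes k: "kb (\<lambda>x. indicator Z3 x * WW s0 s1 s2 b0 b1 b2 x)"
  shows "\<exists>C::real. \<forall>G1 G2 H0. G1 \<in> borel_measurable borel \<longrightarrow> G2 \<in> borel_measurable borel \<longrightarrow> H0 \<in> borel_measurable borel \<longrightarrow>
    (\<forall>p. H0 p < \<top>) \<longrightarrow>
    (\<forall>p. H0 p \<le> ennreal (wt s0 b0 p) * (\<integral>\<^sup>+q. (ennreal (wt s1 b1 q) * G1 q) * (ennreal (wt s2 b2 (p - q)) * G2 (p - q)) \<partial>lborel)) \<longrightarrow>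
    sqn H0 \<le> ennreal C * sqn G1 * sqn G2"
proof -
  obtain C :: real where C: "\<And>F G H. F \<in> borel_measurable borel \<Longrightarrow> G \<in> borel_measurable borel \<Longrightarrow> H \<in> borel_measurable borel \<Longrightarrow>
     (tri (\<lambda>x. indicator Z3 x * WW s0 s1 s2 b0 b1 b2 x * (F (fst x) * G (fst (snd x)) * H (snd (snd x)))))\<^sup>2 \<le> ennreal C * sqn F * sqn G * sqn H"
    using k by (auto simp: kb_def)
  have wt_neg: "wt s b (- p) = wt s b p" for s b p by (simp add: wt_def)
  show ?thesis
  proof (intro exI[of _ C] allI impI)
    fix G1 G2 H0 :: "st \<Rightarrow> ennreal"
    assume [measurable]: "G1 \<in> borel_measurable borel" "G2 \<in> borel_measurable borel" "H0 \<in> borel_measurable borel"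
      and fin: "\<forall>p. H0 p < \<top>"
      and H0: "\<forall>p. H0 p \<le> ennreal (wt s0 b0 p) * (\<integral>\<^sup>+q. (ennreal (wt s1 b1 q) * G1 q) * (ennreal (wt s2 b2 (p - q)) * G2 (p - q)) \<partial>lborel)"
    define K where "K = ennreal C * sqn G1 * sqn G2"
    have pair: "(\<integral>\<^sup>+p. F p * H0 p \<partial>lborel)\<^sup>2 \<le> K * sqn F" if [measurable]: "F \<in> borel_measurable borel" for F
    proof -
      define h where "h p = (\<integral>\<^sup>+q. (ennreal (wt s1 b1 q) * G1 q) * (ennreal (wt s2 b2 (p - q)) * G2 (p - q)) \<partial>lborel)" for p
      have [measurable]: "h \<in> borel_measurable borel" unfolding h_def[abs_def] by measurable
      have "(\<integral>\<^sup>+p. F p * H0 p \<partial>lborel) \<le> (\<integral>\<^sup>+p. F p * (ennreal (wt s0 b0 p) * h p) \<partial>lborel)"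
        using H0 by (intro nn_integral_mono mult_left_mono) (auto simp: h_def)
      \<comment> \<open>In the convolution p is the sum of the two arguments, whereas in the
        trilinear form all three add up to 0; hence p is reflected, and the weights are
        even.\<close>
      also have "\<dots> = (\<integral>\<^sup>+p. F (0 - p) * (ennreal (wt s0 b0 (0 - p)) * h (0 - p)) \<partial>lborel)"
        by (rule nn_integral_reflect[symmetric]) measurable
      also have "\<dots> = tri (\<lambda>x. indicator Z3 x * WW s0 s1 s2 b0 b1 b2 x * (F (- fst x) * G1 (fst (snd x)) * G2 (snd (snd x))))"
        unfolding tri_def
      proof (rule nn_integral_cong)
        fix p :: st
        have "F (0 - p) * (ennreal (wt s0 b0 (0 - p)) * h (0 - p)) = (\<integral>\<^sup>+q. F (- p) * (ennreal (wt s0 b0 p) * ((ennreal (wt s1 b1 q) * G1 q) * (ennreal (wt s2 b2 (- p - q)) * G2 (- p - q)))) \<partial>lborel)"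
          unfolding h_def by (simp add: wt_neg nn_integral_cmult)
        also have "\<dots> = (\<integral>\<^sup>+q. indicator Z3 (p, q, - p - q) * WW s0 s1 s2 b0 b1 b2 (p, q, - p - q) * (F (- fst (p, q, - p - q)) * G1 (fst (snd (p, q, - p - q))) * G2 (snd (snd (p, q, - p - q)))) \<partial>lborel)"
          by (intro nn_integral_cong) (simp add: Z3_def WW_def ennreal_mult wt_pos less_imp_le mult_ac)
        finally show "F (0 - p) * (ennreal (wt s0 b0 (0 - p)) * h (0 - p)) = (\<integral>\<^sup>+q. indicator Z3 (p, q, - p - q) * WW s0 s1 s2 b0 b1 b2 (p, q, - p - q) * (F (- fst (p, q, - p - q)) * G1 (fst (snd (p, q, - p - q))) * G2 (snd (snd (p, q, - p - q)))) \<partial>lborel)" .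
      qed
      finally have "(\<integral>\<^sup>+p. F p * H0 p \<partial>lborel)\<^sup>2 \<le> (tri (\<lambda>x. indicator Z3 x * WW s0 s1 s2 b0 b1 b2 x * ((\<lambda>p. F (- p)) (fst x) * G1 (fst (snd x)) * G2 (snd (snd x)))))\<^sup>2"
        by (simp add: power2_mono_ennreal)
      also have "\<dots> \<le> ennreal C * sqn (\<lambda>p. F (- p)) * sqn G1 * sqn G2" by (rule C) measurable
      also have "sqn (\<lambda>p. F (- p)) = sqn F"
        using nn_integral_reflect[of "\<lambda>p. (F p)\<^sup>2" 0] by (simp add: sqn_def)
      finally show ?thesis by (simp add: K_def mult_ac)
    qed
    define F where "F n p = min (H0 p) (of_nat n) * indicator (cball 0 (real n)) p" for n :: nat and p
    have [measurable]: "cball (0::st) r \<in> sets borel" for r by simp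
    have [measurable]: "F n \<in> borel_measurable borel" for n unfolding F_def[abs_def] by measurable
    have le: "sqn (F n) \<le> K" for n
    proof (cases "sqn (F n) = 0")
      case False
      have "sqn (F n) \<le> (\<integral>\<^sup>+p. (of_nat n)\<^sup>2 * indicator (cball (0::st) (real n)) p \<partial>lborel)"
        unfolding sqn_def by (intro nn_integral_mono) (auto simp: F_def intro!: power2_mono_ennreal split: split_indicator)
      also have "\<dots> = (of_nat n)\<^sup>2 * emeasure lborel (cball (0::st) (real n))"
        by (rule nn_integral_cmult_indicator) simp
      also have "\<dots> < \<top>" using emeasure_lborel_cball_finite[of "0::st" "real n"] by (simp add: ennreal_mult_less_top power2_eq_square of_nat_less_top)
      finally have top: "sqn (F n) \<noteq> \<top>" by simp
      have "sqn (F n) \<le> (\<integral>\<^sup>+p. F n p * H0 p \<partial>lborel)"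
        unfolding sqn_def power2_eq_square by (intro nn_integral_mono mult_left_mono) (auto simp: F_def split: split_indicator)
      then have "(sqn (F n))\<^sup>2 \<le> (\<integral>\<^sup>+p. F n p * H0 p \<partial>lborel)\<^sup>2" by (rule power2_mono_ennreal)
      also have "\<dots> \<le> K * sqn (F n)" by (rule pair) measurable
      finally have "(sqn (F n))\<^sup>2 \<le> K * sqn (F n)" .
      then have "sqn (F n) * sqn (F n) \<le> sqn (F n) * K" by (simp add: power2_eq_square mult.commute)
      then show ?thesis using ennreal_mult_le_mult_iff[OF False top] by simp
    qed simp
    have "sqn H0 \<le> (\<integral>\<^sup>+p. liminf (\<lambda>n. (F n p)\<^sup>2) \<partial>lborel)"
      unfolding sqn_def
    proof (rule nn_integral_mono)
      fix p
      obtain h where h: "H0 p = ennreal h" "h \<ge> 0" using fin by (metis ennreal_cases less_irrefl)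
      \<comment> \<open>Because H0 is finite at p, the truncation is eventually exact there.\<close>
      define N where "N = nat \<lceil>max h (norm p)\<rceil>"
      have "(H0 p)\<^sup>2 \<le> (F n p)\<^sup>2" if "n \<ge> N" for n
      proof -
        have "real N \<ge> max h (norm p)" by (simp add: N_def of_nat_ceiling)
        then have "h \<le> real n" "norm p \<le> real n" using that by (auto intro: order_trans)
        then have "F n p = H0 p" using h by (simp add: F_def min_def ennreal_of_nat_eq_real_of_nat)
        then show ?thesis by simp
      qed
      then show "(H0 p)\<^sup>2 \<le> liminf (\<lambda>n. (F n p)\<^sup>2)"
        by (intro Liminf_bounded) (auto simp: eventually_sequentially)
    qed
    also have "\<dots> \<le> liminf (\<lambda>n. \<integral>\<^sup>+p. (F n p)\<^sup>2 \<partial>lborel)" by (rule nn_integral_liminf) simp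
    also have "\<dots> \<le> liminf (\<lambda>n. K)" using le by (intro Liminf_mono) (simp add: sqn_def)
    also have "\<dots> = K" by (simp add: Liminf_const)
    finally show "sqn H0 \<le> ennreal C * sqn G1 * sqn G2" by (simp add: K_def)
  qed
qed

lemma hsb_sq_eq_sqn: "hsb_sq s b u = sqn (\<lambda>p. ennreal (cmod (ft u p) / wt s b p))"
  unfolding hsb_sq_def sqn_def
proof (rule nn_integral_cong)
  fix p :: st
  have "jbr (norm (snd p)) powr s * jbr (\<bar>fst p\<bar> - norm (snd p)) powr b * cmod (ft u p) = cmod (ft u p) / wt s b p"
    by (simp add: wt_def powr_minus divide_inverse mult_ac)
  moreover have "0 \<le> cmod (ft u p) / wt s b p" using wt_pos[of s b p] by simp
  ultimately show "ennreal ((jbr (norm (snd p)) powr s * jbr (\<bar>fst p\<bar> - norm (snd p)) powr b * cmod (ft u p))\<^sup>2) = (ennreal (cmod (ft u p) / wt s b p))\<^sup>2"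
    by (simp add: ennreal_power)
qed

lemma wt_uminus_params: "wt (- s) (- b) p = 1 / wt s b p"
  by (simp add: wt_def powr_minus divide_inverse)

text \<open>The dual estimate is applied to the transforms divided by their weights. The weight with
  exponents - s0 and - b0 is the reciprocal of the one with s0 and b0, so the pointwise bound by a
  convolution is exactly what duality asks of H0.\<close>

lemma kb_imp_is_product:
  assumes "kb (\<lambda>x. indicator Z3 x * WW s0 s1 s2 b0 b1 b2 x)"
  shows "is_product s0 s1 s2 b0 b1 b2"
proof -
  obtain C :: real where C: "\<forall>G1 G2 H0. G1 \<in> borel_measurable borel \<longrightarrow> G2 \<in> borel_measurable borel \<longrightarrow> H0 \<in> borel_measurable borel \<longrightarrow>
    (\<forall>p. H0 p < \<top>) \<longrightarrow>
    (\<forall>p. H0 p \<le> ennreal (wt s0 b0 p) * (\<integral>\<^sup>+q. (ennreal (wt s1 b1 q) * G1 q) * (ennreal (wt s2 b2 (p - q)) * G2 (p - q)) \<partial>lborel)) \<longrightarrow>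
    sqn H0 \<le> ennreal C * sqn G1 * sqn G2"
    by (rule exE[OF kb_duality[OF assms]])
  show ?thesis unfolding is_product_def
  proof (intro exI[of _ C] allI impI)
    fix u v assume u: "schwartz u" and v: "schwartz v"
    have [measurable]: "u \<in> borel_measurable borel" "v \<in> borel_measurable borel" using u v schwartz_measurable by auto
    have [measurable]: "ft u \<in> borel_measurable borel" "ft v \<in> borel_measurable borel" "ft (\<lambda>p. u p * v p) \<in> borel_measurable borel"
      by (auto intro!: ft_measurable)
    have cancel: "ennreal (wt s b p) * ennreal (cmod z / wt s b p) = ennreal (cmod z)" for s b p z
      using wt_pos[of s b p] by (simp add: ennreal_mult[symmetric])
    show "hsb_sq (- s0) (- b0) (\<lambda>p. u p * v p) \<le> ennreal C * hsb_sq s1 b1 u * hsb_sq s2 b2 v"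
      unfolding hsb_sq_eq_sqn
    proof (rule C[rule_format])
      fix p
      have "ennreal (cmod (ft (\<lambda>p. u p * v p) p)) \<le> (\<integral>\<^sup>+q. ennreal (cmod (ft u q)) * ennreal (cmod (ft v (p - q))) \<partial>lborel)"
        using norm_ft_mult_le[OF v u, of p] by (simp add: mult.commute)
      moreover have "ennreal (cmod (ft (\<lambda>p. u p * v p) p) / wt (- s0) (- b0) p) = ennreal (wt s0 b0 p) * ennreal (cmod (ft (\<lambda>p. u p * v p) p))"
        using wt_pos[of s0 b0 p] by (simp add: wt_uminus_params ennreal_mult[symmetric] mult.commute)
      ultimately show "ennreal (cmod (ft (\<lambda>p. u p * v p) p) / wt (- s0) (- b0) p) \<le> ennreal (wt s0 b0 p) *
         (\<integral>\<^sup>+q. (ennreal (wt s1 b1 q) * ennreal (cmod (ft u q) / wt s1 b1 q)) * (ennreal (wt s2 b2 (p - q)) * ennreal (cmod (ft v (p - q)) / wt s2 b2 (p - q))) \<partial>lborel)"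
        unfolding cancel by (simp add: mult_left_mono)
    qed ((measurable; fail) | simp)+
  qed
qed

section \<open>From the three rules to pairwise exclusions\<close>

lemma at_most_one_pairs4:
  "at_most_one [a, b, c, d] \<Longrightarrow> \<not> (a \<and> b) \<and> \<not> (a \<and> c) \<and> \<not> (b \<and> c) \<and> \<not> (a \<and> d) \<and> \<not> (b \<and> d) \<and> \<not> (c \<and> d)"
  by (auto simp: at_most_one_def split: if_splits)

lemma at_most_one_pairs5:
  "at_most_one [a, b, c, d, e] \<Longrightarrow> \<not> (a \<and> d) \<and> \<not> (b \<and> d) \<and> \<not> (c \<and> d) \<and> \<not> (a \<and> e) \<and> \<not> (b \<and> e) \<and> \<not> (c \<and> e) \<and> \<not> (d \<and> e)"
  by (auto simp: at_most_one_def split: if_splits)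

theorem theorem2:
  fixes s0 s1 s2 b0 b1 b2 :: real
  defines "S \<equiv> s0 + s1 + s2"
  assumes C1: "b0 + b1 + b2 \<ge> 1/2"
    and C2: "b0 + b1 \<ge> 0"
    and C3: "b0 + b2 \<ge> 0"
    and C4: "b1 + b2 \<ge> 0"
    and C5: "S \<ge> 2 - (b0 + b1 + b2)"
    and C6: "S \<ge> 3/2 - (b0 + b1)"
    and C7: "S \<ge> 3/2 - (b0 + b2)"
    and C8: "S \<ge> 3/2 - (b1 + b2)"
    and C9: "S \<ge> 1 - b0"
    and C10: "S \<ge> 1 - b1"
    and C11: "S \<ge> 1 - b2"
    and C12: "S \<ge> 1"
    and C13: "s0 + b0 + 2 * s1 + 2 * s2 \<ge> 3/2"
    and C14: "2 * s0 + s1 + b1 + 2 * s2 \<ge> 3/2"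
    and C15: "2 * s0 + 2 * s1 + s2 + b2 \<ge> 3/2"
    and C16: "s1 + s2 \<ge> - b0"
    and C17: "s0 + s2 \<ge> - b1"
    and C18: "s0 + s1 \<ge> - b2"
    and C19: "s1 + s2 \<ge> 0"
    and C20: "s0 + s2 \<ge> 0"
    and C21: "s0 + s1 \<ge> 0"
    and R1: "\<not> (b0 + b1 + b2 = 1/2 \<and> b0 + b1 + b2 = max b0 (max b1 b2))"
    and R2: "\<And>sj bj. (sj, bj) \<in> {(s0, b0), (s1, b1), (s2, b2)} \<Longrightarrow>
               at_most_one
                 [S = 2 - (b0 + b1 + b2),
                  S = 3/2 + max (- b0 - b1) (max (- b0 - b2) (- b1 - b2)),
                  S = 1 + max (- b0) (max (- b1) (max (- b2) 0)),
                  S = sj + max 0 (- bj)]"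
    and R3: "\<And>sj bj. (sj, bj) \<in> {(s0, b0), (s1, b1), (s2, b2)} \<Longrightarrow>
               at_most_one
                 [S = 2 - (b0 + b1 + b2),
                  S = 3/2 + max (- b0 - b1) (max (- b0 - b2) (- b1 - b2)),
                  S = 1 + max (- b0) (max (- b1) (max (- b2) 0)),
                  S = 3/4 + (sj - bj) / 2,
                  S = sj]"
  shows "is_product s0 s1 s2 b0 b1 b2"
proof -
  define e1 where "e1 \<longleftrightarrow> S = 2 - (b0 + b1 + b2)"
  define e2 where "e2 \<longleftrightarrow> S = 3/2 + max (- b0 - b1) (max (- b0 - b2) (- b1 - b2))"
  define e3 where "e3 \<longleftrightarrow> S = 1 + max (- b0) (max (- b1) (max (- b2) 0))"
  have e1': "S = 2 - b0 - b1 - b2 \<longleftrightarrow> e1" by (auto simp: e1_def)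
  \<comment> \<open>All three lower bounds hold, so equality with the largest means equality in one
    of them.\<close>
  have e2': "(S = 3/2 - b0 - b1 \<or> S = 3/2 - b0 - b2 \<or> S = 3/2 - b1 - b2) \<longleftrightarrow> e2"
    using C6 C7 C8 unfolding e2_def by (simp add: max_def) argo
  have e3': "(S = 1 - b0 \<or> S = 1 - b1 \<or> S = 1 - b2 \<or> S = 1) \<longleftrightarrow> e3"
    using C9 C10 C11 C12 unfolding e3_def by (simp add: max_def) argo
  \<comment> \<open>Since s1 + s2 is at least 0 and at least - b0, equality in either is equality
    with the larger of the two.\<close>
  have E4: "s1 + s2 = 0 \<or> s1 + s2 = - b0 \<longrightarrow> S = s0 + max 0 (- b0)" "s0 + s2 = 0 \<or> s0 + s2 = - b1 \<longrightarrow> S = s1 + max 0 (- b1)"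
      "s0 + s1 = 0 \<or> s0 + s1 = - b2 \<longrightarrow> S = s2 + max 0 (- b2)"
    using C16 C17 C18 C19 C20 C21 by (auto simp: S_def max_def)
  \<comment> \<open>\<open>C13\<close> can be written as 2 S - s0 + b0 \<ge> 3/2, and likewise for
    the other two columns.\<close>
  have E5: "s0 + b0 + 2 * s1 + 2 * s2 = 3/2 \<longleftrightarrow> S = 3/4 + (s0 - b0) / 2" "2 * s0 + s1 + b1 + 2 * s2 = 3/2 \<longleftrightarrow> S = 3/4 + (s1 - b1) / 2"
      "2 * s0 + 2 * s1 + s2 + b2 = 3/2 \<longleftrightarrow> S = 3/4 + (s2 - b2) / 2"
    by (auto simp: S_def field_simps)
  have E6: "s1 + s2 = 0 \<longleftrightarrow> S = s0" "s0 + s2 = 0 \<longleftrightarrow> S = s1" "s0 + s1 = 0 \<longleftrightarrow> S = s2" by (auto simp: S_def)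
  note r2 = R2[THEN at_most_one_pairs4, folded e1_def e2_def e3_def] and r3 = R3[THEN at_most_one_pairs5, folded e1_def e2_def e3_def]
  have r20: "\<not> (e1 \<and> e2) \<and> \<not> (e1 \<and> e3) \<and> \<not> (e2 \<and> e3)" using r2[of s0 b0] by blast
  have r: "(e1 \<or> e2 \<or> e3) \<longrightarrow> S \<noteq> sj + max 0 (- bj) \<and> S \<noteq> 3/4 + (sj - bj) / 2 \<and> S \<noteq> sj" "\<not> (S = 3/4 + (sj - bj) / 2 \<and> S = sj)"
    if "(sj, bj) \<in> {(s0, b0), (s1, b1), (s2, b2)}" for sj bj
    using r2[OF that] r3[OF that] by blast+
  \<comment> \<open>If b0 + b1 = 0 and b2 = 1/2, then \<open>C3\<close> and \<open>C4\<close> bound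
    b0 and b1 by 1/2 in modulus, so b2 is the maximum.\<close>
  have R1': "b0 + b1 = 0 \<longrightarrow> b2 \<noteq> 1/2" "b0 + b2 = 0 \<longrightarrow> b1 \<noteq> 1/2" "b1 + b2 = 0 \<longrightarrow> b0 \<noteq> 1/2"
    using R1 C2 C3 C4 by (auto simp: max_def split: if_splits)
  have X: "(e1 \<or> e2 \<or> e3) \<longrightarrow> s1 + s2 \<noteq> 0 \<and> s0 + s2 \<noteq> 0 \<and> s0 + s1 \<noteq> 0 \<and> s1 + s2 \<noteq> - b0 \<and> s0 + s2 \<noteq> - b1 \<and> s0 + s1 \<noteq> - b2 \<and>
           s0 + b0 + 2 * s1 + 2 * s2 \<noteq> 3/2 \<and> 2 * s0 + s1 + b1 + 2 * s2 \<noteq> 3/2 \<and> 2 * s0 + 2 * s1 + s2 + b2 \<noteq> 3/2"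
    using r(1)[of s0 b0] r(1)[of s1 b1] r(1)[of s2 b2] E4 unfolding E5 by blast
  have Y: "\<not> (s1 + s2 = 0 \<and> s0 + b0 + 2 * s1 + 2 * s2 = 3/2) \<and> \<not> (s0 + s2 = 0 \<and> 2 * s0 + s1 + b1 + 2 * s2 = 3/2) \<and> \<not> (s0 + s1 = 0 \<and> 2 * s0 + 2 * s1 + s2 + b2 = 3/2)"
    using r(2)[of s0 b0] r(2)[of s1 b1] r(2)[of s2 b2] unfolding E5 E6 by blast
  have "Hyp s0 s1 s2 b0 b1 b2"
    unfolding Hyp_def Let_def S_def[symmetric] e1' e2' e3'
    by (intro conjI) (use C1 C2 C3 C4 C5 C6 C7 C8 C9 C10 C11 C12 C13 C14 C15 C16 C17 C18 C19 C20 C21 R1' r20 X Y in \<open>(blast | linarith)+\<close>)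
  then show ?thesis by (intro kb_imp_is_product kb_total)
qed

end
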